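(* Let $\mathfrak{g}=\mathfrak{sl}_2(\mathbb{C})$ and let $\mathfrak{T}=\mathfrak{g}\otimes\mathbb{C}[x]/(x^2)$ be the Takiff Lie algebra of $\mathfrak{sl}_2$. For every infinite-dimensional simple $\mathfrak{g}$-Harish-Chandra module $V$ for $\mathfrak{T}$, we have \[ \operatorname{Ext}^1(V,V)\cong\mathbb{C}, \] where $\operatorname{Ext}^1$ is taken in the category of $\mathfrak{T}$-modules.
   Context: Everything is over $\mathbb{C}$. The bracket on $\mathfrak{T}$ is $[v\otimes x^i,w\otimes x^j]=[v,w]\otimes x^{i+j}$ and $\mathfrak{g}$ is identified with $\mathfrak{g}\otimes 1\subset\mathfrak{T}$. A $\mathfrak{T}$-module is a $\mathfrak{g}$-Harish-Chandra module if its restriction to $\mathfrak{g}$ is a direct sum of simple finite-dimensional $\mathfrak{g}$-modules, each isomorphism class occurring with finite multiplicity. *)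

theory Defs
  imports "HOL-Analysis.Analysis"
begin

section \<open>The Takiff Lie algebra of \<open>sl\<^sub>2\<close>\<close>

definition mat_smult :: "complex \<Rightarrow> complex^2^2 \<Rightarrow> complex^2^2" where
  "mat_smult c A = (\<chi> i j. c * A $ i $ j)"

definition mat_bracket :: "complex^2^2 \<Rightarrow> complex^2^2 \<Rightarrow> complex^2^2" where
  "mat_bracket A B = A ** B - B ** A"

definition sl2 :: "(complex^2^2) set" where
  "sl2 = {A. trace A = 0}"

text \<open>The pair \<open>(A, B)\<close> stands for \<open>A \<otimes> 1 + B \<otimes> x\<close> in \<open>sl\<^sub>2 \<otimes> \<complex>[x]/(x\<^sup>2)\<close>.\<close>

type_synonym takiff_elt = "(complex^2^2) \<times> (complex^2^2)"

definition takiff :: "takiff_elt set" where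
  "takiff = sl2 \<times> sl2"

definition takiff_smult :: "complex \<Rightarrow> takiff_elt \<Rightarrow> takiff_elt" where
  "takiff_smult c X = (mat_smult c (fst X), mat_smult c (snd X))"

definition takiff_bracket :: "takiff_elt \<Rightarrow> takiff_elt \<Rightarrow> takiff_elt" where
  "takiff_bracket X Y =
     (mat_bracket (fst X) (fst Y), mat_bracket (fst X) (snd Y) + mat_bracket (snd X) (fst Y))"

text \<open>The pure tensor \<open>A \<otimes> x\<^sup>i\<close>.\<close>

definition takiff_tensor :: "complex^2^2 \<Rightarrow> nat \<Rightarrow> takiff_elt" where
  "takiff_tensor A i = (if i = 0 then (A, 0) else if i = 1 then (0, A) else (0, 0))"

lemma mat_bracket_zero [simp]: "mat_bracket 0 A = 0" "mat_bracket A 0 = 0"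
  by (simp_all add: mat_bracket_def matrix_matrix_mult_def vec_eq_iff)

lemma takiff_bracket_tensor:
  "takiff_bracket (takiff_tensor A i) (takiff_tensor B j) = takiff_tensor (mat_bracket A B) (i + j)"
  by (auto simp: takiff_bracket_def takiff_tensor_def)

lemma takiff_decompose: "X = takiff_tensor (fst X) 0 + takiff_tensor (snd X) 1"
  by (simp add: takiff_tensor_def)

lemma mat_bracket_in_sl2: "mat_bracket A B \<in> sl2"
  by (simp add: mat_bracket_def sl2_def trace_sub trace_mul_sym[of A B])

lemma sl2_add: "A \<in> sl2 \<Longrightarrow> B \<in> sl2 \<Longrightarrow> A + B \<in> sl2"
  by (simp add: sl2_def trace_add)

lemma sl2_smult: "A \<in> sl2 \<Longrightarrow> mat_smult c A \<in> sl2"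
  by (simp add: sl2_def mat_smult_def trace_def flip: sum_distrib_left)

lemma takiff_closed:
  assumes "X \<in> takiff" "Y \<in> takiff"
  shows "X + Y \<in> takiff" "takiff_smult c X \<in> takiff" "takiff_bracket X Y \<in> takiff"
  using assms
  by (auto simp: takiff_def takiff_smult_def takiff_bracket_def sl2_add sl2_smult mat_bracket_in_sl2)

text \<open>\<open>sl\<^sub>2\<close> identified with \<open>sl\<^sub>2 \<otimes> 1\<close>.\<close>

definition takiff_g :: "takiff_elt set" where
  "takiff_g = (\<lambda>A. takiff_tensor A 0) ` sl2"

section \<open>Modules\<close>

text \<open>The underlying abelian group is the whole type \<open>'a\<close>. The action is only meaningful on
  \<^const>\<open>takiff\<close>; its values elsewhere are never used.\<close>

record 'a takiff_struct =
  scal :: "complex \<Rightarrow> 'a \<Rightarrow> 'a"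
  act :: "takiff_elt \<Rightarrow> 'a \<Rightarrow> 'a"

definition takiff_module :: "'a::ab_group_add takiff_struct \<Rightarrow> bool" where
  "takiff_module M \<longleftrightarrow>
     vector_space (scal M) \<and>
     (\<forall>X\<in>takiff. Vector_Spaces.linear (scal M) (scal M) (act M X)) \<and>
     (\<forall>X\<in>takiff. \<forall>Y\<in>takiff. \<forall>v. act M (X + Y) v = act M X v + act M Y v) \<and>
     (\<forall>X\<in>takiff. \<forall>c v. act M (takiff_smult c X) v = scal M c (act M X v)) \<and>
     (\<forall>X\<in>takiff. \<forall>Y\<in>takiff. \<forall>v.
        act M (takiff_bracket X Y) v = act M X (act M Y v) - act M Y (act M X v))"

text \<open>In what follows \<open>L\<close> is the set of acting elements, either \<^const>\<open>takiff\<close> or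
  \<^const>\<open>takiff_g\<close>, so that the same notions serve for modules over both Lie algebras.\<close>

definition submod :: "takiff_elt set \<Rightarrow> 'a::ab_group_add takiff_struct \<Rightarrow> 'a set \<Rightarrow> bool" where
  "submod L M S \<longleftrightarrow> module.subspace (scal M) S \<and> (\<forall>X\<in>L. \<forall>v\<in>S. act M X v \<in> S)"

definition simple_submod :: "takiff_elt set \<Rightarrow> 'a::ab_group_add takiff_struct \<Rightarrow> 'a set \<Rightarrow> bool" where
  "simple_submod L M S \<longleftrightarrow>
     submod L M S \<and> S \<noteq> {0} \<and> (\<forall>U. submod L M U \<and> U \<subseteq> S \<longrightarrow> U = {0} \<or> U = S)"

definition simple_takiff_module :: "'a::ab_group_add takiff_struct \<Rightarrow> bool" where
  "simple_takiff_module M \<longleftrightarrow> takiff_module M \<and> simple_submod takiff M UNIV"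

definition finite_dim :: "'a::ab_group_add takiff_struct \<Rightarrow> 'a set \<Rightarrow> bool" where
  "finite_dim M S \<longleftrightarrow> (\<exists>B. finite B \<and> B \<subseteq> S \<and> module.span (scal M) B = S)"

definition hom_on ::
  "takiff_elt set \<Rightarrow> 'a::ab_group_add set \<Rightarrow> 'a takiff_struct \<Rightarrow> 'b::ab_group_add takiff_struct
     \<Rightarrow> ('a \<Rightarrow> 'b) \<Rightarrow> bool" where
  "hom_on L S M N f \<longleftrightarrow>
     (\<forall>v\<in>S. \<forall>w\<in>S. f (v + w) = f v + f w) \<and>
     (\<forall>c. \<forall>v\<in>S. f (scal M c v) = scal N c (f v)) \<and>
     (\<forall>X\<in>L. \<forall>v\<in>S. f (act M X v) = act N X (f v))"

definition submod_iso ::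
  "takiff_elt set \<Rightarrow> 'a::ab_group_add takiff_struct \<Rightarrow> 'a set \<Rightarrow> 'a set \<Rightarrow> bool" where
  "submod_iso L M S S' \<longleftrightarrow> (\<exists>f. hom_on L S M M f \<and> bij_betw f S S')"

text \<open>\<open>M\<close> is the internal direct sum of the members of \<open>\<S>\<close>. No generality is lost by taking a set
  of submodules instead of an indexed family, since the summands below are nonzero.\<close>

definition is_direct_sum :: "'a::ab_group_add set set \<Rightarrow> bool" where
  "is_direct_sum \<S> \<longleftrightarrow>
     (\<forall>v. \<exists>!f. (\<forall>S\<in>\<S>. f S \<in> S) \<and> (\<forall>S. S \<notin> \<S> \<longrightarrow> f S = 0) \<and>
               finite {S. f S \<noteq> 0} \<and> v = (\<Sum>S | f S \<noteq> 0. f S))"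

definition harish_chandra :: "'a::ab_group_add takiff_struct \<Rightarrow> bool" where
  "harish_chandra M \<longleftrightarrow>
     (\<exists>\<S>. is_direct_sum \<S> \<and>
          (\<forall>S\<in>\<S>. simple_submod takiff_g M S \<and> finite_dim M S) \<and>
          (\<forall>S\<in>\<S>. finite {S'\<in>\<S>. submod_iso takiff_g M S S'}))"

definition prod_struct :: "'a takiff_struct \<Rightarrow> 'b takiff_struct \<Rightarrow> ('a \<times> 'b) takiff_struct" where
  "prod_struct M N =
     \<lparr>scal = (\<lambda>c z. (scal M c (fst z), scal N c (snd z))),
      act = (\<lambda>X z. (act M X (fst z), act N X (snd z)))\<rparr>"

section \<open>Yoneda extensions\<close>

record ('w, 'e, 'v) extension =
  mid :: "'e takiff_struct"
  incl :: "'w \<Rightarrow> 'e"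
  proj :: "'e \<Rightarrow> 'v"

text \<open>Short exact sequences \<open>0 \<rightarrow> W \<rightarrow> E \<rightarrow> V \<rightarrow> 0\<close> of modules over the Takiff algebra.\<close>

definition is_extension ::
  "'w::ab_group_add takiff_struct \<Rightarrow> 'v::ab_group_add takiff_struct
     \<Rightarrow> ('w, 'e::ab_group_add, 'v) extension \<Rightarrow> bool" where
  "is_extension W V E \<longleftrightarrow>
     takiff_module (mid E) \<and>
     hom_on takiff UNIV W (mid E) (incl E) \<and>
     hom_on takiff UNIV (mid E) V (proj E) \<and>
     inj (incl E) \<and> surj (proj E) \<and> range (incl E) = {e. proj E e = 0}"

definition ext_equivalent ::
  "('w, 'e::ab_group_add, 'v) extension \<Rightarrow> ('w, 'f::ab_group_add, 'v) extension \<Rightarrow> bool" where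
  "ext_equivalent E E' \<longleftrightarrow>
     (\<exists>f. hom_on takiff UNIV (mid E) (mid E') f \<and> bij f \<and>
          f \<circ> incl E = incl E' \<and> proj E' \<circ> f = proj E)"

text \<open>The Baer sum of \<open>E1\<close> and \<open>E2\<close> is the quotient of the pullback
  \<open>{(a, b). proj E1 a = proj E2 b}\<close> by \<open>{(incl E1 w, - incl E2 w)}\<close>, with inclusion
  \<open>w \<mapsto> [(incl E1 w, 0)]\<close> and projection \<open>[(a, b)] \<mapsto> proj E1 a\<close>. To stay within types of the same
  shape, the quotient is not formed from cosets: \<open>q\<close> is the quotient map onto \<open>E3\<close>.\<close>

definition is_baer_sum ::
  "('w, 'e1::ab_group_add, 'v) extension \<Rightarrow> ('w, 'e2::ab_group_add, 'v) extension
     \<Rightarrow> ('w, 'e3::ab_group_add, 'v) extension \<Rightarrow> bool" where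
  "is_baer_sum E1 E2 E3 \<longleftrightarrow>
     (let P = {(a, b). proj E1 a = proj E2 b} in
      \<exists>q. hom_on takiff P (prod_struct (mid E1) (mid E2)) (mid E3) q \<and>
          q ` P = UNIV \<and>
          {z\<in>P. q z = 0} = range (\<lambda>w. (incl E1 w, - incl E2 w)) \<and>
          (\<forall>w. incl E3 w = q (incl E1 w, 0)) \<and>
          (\<forall>(a, b)\<in>P. proj E3 (q (a, b)) = proj E1 a))"

text \<open>The multiple \<open>c \<cdot> E\<close> is the pushout of \<open>E\<close> along \<open>c : W \<rightarrow> W\<close>, that is, the quotient of
  \<open>W \<oplus> E\<close> by \<open>{(c w, - incl E w)}\<close>; again \<open>q\<close> is the quotient map onto \<open>E'\<close>.\<close>

definition is_ext_multiple ::
  "'w::ab_group_add takiff_struct \<Rightarrow> complex \<Rightarrow> ('w, 'e::ab_group_add, 'v) extension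
     \<Rightarrow> ('w, 'f::ab_group_add, 'v) extension \<Rightarrow> bool" where
  "is_ext_multiple W c E E' \<longleftrightarrow>
     (\<exists>q. hom_on takiff UNIV (prod_struct W (mid E)) (mid E') q \<and>
          surj q \<and>
          {z. q z = 0} = range (\<lambda>w. (scal W c w, - incl E w)) \<and>
          (\<forall>w. incl E' w = q (w, 0)) \<and>
          (\<forall>w e. proj E' (q (w, e)) = proj E e))"

text \<open>Equivalence classes need a fixed type for the middle term. The type \<open>'w \<times> 'v\<close>, with the scalar
  multiplication and the action left free, is large enough: by \<open>ext_representable\<close> below every
  extension on any type is equivalent to one on \<open>'w \<times> 'v\<close>.\<close>

definition extensions ::
  "'w::ab_group_add takiff_struct \<Rightarrow> 'v::ab_group_add takiff_struct
     \<Rightarrow> ('w, 'w \<times> 'v, 'v) extension set" where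
  "extensions W V = {E. is_extension W V E}"

definition ext_rel ::
  "'w::ab_group_add takiff_struct \<Rightarrow> 'v::ab_group_add takiff_struct
     \<Rightarrow> ('w, 'w \<times> 'v, 'v) extension rel" where
  "ext_rel W V = {(E, E'). E \<in> extensions W V \<and> E' \<in> extensions W V \<and> ext_equivalent E E'}"

definition Ext1 ::
  "'w::ab_group_add takiff_struct \<Rightarrow> 'v::ab_group_add takiff_struct
     \<Rightarrow> ('w, 'w \<times> 'v, 'v) extension set set" where
  "Ext1 W V = extensions W V // ext_rel W V"

definition Ext1_add ::
  "'w::ab_group_add takiff_struct \<Rightarrow> 'v::ab_group_add takiff_struct
     \<Rightarrow> ('w, 'w \<times> 'v, 'v) extension set \<Rightarrow> ('w, 'w \<times> 'v, 'v) extension set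
     \<Rightarrow> ('w, 'w \<times> 'v, 'v) extension set" where
  "Ext1_add W V \<alpha> \<beta> = {E3 \<in> extensions W V. \<exists>E1\<in>\<alpha>. \<exists>E2\<in>\<beta>. is_baer_sum E1 E2 E3}"

definition Ext1_scale ::
  "'w::ab_group_add takiff_struct \<Rightarrow> 'v::ab_group_add takiff_struct \<Rightarrow> complex
     \<Rightarrow> ('w, 'w \<times> 'v, 'v) extension set \<Rightarrow> ('w, 'w \<times> 'v, 'v) extension set" where
  "Ext1_scale W V c \<alpha> = {E' \<in> extensions W V. \<exists>E\<in>\<alpha>. is_ext_multiple W c E E'}"

lemma hom_onD:
  assumes "hom_on L S M N f" "v \<in> S"
  shows "w \<in> S \<Longrightarrow> f (v + w) = f v + f w" "f (scal M c v) = scal N c (f v)"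
    "X \<in> L \<Longrightarrow> f (act M X v) = act N X (f v)"
  using assms by (auto simp only: hom_on_def)

lemma hom_on_cancel:
  assumes "hom_on L UNIV M N f"
  shows "f 0 = 0" "f (- v) = - f v" "f (v - w) = f v - f w"
proof -
  interpret additive f
    by unfold_locales (use assms in \<open>simp add: hom_on_def\<close>)
  show "f 0 = 0" "f (- v) = - f v" "f (v - w) = f v - f w"
    by (fact zero, fact minus, fact diff)
qed

lemma equiv_ext_rel: "equiv (extensions W V) (ext_rel W V)"
proof (rule equivI)
  show "ext_rel W V \<subseteq> extensions W V \<times> extensions W V"
    by (auto simp: ext_rel_def)
  show "refl_on (extensions W V) (ext_rel W V)"
    by (auto simp: refl_on_def ext_rel_def ext_equivalent_def hom_on_def intro!: exI[of _ id])
  show "sym (ext_rel W V)"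
  proof (rule symI)
    fix E E' assume "(E, E') \<in> ext_rel W V"
    then obtain f where E: "E \<in> extensions W V" "E' \<in> extensions W V"
      and f: "hom_on takiff UNIV (mid E) (mid E') f" "bij f"
        "f \<circ> incl E = incl E'" "proj E' \<circ> f = proj E"
      by (auto simp: ext_rel_def ext_equivalent_def)
    define g where "g = inv f"
    have fg: "f (g y) = y" and gf: "g (f x) = x" for x y
      using \<open>bij f\<close> by (simp_all add: g_def bij_def surj_f_inv_f inv_f_f)
    have "hom_on takiff UNIV (mid E') (mid E) g"
      unfolding hom_on_def
    proof (intro conjI ballI allI)
      fix v w show "g (v + w) = g v + g w"
        using hom_onD(1)[OF f(1), of "g v" "g w"] gf[of "g v + g w"] by (simp add: fg)
    next
      fix c v show "g (scal (mid E') c v) = scal (mid E) c (g v)"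
        using hom_onD(2)[OF f(1), of "g v" c] gf[of "scal (mid E) c (g v)"] by (simp add: fg)
    next
      fix X v assume "X \<in> takiff" then show "g (act (mid E') X v) = act (mid E) X (g v)"
        using hom_onD(3)[OF f(1), of "g v" X] gf[of "act (mid E) X (g v)"] by (simp add: fg)
    qed
    moreover have "bij g" using \<open>bij f\<close> by (simp add: g_def bij_imp_bij_inv)
    moreover have "g \<circ> incl E' = incl E" "proj E \<circ> g = proj E'"
      unfolding f(3,4)[symmetric] by (simp_all add: fun_eq_iff gf fg del: split_paired_All)
    ultimately show "(E', E) \<in> ext_rel W V"
      using E by (auto simp: ext_rel_def ext_equivalent_def)
  qed
  show "trans (ext_rel W V)"
  proof (rule transI)
    fix E E' E'' assume "(E, E') \<in> ext_rel W V" "(E', E'') \<in> ext_rel W V"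
    then obtain f g where E: "E \<in> extensions W V" "E'' \<in> extensions W V"
      and f: "hom_on takiff UNIV (mid E) (mid E') f" "bij f"
        "f \<circ> incl E = incl E'" "proj E' \<circ> f = proj E"
      and g: "hom_on takiff UNIV (mid E') (mid E'') g" "bij g"
        "g \<circ> incl E' = incl E''" "proj E'' \<circ> g = proj E'"
      by (auto simp: ext_rel_def ext_equivalent_def)
    have "hom_on takiff UNIV (mid E) (mid E'') (g \<circ> f)"
      using f(1) g(1) by (simp add: hom_on_def del: split_paired_All)
    moreover have "bij (g \<circ> f)" using f(2) g(2) by (rule bij_comp)
    moreover have "(g \<circ> f) \<circ> incl E = incl E''" "proj E'' \<circ> (g \<circ> f) = proj E"
      using f(3,4) g(3,4) by (simp_all add: fun_eq_iff del: split_paired_All)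
    ultimately show "(E, E'') \<in> ext_rel W V"
      using E by (auto simp: ext_rel_def ext_equivalent_def)
  qed
qed

lemma ext_representable:
  fixes W :: "'w::ab_group_add takiff_struct" and V :: "'v::ab_group_add takiff_struct"
    and E :: "('w, 'e::ab_group_add, 'v) extension"
  assumes "takiff_module V" and E: "is_extension W V E"
  shows "\<exists>E'\<in>extensions W V. ext_equivalent E E'"
proof -
  let ?M = "mid E" and ?i = "incl E" and ?p = "proj E"
  have M: "takiff_module ?M" and hi: "hom_on takiff UNIV W ?M ?i" and hp: "hom_on takiff UNIV ?M V ?p"
    and inj: "inj ?i" and surj: "surj ?p" and ker: "range ?i = {e. ?p e = 0}"
    using E by (auto simp: is_extension_def)
  interpret vector_space_pair "scal ?M" "scal V"
    using M assms(1) by (simp add: vector_space_pair_def takiff_module_def)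
  have "Vector_Spaces.linear (scal ?M) (scal V) ?p"
    using hp by (simp add: Vector_Spaces.linear_iff hom_on_def vs1.vector_space_axioms vs2.vector_space_axioms)
  from linear_surjective_right_inverse[OF this surj] obtain s
    where s: "Vector_Spaces.linear (scal V) (scal ?M) s" and ps: "\<And>v. ?p (s v) = v"
    by (auto simp: fun_eq_iff)
  have s_add: "s (a + b) = s a + s b" for a b
    using s by (simp add: Vector_Spaces.linear_iff)
  note i_simps = hom_on_cancel[OF hi] and p_simps = hom_on_cancel[OF hp]
  have pi: "?p (?i w) = 0" for w using ker by blast
  have p_add: "?p (a + b) = ?p a + ?p b" and i_add: "?i (u + w) = ?i u + ?i w" for a b u w
    using hp hi by (simp_all add: hom_on_def)
  define r where "r e = inv ?i (e - s (?p e))" for e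
  have ir: "?i (r e) = e - s (?p e)" for e
  proof -
    have "?p (e - s (?p e)) = 0" by (simp add: p_simps ps)
    then have "e - s (?p e) \<in> range ?i" using ker by simp
    then show ?thesis by (simp add: r_def f_inv_into_f)
  qed
  define f where "f e = (r e, ?p e)" for e
  define g where "g z = ?i (fst z) + s (snd z)" for z
  have gf: "g (f e) = e" for e by (simp add: f_def g_def ir)
  have g_add: "g (y + z) = g y + g z" for y z
    by (simp add: g_def s_add i_add)
  have fg: "f (g z) = z" for z
  proof -
    have "?p (g z) = snd z" by (simp add: g_def p_add pi ps)
    moreover from this have "?i (r (g z)) = ?i (fst z)" by (simp add: ir g_def)
    ultimately show ?thesis using inj by (simp add: f_def inj_eq prod_eq_iff)
  qed
  have f_add: "f (a + b) = f a + f b" for a b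
    using fg[of "f a + f b"] by (simp add: g_add gf)
  have f_diff: "f (a - b) = f a - f b" for a b
    using f_add[of "a - b" b] by (simp add: algebra_simps)
  have bij: "bij f" by (rule bij_betw_byWitness[where f' = g]) (auto simp: fg gf)
  define N where "N = \<lparr>scal = (\<lambda>c z. f (scal ?M c (g z))), act = (\<lambda>X z. f (act ?M X (g z)))\<rparr>"
  define E' where "E' = \<lparr>mid = N, incl = f \<circ> ?i, proj = ?p \<circ> g\<rparr>"
  have hf: "hom_on takiff UNIV ?M N f"
    by (simp add: hom_on_def N_def f_add gf)
  have vsN: "vector_space (scal N)"
  proof
    fix a b :: complex and x y :: "'w \<times> 'v"
    show "scal N a (x + y) = scal N a x + scal N a y"
      by (simp only: N_def takiff_struct.simps g_add vs1.scale_right_distrib f_add)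
    show "scal N (a + b) x = scal N a x + scal N b x"
      by (simp only: N_def takiff_struct.simps vs1.scale_left_distrib f_add)
    show "scal N a (scal N b x) = scal N (a * b) x"
      by (simp only: N_def takiff_struct.simps gf vs1.scale_scale)
    show "scal N 1 x = x"
      by (simp only: N_def takiff_struct.simps vs1.scale_one fg)
  qed
  have N: "takiff_module N"
    using M vsN
    by (simp add: takiff_module_def Vector_Spaces.linear_iff N_def g_add f_add f_diff gf del: split_paired_All)
  have "is_extension W V E'"
    unfolding is_extension_def E'_def extension.simps
  proof (intro conjI)
    show "hom_on takiff UNIV W N (f \<circ> ?i)"
      using hi hf by (simp add: hom_on_def)
    show "hom_on takiff UNIV N V (?p \<circ> g)"
      using hp by (simp add: hom_on_def N_def g_add gf)
    show "inj (f \<circ> ?i)" using inj bij by (simp add: bij_def inj_compose)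
    show "surj (?p \<circ> g)" using surj gf by (metis comp_apply surj_def)
    show "range (f \<circ> ?i) = {e. (?p \<circ> g) e = 0}"
    proof -
      have "e \<in> f ` {e. ?p e = 0}" if "?p (g e) = 0" for e
        using that fg[of e] by (metis (mono_tags) imageI mem_Collect_eq)
      then have "{e. ?p (g e) = 0} = f ` {e. ?p e = 0}" by (auto simp: gf)
      then show ?thesis by (simp add: image_comp flip: ker)
    qed
  qed (fact N)
  moreover have "ext_equivalent E E'"
    unfolding ext_equivalent_def using hf bij by (auto simp: E'_def gf fun_eq_iff)
  ultimately show ?thesis by (auto simp: extensions_def)
qed

text \<open>Isomorphism with \<open>\<complex>\<close> as vector spaces.\<close>

definition iso_complex_line ::
  "'a set \<Rightarrow> ('a \<Rightarrow> 'a \<Rightarrow> 'a) \<Rightarrow> (complex \<Rightarrow> 'a \<Rightarrow> 'a) \<Rightarrow> bool" where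
  "iso_complex_line A add smul \<longleftrightarrow>
     (\<forall>\<alpha>\<in>A. \<forall>\<beta>\<in>A. add \<alpha> \<beta> \<in> A) \<and> (\<forall>c. \<forall>\<alpha>\<in>A. smul c \<alpha> \<in> A) \<and>
     (\<exists>\<phi>. bij_betw \<phi> A (UNIV :: complex set) \<and>
          (\<forall>\<alpha>\<in>A. \<forall>\<beta>\<in>A. \<phi> (add \<alpha> \<beta>) = \<phi> \<alpha> + \<phi> \<beta>) \<and>
          (\<forall>c. \<forall>\<alpha>\<in>A. \<phi> (smul c \<alpha>) = c * \<phi> \<alpha>))"

end

theory Submission
  imports Defs "HOL-Computational_Algebra.Fundamental_Theorem_Algebra"
begin

text \<open>The element \<open>(h \<otimes> x)\<^sup>2 + 4 (e \<otimes> x)(f \<otimes> x)\<close> is central in the enveloping algebra. It acts on \<open>V\<close> by a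
  scalar \<open>\<zeta>\<close>, and on a self-extension \<open>E\<close> by \<open>\<zeta> + c \<cdot> (incl \<circ> proj)\<close>, where \<open>c\<close> is a scalar by Schur's
  lemma. The number \<open>c\<close> is additive under Baer sums and linear, so it remains to see that it can be
  arbitrary and determines the class of \<open>E\<close>.

  Let \<open>u\<close> be a highest weight vector of minimal weight \<open>n\<close>. Then the vectors
  \<open>f\<^sup>j (e \<otimes> x)\<^sup>k u\<close> with \<open>j \<le> n + 2 k\<close> span \<open>V\<close>. The second central element, the mixed Casimir
  operator, acts by a scalar \<open>\<kappa>\<close> with \<open>\<kappa>\<^sup>2 = n\<^sup>2 \<zeta>\<close>; since \<open>V\<close> has infinite dimension, this forces
  \<open>\<zeta> \<noteq> 0\<close>, and the vectors form a basis. The cocycle given by the grading derivation of the Takiff algebra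
  multiplies the action of \<open>sl\<^sub>2 \<otimes> x\<close> by \<open>1 + b \<epsilon>\<close>, so it shifts the Casimir operator by \<open>2 b \<zeta>\<close>; hence
  every \<open>c\<close> occurs. If \<open>c = 0\<close>, lift \<open>u\<close> to a highest weight vector \<open>v\<close> of \<open>E\<close>. The relation
  \<open>\<kappa>\<^sup>2 = n\<^sup>2 \<zeta>\<close> holds for the operators on \<open>v\<close> as well, so the mixed Casimir operator is also not deformed,
  and \<open>f\<^sup>j (e \<otimes> x)\<^sup>k u \<mapsto> f\<^sup>j (e \<otimes> x)\<^sup>k v\<close> splits the extension.\<close>

section \<open>Eigenvectors\<close>

text \<open>What does pass from V to E is a lower bound on highest weights, because a nonzero
  highest weight vector of E either projects to a nonzero one of V or comes from V. The structural
  identities are therefore derived from \<open>hw_bounded\<close> and serve both modules.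

  This is also why \<kappa>^2 = n^2 \<zeta> is proved as an operator identity on a single vector: on
  E the mixed Casimir operator is not known to be a scalar. With \<epsilon> = incl o proj and
  \<epsilon>^2 = 0, the identity (\<kappa> + d \<epsilon>)^2 = \<kappa>^2 gives 2 \<kappa> d = 0.
  For n > 0 this forces d = 0 since \<zeta> \<noteq> 0; for n = 0 the operator vanishes outright on
  highest weight vectors of weight 0.\<close>

context vector_space
begin

lemma eigenvectors_sum_zero:
  assumes T: "Vector_Spaces.linear scale scale T"
    and "finite J"
    and "\<And>i. i \<in> J \<Longrightarrow> T (x i) = scale (l i) (x i)"
    and "\<And>i. i \<in> J \<Longrightarrow> x i \<noteq> 0"
    and "inj_on l J"
    and "(\<Sum>j\<in>J. scale (c j) (x j)) = 0"
    and "i \<in> J"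
  shows "c i = 0"
  using assms(2-)
proof (induction J arbitrary: c i rule: finite_induct)
  case (insert a J)
  interpret T: Vector_Spaces.linear scale scale T by (fact T)
  have ind: "\<forall>i\<in>J. c i * (l i - l a) = 0"
  proof (intro ballI)
    fix i assume "i \<in> J"
    have "0 = T (\<Sum>j\<in>insert a J. scale (c j) (x j)) - scale (l a) (\<Sum>j\<in>insert a J. scale (c j) (x j))"
      by (simp only: insert.prems T.zero scale_zero_right diff_zero)
    also have "\<dots> = (\<Sum>j\<in>insert a J. scale (c j * l j) (x j)) - (\<Sum>j\<in>insert a J. scale (l a * c j) (x j))"
      using insert.prems(1) by (simp add: T.sum T.scale scale_sum_right)
    also have "\<dots> = (\<Sum>j\<in>insert a J. scale (c j * (l j - l a)) (x j))"
      by (simp add: sum_subtractf scale_left_diff_distrib algebra_simps)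
    also have "\<dots> = (\<Sum>j\<in>J. scale (c j * (l j - l a)) (x j))"
      using insert.hyps by simp
    finally show "c i * (l i - l a) = 0"
      using insert.IH[of "\<lambda>i. c i * (l i - l a)" i] insert.prems \<open>i \<in> J\<close> by auto
  qed
  have J: "\<forall>i\<in>J. c i = 0"
    using ind insert.prems(3) insert.hyps by (auto simp: inj_on_def)
  then have "scale (c a) (x a) = 0"
    using insert.prems(4) insert.hyps by simp
  then show ?case
    using J insert.prems(2,5) by auto
qed simp

lemma eigenvectors_inj:
  assumes "\<And>i. i \<in> I \<Longrightarrow> T (x i) = scale (l i) (x i)" "\<And>i. i \<in> I \<Longrightarrow> x i \<noteq> 0" "inj_on l I"
  shows "inj_on x I"
  using assms by (metis (no_types, lifting) inj_on_def scale_right_imp_eq)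

lemma eigenvectors_independent:
  assumes T: "Vector_Spaces.linear scale scale T"
    and ev: "\<And>i. i \<in> I \<Longrightarrow> T (x i) = scale (l i) (x i)" "\<And>i. i \<in> I \<Longrightarrow> x i \<noteq> 0"
    and l: "inj_on l I"
  shows "independent (x ` I)"
proof
  assume "dependent (x ` I)"
  then obtain t u a where t: "finite t" "t \<subseteq> x ` I" "(\<Sum>v\<in>t. scale (u v) v) = 0" and a: "a \<in> t" "u a \<noteq> 0"
    unfolding dependent_explicit by blast
  obtain J where J: "J \<subseteq> I" "finite J" "t = x ` J"
    using t(1,2) by (auto dest: finite_subset_image)
  have inj: "inj_on x J"
    using eigenvectors_inj[of I T x l] ev l J(1) by (meson inj_on_subset)
  have "(\<Sum>j\<in>J. scale (u (x j)) (x j)) = 0"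
    using t(3) inj by (simp add: J(3) sum.reindex)
  moreover obtain j where "j \<in> J" "a = x j"
    using a J by auto
  ultimately show False
    using eigenvectors_sum_zero[OF T J(2), of x l "\<lambda>j. u (x j)" j] ev l J(1) a(2)
    by (meson inj_on_subset subsetD)
qed

text \<open>Induction on the degree of an annihilating polynomial, splitting off a linear factor X -
  z. Either \<open>x\<close> is an eigenvector for \<open>z\<close>, or \<open>T x - z x\<close> is
  a nonzero vector annihilated by the cofactor. The subspace \<open>S\<close> is carried along to
  locate the eigenvector.\<close>

lemma eigenvector_of_vanishing_sum:
  fixes T :: "'b \<Rightarrow> 'b"
  assumes alg: "\<And>p::'a poly. degree p > 0 \<Longrightarrow> \<exists>z. poly p z = 0"
    and T: "Vector_Spaces.linear scale scale T"
    and "p \<noteq> 0" "x \<noteq> 0" "(\<Sum>i\<le>degree p. scale (coeff p i) ((T ^^ i) x)) = 0"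
    and S: "subspace S" "\<And>i. (T ^^ i) x \<in> S"
  shows "\<exists>y\<in>S. \<exists>l. y \<noteq> 0 \<and> T y = scale l y"
  using assms(3-)
proof (induction "degree p" arbitrary: p x)
  case 0
  then obtain a where "p = [:a:]" "a \<noteq> 0" by (metis degree_eq_zeroE pCons_eq_0_iff)
  with 0 show ?case by simp
next
  case (Suc d)
  interpret T: Vector_Spaces.linear scale scale T by (fact T)
  obtain z where "poly p z = 0" using alg[of p] Suc.hyps(2) by auto
  then obtain q where q: "p = [:- z, 1:] * q" by (auto simp: poly_eq_0_iff_dvd)
  with Suc.prems have "q \<noteq> 0" by auto
  then have dp: "degree p = Suc (degree q)"
    by (simp add: q degree_mult_eq del: mult_pCons_left)
  have x: "x \<in> S" using Suc.prems(5)[of 0] by simp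
  define y where "y = T x - scale z x"
  show ?case
  proof (cases "y = 0")
    case True
    then show ?thesis using Suc.prems x by (auto simp: y_def)
  next
    case False
    have Ty: "(T ^^ i) y = (T ^^ Suc i) x - scale z ((T ^^ i) x)" for i
      by (induction i) (simp_all add: y_def T.diff T.scale)
    have c0: "coeff p 0 = - z * coeff q 0"
      by (simp add: q coeff_mult del: mult_pCons_left)
    have cS: "coeff p (Suc i) = coeff q i - z * coeff q (Suc i)" for i
      by (simp add: q)
    have "0 = (\<Sum>i\<le>Suc (degree q). scale (coeff p i) ((T ^^ i) x))"
      using Suc.prems(3) by (simp only: dp)
    also have "\<dots> = scale (coeff p 0) x + (\<Sum>i\<le>degree q. scale (coeff p (Suc i)) ((T ^^ Suc i) x))"
      by (simp only: sum.atMost_Suc_shift funpow_0)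
    also have "\<dots> = (\<Sum>i\<le>degree q. scale (coeff q i) ((T ^^ Suc i) x))
        - (scale (z * coeff q 0) x + (\<Sum>i\<le>degree q. scale (z * coeff q (Suc i)) ((T ^^ Suc i) x)))"
      by (simp add: c0 cS scale_left_diff_distrib sum_subtractf)
    also have "scale (z * coeff q 0) x + (\<Sum>i\<le>degree q. scale (z * coeff q (Suc i)) ((T ^^ Suc i) x))
       = (\<Sum>i\<le>Suc (degree q). scale (z * coeff q i) ((T ^^ i) x))"
      by (simp only: sum.atMost_Suc_shift funpow_0)
    also have "\<dots> = (\<Sum>i\<le>degree q. scale (z * coeff q i) ((T ^^ i) x))"
      by (simp add: coeff_eq_0)
    also have "(\<Sum>i\<le>degree q. scale (coeff q i) ((T ^^ Suc i) x)) - \<dots>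
       = (\<Sum>i\<le>degree q. scale (coeff q i) ((T ^^ i) y))"
      by (simp only: Ty scale_right_diff_distrib sum_subtractf scale_scale mult.commute)
    finally have "(\<Sum>i\<le>degree q. scale (coeff q i) ((T ^^ i) y)) = 0" by simp
    moreover have "d = degree q" using dp Suc.hyps(2) by simp
    moreover have "(T ^^ i) y \<in> S" for i
      using Suc.prems(5)[of "Suc i"] Suc.prems(4,5) by (simp only: Ty subspace_diff subspace_scale)
    ultimately show ?thesis
      using Suc.hyps(1)[of q y] False \<open>q \<noteq> 0\<close> Suc.prems(4) by blast
  qed
qed

text \<open>Only the orbit of \<open>x\<close> has to stay in a finite-dimensional space, not the
  domain of \<open>T\<close>: \<open>card B + 1\<close> vectors of the orbit are linearly related,
  which is an annihilating polynomial for \<open>x\<close>.\<close>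

lemma eigenvector_exists:
  fixes T :: "'b \<Rightarrow> 'b"
  assumes alg: "\<And>p::'a poly. degree p > 0 \<Longrightarrow> \<exists>z. poly p z = 0"
    and T: "Vector_Spaces.linear scale scale T"
    and "x \<noteq> 0" "finite B" and B: "\<And>i. (T ^^ i) x \<in> span B"
    and S: "subspace S" "\<And>i. (T ^^ i) x \<in> S"
  shows "\<exists>y\<in>S. \<exists>l. y \<noteq> 0 \<and> T y = scale l y"
proof -
  let ?g = "\<lambda>i. (T ^^ i) x"
  have "\<exists>p. p \<noteq> 0 \<and> (\<Sum>i\<le>degree p. scale (coeff p i) (?g i)) = 0"
  proof -
    let ?J = "{..card B}"
    have "\<exists>c. (\<exists>i\<in>?J. c i \<noteq> 0) \<and> (\<Sum>i\<in>?J. scale (c i) (?g i)) = 0"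
    proof (cases "inj_on ?g ?J")
      case True
      have "dependent (?g ` ?J)"
        using independent_span_bound[OF \<open>finite B\<close>, of "?g ` ?J"] B True
        by (auto simp: card_image image_subset_iff)
      then obtain u where u: "\<exists>v\<in>?g ` ?J. u v \<noteq> 0" "(\<Sum>v\<in>?g ` ?J. scale (u v) v) = 0"
        unfolding dependent_finite[OF finite_imageI[OF finite_atMost]] by auto
      then show ?thesis
        using True by (intro exI[of _ "u \<circ> ?g"]) (auto simp: sum.reindex)
    next
      \<comment> \<open>A repetition in the orbit is itself a linear relation.\<close>
      case False
      then obtain i j where ij: "i \<in> ?J" "j \<in> ?J" "i \<noteq> j" "?g i = ?g j"
        by (auto simp: inj_on_def)
      have "(\<Sum>k\<in>?J. scale (if k = i then 1 else if k = j then - 1 else 0) (?g k))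
        = (\<Sum>k\<in>{i, j}. scale (if k = i then 1 else if k = j then - 1 else 0) (?g k))"
        using ij by (intro sum.mono_neutral_right) auto
      also have "\<dots> = 0"
        using ij by auto
      finally show ?thesis
        using ij by (intro exI[of _ "\<lambda>k. if k = i then 1 else if k = j then - 1 else 0"]) auto
    qed
    then obtain c where c: "\<exists>i\<in>?J. c i \<noteq> 0" "(\<Sum>i\<in>?J. scale (c i) (?g i)) = 0" by blast
    define p where "p = (\<Sum>i\<in>?J. monom (c i) i)"
    have cp: "coeff p i = (if i \<in> ?J then c i else 0)" for i
      by (simp add: p_def coeff_sum)
    have "(\<Sum>i\<le>degree p. scale (coeff p i) (?g i)) = (\<Sum>i\<in>{i. coeff p i \<noteq> 0}. scale (coeff p i) (?g i))"
      by (rule sum.mono_neutral_right) (auto intro: le_degree)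
    also have "\<dots> = (\<Sum>i\<in>?J. scale (coeff p i) (?g i))"
      by (rule sum.mono_neutral_left) (auto simp: cp split: if_splits)
    also have "\<dots> = 0" using c(2) by (simp add: cp)
    finally show ?thesis using c(1) cp by (metis coeff_0)
  qed
  then obtain p where "p \<noteq> 0" "(\<Sum>i\<le>degree p. scale (coeff p i) (?g i)) = 0" by blast
  from eigenvector_of_vanishing_sum[OF alg T this(1) \<open>x \<noteq> 0\<close> this(2) S]
  show ?thesis by blast
qed

end

section \<open>Modules in terms of the standard basis\<close>

text \<open>\<open>eb\<close>, \<open>fb\<close>, \<open>hb\<close> are the actions of \<open>e \<otimes> x\<close>, \<open>f \<otimes> x\<close>, \<open>h \<otimes> x\<close>. The commutation relations are
  oriented so that they rewrite words into the order \<open>f, eb, hb, fb, h, e\<close>.\<close>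

locale takiff_rep = vector_space scale
  for scale :: "complex \<Rightarrow> 'a::ab_group_add \<Rightarrow> 'a" (infixr "\<cdot>" 75) +
  fixes e f h eb fb hb :: "'a \<Rightarrow> 'a"
  assumes op_linear: "T \<in> {e, f, h, eb, fb, hb} \<Longrightarrow> Vector_Spaces.linear scale scale T"
    and ef: "e (f x) = f (e x) + h x"
    and he: "e (h x) = h (e x) - 2 \<cdot> e x"
    and hf: "h (f x) = f (h x) - 2 \<cdot> f x"
    and e_eb: "e (eb x) = eb (e x)"
    and e_fb: "e (fb x) = fb (e x) + hb x"
    and e_hb: "e (hb x) = hb (e x) - 2 \<cdot> eb x"
    and h_eb: "h (eb x) = eb (h x) + 2 \<cdot> eb x"
    and h_fb: "h (fb x) = fb (h x) - 2 \<cdot> fb x"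
    and h_hb: "h (hb x) = hb (h x)"
    and f_eb: "eb (f x) = f (eb x) + hb x"
    and f_fb: "fb (f x) = f (fb x)"
    and f_hb: "hb (f x) = f (hb x) - 2 \<cdot> fb x"
    and eb_hb: "hb (eb x) = eb (hb x)"
    and eb_fb: "fb (eb x) = eb (fb x)"
    and hb_fb: "fb (hb x) = hb (fb x)"
begin

lemmas comm = ef he hf e_eb e_fb e_hb h_eb h_fb h_hb f_eb f_fb f_hb eb_hb eb_fb hb_fb

sublocale e: Vector_Spaces.linear scale scale e by (rule op_linear) simp
sublocale f: Vector_Spaces.linear scale scale f by (rule op_linear) simp
sublocale h: Vector_Spaces.linear scale scale h by (rule op_linear) simp
sublocale eb: Vector_Spaces.linear scale scale eb by (rule op_linear) simp
sublocale fb: Vector_Spaces.linear scale scale fb by (rule op_linear) simp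
sublocale hb: Vector_Spaces.linear scale scale hb by (rule op_linear) simp

lemmas op_zero = e.zero f.zero h.zero eb.zero fb.zero hb.zero
lemmas op_add = e.add f.add h.add eb.add fb.add hb.add
lemmas op_diff = e.diff f.diff h.diff eb.diff fb.diff hb.diff
lemmas op_neg = e.neg f.neg h.neg eb.neg fb.neg hb.neg
lemmas op_scale = e.scale f.scale h.scale eb.scale fb.scale hb.scale
lemmas op_simps = op_zero op_add op_diff op_neg op_scale

lemma scale_2: "2 \<cdot> x = x + x"
  using scale_left_distrib[of 1 1 x] by simp

lemma scale_4: "4 \<cdot> x = x + x + x + x"
  using scale_left_distrib[of 2 2 x] by (simp add: scale_2 add.assoc)

text \<open>The sl2 Casimir element h^2 + 2 (e f + f e) with every factor moved to the ideal sl2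
  \<otimes> x; there the factors commute, which gives the coefficient 4.\<close>

definition Cas :: "'a \<Rightarrow> 'a" where
  "Cas x = hb (hb x) + 4 \<cdot> eb (fb x)"

text \<open>The polarised Casimir element h hb + 2 (e fb + f eb), with \<open>e\<close> moved to the
  right so that its term dies on highest weight vectors; the summand \<open>2 \<cdot> hb x\<close>
  comes from [e, fb] = hb.\<close>

definition Mix :: "'a \<Rightarrow> 'a" where
  "Mix x = h (hb x) + 2 \<cdot> hb x + 2 \<cdot> fb (e x) + 2 \<cdot> f (eb x)"

lemma Cas_linear: "Vector_Spaces.linear scale scale Cas"
  by unfold_locales (simp_all add: Cas_def op_simps algebra_simps)

lemma Mix_linear: "Vector_Spaces.linear scale scale Mix"
  by unfold_locales (simp_all add: Mix_def op_simps algebra_simps)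

lemma Cas_commute: "T \<in> {e, f, h, eb, fb, hb} \<Longrightarrow> Cas (T x) = T (Cas x)"
  by (auto simp: Cas_def comm op_simps scale_2 scale_4 algebra_simps)

lemma Mix_commute: "T \<in> {e, f, h, eb, fb, hb} \<Longrightarrow> Mix (T x) = T (Mix x)"
  by (auto simp: Mix_def comm op_simps scale_2 scale_4 algebra_simps)

definition stable :: "'a set \<Rightarrow> bool" where
  "stable S \<longleftrightarrow> subspace S \<and> (\<forall>T\<in>{e, f, h, eb, fb, hb}. \<forall>x\<in>S. T x \<in> S)"

section \<open>Strings of sl2 through highest weight vectors\<close>

definition hw :: "complex \<Rightarrow> 'a \<Rightarrow> bool" where
  "hw m x \<longleftrightarrow> e x = 0 \<and> h x = m \<cdot> x"

text \<open>\<open>eb\<close> commutes with \<open>e\<close>, unlike \<open>fb\<close> and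
  \<open>hb\<close>, so it climbs from one highest weight vector to the next in steps of
  two.\<close>

lemma hw_eb: "hw m x \<Longrightarrow> hw (m + 2) (eb x)"
  by (simp add: hw_def comm op_simps algebra_simps)

lemma h_funpow_f: "h x = m \<cdot> x \<Longrightarrow> h ((f ^^ j) x) = (m - 2 * of_nat j) \<cdot> (f ^^ j) x"
  by (induction j) (simp_all add: hf op_simps, simp add: algebra_simps)

text \<open>Stated for arbitrary \<open>x\<close>, since \<open>lift_highest\<close> applies it to a
  vector that is killed by \<open>e\<close> but is a weight vector only up to an error in V.\<close>

lemma e_funpow_f:
  "e ((f ^^ Suc j) x) = (f ^^ Suc j) (e x) + of_nat (Suc j) \<cdot> (f ^^ j) (h x - of_nat j \<cdot> x)"
proof (induction j)
  case (Suc j)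
  have h: "h ((f ^^ j) y) = (f ^^ j) (h y) - (2 * of_nat j) \<cdot> (f ^^ j) y" for j y
    by (induction j) (simp_all add: hf op_simps, simp add: algebra_simps)
  have lin: "(f ^^ j) (x + y) = (f ^^ j) x + (f ^^ j) y" "(f ^^ j) (c \<cdot> y) = c \<cdot> (f ^^ j) y"
    "(f ^^ j) (x - y) = (f ^^ j) x - (f ^^ j) y" for x y c j
    by (induction j) (simp_all add: op_simps)
  have "e ((f ^^ Suc (Suc j)) x) = f (e ((f ^^ Suc j) x)) + h ((f ^^ Suc j) x)"
    by (simp add: ef)
  also have "\<dots> = (f ^^ Suc (Suc j)) (e x) + of_nat (Suc j) \<cdot> (f ^^ Suc j) (h x - of_nat j \<cdot> x)
     + ((f ^^ Suc j) (h x) - (2 * of_nat (Suc j)) \<cdot> (f ^^ Suc j) x)"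
    unfolding Suc.IH h[of "Suc j"] by (simp add: op_simps)
  also have "\<dots> = (f ^^ Suc (Suc j)) (e x)
       + of_nat (Suc (Suc j)) \<cdot> (f ^^ Suc j) (h x - of_nat (Suc j) \<cdot> x)"
    unfolding lin by (simp add: algebra_simps scale_2)
  finally show ?case .
qed (simp add: ef)

lemma e_funpow_f_hw:
  assumes "hw m x"
  shows "e ((f ^^ Suc j) x) = (of_nat (Suc j) * (m - of_nat j)) \<cdot> (f ^^ j) x"
proof -
  have z: "(f ^^ j) 0 = 0" and s: "(f ^^ j) (c \<cdot> y) = c \<cdot> (f ^^ j) y" for j y c
    by (induction j) (simp_all add: op_simps)
  have "h x - of_nat j \<cdot> x = (m - of_nat j) \<cdot> x"
    using assms by (simp add: hw_def algebra_simps)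
  moreover have "e x = 0" using assms by (simp add: hw_def)
  ultimately show ?thesis by (simp only: e_funpow_f z s scale_scale add_0_left)
qed

lemma hw_funpow_f_nonzero:
  assumes "hw (of_nat m) x" "x \<noteq> 0" "j \<le> m"
  shows "(f ^^ j) x \<noteq> 0"
  using assms(3)
proof (induction j)
  case (Suc j)
  have "e ((f ^^ Suc j) x) = (of_nat (Suc j) * of_nat (m - j)) \<cdot> (f ^^ j) x"
    using Suc.prems by (simp only: e_funpow_f_hw[OF assms(1)] of_nat_diff Suc_leD)
  also have "\<dots> \<noteq> 0"
    using Suc by (simp del: funpow.simps of_nat_Suc)
  finally show ?case by (metis e.zero)
qed (use assms in simp)

text \<open>The Casimir operator of \<open>sl\<^sub>2\<close> plus \<open>\<i> h\<close>: its eigenvalue on \<open>f\<^sup>j x\<close> determines both \<open>m\<close>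
  and \<open>j\<close>.\<close>

definition sep :: "'a \<Rightarrow> 'a" where
  "sep x = h (h x) + 2 \<cdot> h x + 4 \<cdot> f (e x) + \<i> \<cdot> h x"

lemma sep_linear: "Vector_Spaces.linear scale scale sep"
  by unfold_locales (simp_all add: sep_def op_simps algebra_simps)

lemma sep_funpow_f:
  assumes "hw m x"
  shows "sep ((f ^^ j) x) = (m * (m + 2) + \<i> * (m - 2 * of_nat j)) \<cdot> (f ^^ j) x"
proof -
  have "f (e ((f ^^ j) x)) = (of_nat j * (m - of_nat j + 1)) \<cdot> (f ^^ j) x"
  proof (cases j)
    case 0
    then show ?thesis using assms by (simp add: hw_def op_simps)
  next
    case (Suc i)
    then show ?thesis by (simp only: e_funpow_f_hw[OF assms] op_simps) (simp add: algebra_simps)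
  qed
  moreover have "h x = m \<cdot> x" using assms by (simp add: hw_def)
  note h_funpow_f[OF this]
  ultimately show ?thesis
    by (simp add: sep_def op_simps flip: scale_left_distrib) (simp add: algebra_simps)
qed

text \<open>The real part m (m + 2) is strictly increasing in m and so gives m; the imaginary part
  then gives j.\<close>

lemma sep_eigenvalue_inj:
  fixes m m' j j' :: nat
  assumes "of_nat m * (of_nat m + 2) + \<i> * (of_nat m - 2 * of_nat j)
    = of_nat m' * (of_nat m' + 2) + \<i> * (of_nat m' - 2 * of_nat j')"
  shows "m = m' \<and> j = j'"
proof -
  have "Re (of_nat m * (of_nat m + 2) + \<i> * (of_nat m - 2 * of_nat j))
      = Re (of_nat m' * (of_nat m' + 2) + \<i> * (of_nat m' - 2 * of_nat j'))"
   "Im (of_nat m * (of_nat m + 2) + \<i> * (of_nat m - 2 * of_nat j))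
      = Im (of_nat m' * (of_nat m' + 2) + \<i> * (of_nat m' - 2 * of_nat j'))"
    using assms by simp_all
  then have re: "real m * (real m + 2) = real m' * (real m' + 2)"
    and im: "real m - 2 * real j = real m' - 2 * real j'" by simp_all
  from re have "(real m - real m') * (real m + real m' + 2) = 0" by (simp add: algebra_simps)
  moreover have "real m + real m' + 2 > 0" by simp
  ultimately have "real m = real m'" by (smt (verit) mult_eq_0_iff)
  with im show ?thesis by simp
qed

text \<open>This stands in for local finiteness over sl2: a vector killed by \<open>e\<close> must
  vanish if its weight is not one of n, n + 1, and so on. Unlike a decomposition into
  finite-dimensional summands, the condition is readily inherited by self-extensions
  (\<open>E_bounded\<close>).\<close>

definition hw_bounded :: "nat \<Rightarrow> bool" where
  "hw_bounded n \<longleftrightarrow> (\<forall>m y. hw m y \<and> y \<noteq> 0 \<longrightarrow> (\<exists>i\<ge>n. m = of_nat i))"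

lemma hw_boundedD: "hw_bounded n \<Longrightarrow> hw m y \<Longrightarrow> (\<And>i. i \<ge> n \<Longrightarrow> m \<noteq> of_nat i) \<Longrightarrow> y = 0"
  unfolding hw_bounded_def by blast

lemma hw_neg_zero:
  assumes "hw_bounded n" "hw m y" "Re m < 0"
  shows "y = 0"
  using assms by (intro hw_boundedD[OF assms(1,2)]) auto

text \<open>The vector is killed by \<open>e\<close> and has weight -m - 2, which the bound excludes
  for nonzero vectors.\<close>

lemma funpow_f_hw_zero:
  assumes "hw_bounded n" "hw (of_nat m) x"
  shows "(f ^^ Suc m) x = 0"
proof (rule hw_neg_zero[OF assms(1)])
  have "e ((f ^^ Suc m) x) = 0"
    by (simp only: e_funpow_f_hw[OF assms(2)]) simp
  moreover have "h ((f ^^ Suc m) x) = (of_nat m - 2 * of_nat (Suc m)) \<cdot> (f ^^ Suc m) x"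
    using h_funpow_f assms(2) unfolding hw_def by blast
  ultimately show "hw (of_nat m - 2 * of_nat (Suc m)) ((f ^^ Suc m) x)"
    by (simp only: hw_def)
qed simp

lemma Mix_hw: "hw m w \<Longrightarrow> Mix w = (m + 2) \<cdot> hb w + 2 \<cdot> f (eb w)"
  by (simp add: hw_def Mix_def comm op_simps algebra_simps)

lemma hw_commuting:
  assumes "Vector_Spaces.linear scale scale T" "\<And>x. T (e x) = e (T x)" "\<And>x. T (h x) = h (T x)" "hw m x"
  shows "hw m (T x)"
proof -
  interpret T: Vector_Spaces.linear scale scale T by (fact assms(1))
  show ?thesis using assms(4) by (simp add: hw_def flip: assms(2,3)) (simp add: T.zero T.scale)
qed

lemma hw_Mix: "hw m x \<Longrightarrow> hw m (Mix x)"
  by (rule hw_commuting[OF Mix_linear]) (simp_all add: Mix_commute)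

text \<open>The vector \<open>2 n (n + 1) fb u - f (n hb u + Mix u)\<close> is killed by \<open>e\<close> and has weight \<open>n - 2\<close>.\<close>

lemma lowest_fb:
  assumes b: "hw_bounded n" and u: "hw (of_nat n) u"
  shows "(2 * of_nat n * (of_nat n + 1)) \<cdot> fb u = f (of_nat n \<cdot> hb u + Mix u)"
proof -
  let ?n = "of_nat n :: complex"
  let ?y = "(2 * ?n * (?n + 1)) \<cdot> fb u - f (?n \<cdot> hb u + Mix u)"
  have eu: "e u = 0" and hu: "h u = ?n \<cdot> u"
    and eM: "e (Mix u) = 0" and hM: "h (Mix u) = ?n \<cdot> Mix u"
    using u hw_Mix[OF u] by (simp_all add: hw_def)
  have fe: "2 \<cdot> f (eb u) = Mix u - (?n + 2) \<cdot> hb u"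
    by (simp add: Mix_hw[OF u])
  have "e ?y = (2 * ?n * (?n + 1)) \<cdot> hb u - (?n * ?n) \<cdot> hb u - ?n \<cdot> Mix u + ?n \<cdot> (2 \<cdot> f (eb u))"
    by (simp add: comm op_simps eu hu eM hM) (simp add: algebra_simps)
  also have "\<dots> = 0"
    unfolding fe by (simp add: algebra_simps flip: scale_left_distrib scale_left_diff_distrib) 
  finally have 1: "e ?y = 0" .
  have 2: "h ?y = (?n - 2) \<cdot> ?y"
    by (simp add: comm op_simps eu hu eM hM) (simp add: algebra_simps)
  have "?y = 0"
  proof (rule hw_boundedD[OF b])
    show "hw (?n - 2) ?y" using 1 2 by (simp only: hw_def)
    show "?n - 2 \<noteq> of_nat i" if "i \<ge> n" for i
    proof
      assume "?n - 2 = of_nat i"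
      then have "Re (?n - 2) = Re (of_nat i)" by simp
      then show False using that by simp
    qed
  qed
  then show ?thesis by simp
qed

text \<open>At n = 0 the coefficient in \<open>lowest_fb\<close> vanishes. Here
  \<open>f u = 0\<close> already, and applying \<open>hb\<close> and \<open>eb\<close> to this
  equation yields the other two statements.\<close>

lemma lowest_zero:
  assumes b: "hw_bounded 0" and u: "hw 0 u"
  shows "f u = 0" "2 \<cdot> fb u = f (hb u)" "Mix u = 0"
proof -
  show f: "f u = 0" using funpow_f_hw_zero[OF b, of 0 u] u by simp
  have "0 = hb (f u)" by (simp add: f op_simps)
  then show "2 \<cdot> fb u = f (hb u)" by (simp add: comm)
  have "0 = eb (f u)" by (simp add: f op_simps)
  then have "f (eb u) = - hb u" by (simp add: comm eq_neg_iff_add_eq_0)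
  then show "Mix u = 0" by (simp add: Mix_hw[OF u])
qed

text \<open>Apply \<open>eb\<close> to the relation of \<open>lowest_fb\<close>. Then
  \<open>4 \<cdot> eb (fb u)\<close> becomes \<open>Cas u - hb (hb u)\<close>, and
  \<open>Mix_hw\<close> removes the terms in f eb; what remains in \<open>hb (hb u)\<close> and
  \<open>hb (Mix u)\<close> cancels. \<open>Mix u\<close> is kept as a vector of its own, because on
  an extension it need not be a multiple of \<open>u\<close>.\<close>

lemma Mix_Mix:
  assumes b: "hw_bounded n" and u: "hw (of_nat n) u"
  shows "Mix (Mix u) = (of_nat n * of_nat n) \<cdot> Cas u"
proof (cases "n = 0")
  case True
  interpret M: Vector_Spaces.linear scale scale Mix by (fact Mix_linear)
  show ?thesis using lowest_zero(3)[of u] assms True by (simp add: M.zero)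
next
  case False
  let ?n = "of_nat n :: complex"
  interpret M: Vector_Spaces.linear scale scale Mix by (fact Mix_linear)
  define K where "K = Mix u"
  have KK: "hw ?n K" using hw_Mix[OF u] by (simp add: K_def)
  have hbK: "Mix (hb u) = hb K" by (simp add: K_def Mix_commute)
  have MK: "2 \<cdot> f (eb K) = Mix K - (?n + 2) \<cdot> hb K"
    by (simp add: Mix_hw[OF KK])
  have Mu: "2 \<cdot> f (eb u) = K - (?n + 2) \<cdot> hb u"
    by (simp add: Mix_hw[OF u] K_def)
  have C: "4 \<cdot> eb (fb u) = Cas u - hb (hb u)" by (simp add: Cas_def)
  have "hb (2 \<cdot> f (eb u)) = 2 \<cdot> f (eb (hb u)) - 4 \<cdot> eb (fb u)"
    by (simp add: comm op_simps scale_right_diff_distrib)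
  then have feh: "2 \<cdot> f (eb (hb u)) = hb K - (?n + 2) \<cdot> hb (hb u) + (Cas u - hb (hb u))"
    unfolding Mu by (simp add: op_simps C algebra_simps)
  have "(?n * (?n + 1)) \<cdot> (4 \<cdot> eb (fb u)) = 2 \<cdot> eb ((2 * ?n * (?n + 1)) \<cdot> fb u)"
    by (simp add: op_simps algebra_simps)
  also have "\<dots> = ?n \<cdot> (2 \<cdot> f (eb (hb u))) + 2 \<cdot> f (eb K) + (2 * ?n) \<cdot> hb (hb u) + 2 \<cdot> hb K"
    unfolding lowest_fb[OF b u] K_def[symmetric] by (simp add: op_simps comm algebra_simps)
  finally have "(?n * (?n + 1)) \<cdot> (Cas u - hb (hb u))
     = ?n \<cdot> (hb K - (?n + 2) \<cdot> hb (hb u) + (Cas u - hb (hb u))) + (Mix K - (?n + 2) \<cdot> hb K)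
       + (2 * ?n) \<cdot> hb (hb u) + 2 \<cdot> hb K"
    by (simp only: C feh MK)
  moreover have "(a * 2) \<cdot> x = a \<cdot> x + a \<cdot> x" for a x
    by (simp only: mult_2_right scale_left_distrib)
  ultimately show ?thesis
    by (simp add: K_def[symmetric] algebra_simps scale_2)
qed

end

lemma of_nat_add_numeral_nonzero: "of_nat m + numeral k \<noteq> (0 :: complex)"
proof -
  have "of_nat (m + numeral k) \<noteq> (0 :: complex)" by (subst of_nat_eq_0_iff) simp
  then show ?thesis by simp
qed

lemma (in vector_space) scale_divide_cancel: "c \<noteq> 0 \<Longrightarrow> x = scale (1 / c) (scale c x)"
  by simp

lemma (in vector_space) linear_span_into:
  assumes T: "Vector_Spaces.linear scale scale T"
    and "\<And>x. x \<in> A \<Longrightarrow> T x \<in> S" "subspace S" "x \<in> span A"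
  shows "T x \<in> S"
proof -
  interpret T: Vector_Spaces.linear scale scale T by (fact T)
  show ?thesis
  proof (rule span_induct[OF assms(4), of "\<lambda>x. T x \<in> S"])
    show "subspace {x. T x \<in> S}"
      using assms(3) by (auto simp: subspace_def T.add T.scale T.zero)
  qed (use assms(2) in auto)
qed

section \<open>The ladder of strings through the powers of \<open>eb\<close>\<close>

context takiff_rep
begin

definition bs :: "'a \<Rightarrow> nat \<Rightarrow> nat \<Rightarrow> 'a" where
  "bs u k j = (f ^^ j) ((eb ^^ k) u)"

text \<open>The sum of the sl2-strings through \<open>(eb ^^ k) u\<close> for
  \<open>K \<le> k\<close>. It serves for \<open>K = 0\<close>, as the module generated by
  \<open>u\<close>, and for \<open>K = 1\<close>, as the submodule that excludes \<zeta> =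
  0.\<close>

definition tail :: "'a \<Rightarrow> nat \<Rightarrow> nat \<Rightarrow> 'a set" where
  "tail u n K = span {bs u k j | k j. K \<le> k \<and> j \<le> n + 2 * k}"

lemma bs_in_tail: "K \<le> k \<Longrightarrow> j \<le> n + 2 * k \<Longrightarrow> bs u k j \<in> tail u n K"
  unfolding tail_def by (intro span_base) blast

lemma subspace_tail: "subspace (tail u n K)"
  unfolding tail_def by simp

lemma hw_funpow_eb: "hw (of_nat n) u \<Longrightarrow> hw (of_nat (n + 2 * k)) ((eb ^^ k) u)"
proof (induction k)
  case (Suc k)
  from hw_eb[OF Suc.IH[OF Suc.prems]] show ?case by (simp add: add_ac)
qed simp

lemma f_bs: "f (bs u k j) = bs u k (Suc j)"
  by (simp add: bs_def)

lemma h_bs: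
  assumes "hw (of_nat n) u"
  shows "h (bs u k j) = (of_nat (n + 2 * k) - 2 * of_nat j) \<cdot> bs u k j"
  using h_funpow_f hw_funpow_eb[OF assms] unfolding hw_def bs_def by blast

lemma e_bs_Suc:
  assumes "hw (of_nat n) u"
  shows "e (bs u k (Suc j)) = (of_nat (Suc j) * (of_nat (n + 2 * k) - of_nat j)) \<cdot> bs u k j"
  unfolding bs_def by (rule e_funpow_f_hw[OF hw_funpow_eb[OF assms]])

lemma e_bs_0: "hw (of_nat n) u \<Longrightarrow> e (bs u k 0) = 0"
  using hw_funpow_eb[of n u k] unfolding hw_def bs_def by simp

lemma hb_hw:
  assumes "hw (of_nat m) w" "Mix w = \<kappa> \<cdot> w"
  shows "hb w = (1 / (of_nat m + 2)) \<cdot> (\<kappa> \<cdot> w - 2 \<cdot> f (eb w))"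
proof -
  have "of_nat m + 2 \<noteq> (0 :: complex)"
    by (rule of_nat_add_numeral_nonzero)
  moreover have "(of_nat m + 2) \<cdot> hb w = \<kappa> \<cdot> w - 2 \<cdot> f (eb w)"
    using Mix_hw[OF assms(1)] assms(2) by simp
  ultimately show ?thesis using scale_divide_cancel[of "of_nat m + 2" "hb w"] by simp
qed

text \<open>Apply \<open>hb\<close> to \<open>Mix_hw\<close> and eliminate \<open>hb (hb w)\<close>
  by the scalar Casimir operator. Since m + 3 is nonzero, this determines \<open>fb\<close> on every
  rung of the ladder above the lowest.\<close>

lemma fb_eb_hw:
  assumes "hw (of_nat m) w" "Mix w = \<kappa> \<cdot> w" "Cas w = \<zeta> \<cdot> w"
  shows "(4 * (of_nat m + 3)) \<cdot> fb (eb w)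
    = ((of_nat m + 2) * \<zeta>) \<cdot> w - \<kappa> \<cdot> hb w + 2 \<cdot> f (hb (eb w))"
proof -
  let ?m = "of_nat m :: complex"
  have "(?m + 2) \<cdot> hb w = \<kappa> \<cdot> w - 2 \<cdot> f (eb w)"
    using Mix_hw[OF assms(1)] assms(2) by simp
  then have "hb ((?m + 2) \<cdot> hb w) = hb (\<kappa> \<cdot> w - 2 \<cdot> f (eb w))" by simp
  then have 1: "(?m + 2) \<cdot> hb (hb w) = \<kappa> \<cdot> hb w - 2 \<cdot> f (hb (eb w)) + 4 \<cdot> fb (eb w)"
    by (simp add: op_simps comm algebra_simps)
  have "hb (hb w) = \<zeta> \<cdot> w - 4 \<cdot> fb (eb w)"
    using assms(3) by (simp add: Cas_def eb_fb algebra_simps)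
  then have "(?m + 2) \<cdot> (\<zeta> \<cdot> w - 4 \<cdot> fb (eb w)) = \<kappa> \<cdot> hb w - 2 \<cdot> f (hb (eb w)) + 4 \<cdot> fb (eb w)"
    using 1 by simp
  moreover have "(4 * (?m + 3)) \<cdot> fb (eb w) = (?m + 2) \<cdot> (4 \<cdot> fb (eb w)) + 4 \<cdot> fb (eb w)"
    by (simp add: algebra_simps flip: scale_left_distrib)
  ultimately show ?thesis
    by (simp add: scale_right_diff_distrib algebra_simps)
qed

text \<open>If \<open>eb w = 0\<close>, the formulas for \<open>hb w\<close> and
  \<open>fb (eb w)\<close> collapse to (m + 2) hb w = \<kappa> w and (m + 2) \<zeta> w = \<kappa> hb
  w, whence (m + 2)^2 \<zeta> = \<kappa>^2.\<close>

lemma eb_hw_nonzero: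
  assumes "hw (of_nat m) w" "Mix w = \<kappa> \<cdot> w" "Cas w = \<zeta> \<cdot> w" "w \<noteq> 0"
    and ne: "(of_nat m + 2) * (of_nat m + 2) * \<zeta> \<noteq> \<kappa> * \<kappa>"
  shows "eb w \<noteq> 0"
proof
  assume z: "eb w = 0"
  let ?m = "of_nat m + 2 :: complex"
  have 1: "?m \<cdot> hb w = \<kappa> \<cdot> w"
    using Mix_hw[OF assms(1)] assms(2) by (simp add: z op_simps)
  have 2: "((of_nat m + 2) * \<zeta>) \<cdot> w = \<kappa> \<cdot> hb w"
    using fb_eb_hw[OF assms(1-3)] by (simp add: z op_simps)
  have "(?m * (?m * \<zeta>)) \<cdot> w = ?m \<cdot> \<kappa> \<cdot> hb w"
    by (simp only: mult.assoc flip: 2 scale_scale)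
  also have "\<dots> = \<kappa> \<cdot> ?m \<cdot> hb w" by (simp add: mult.commute)
  also have "\<dots> = (\<kappa> * \<kappa>) \<cdot> w" unfolding 1 by simp
  finally show False using ne \<open>w \<noteq> 0\<close> by (auto simp: mult.assoc)
qed

text \<open>Applied to \<open>(eb ^^ k) u\<close>, only \<open>fb\<close> can lead to a smaller
  \<open>k\<close>, so only its effect at \<open>k = K\<close> has to be assumed; for larger
  \<open>k\<close> it is given by \<open>fb_eb_hw\<close>, and \<open>hb\<close> by
  \<open>hb_hw\<close>. Powers of \<open>f\<close> are then passed by commutation.\<close>

lemma tail_stable:
  assumes b: "hw_bounded n" and u: "hw (of_nat n) u"
    and C: "\<And>k. Cas ((eb ^^ k) u) = \<zeta> \<cdot> (eb ^^ k) u" and M: "\<And>k. Mix ((eb ^^ k) u) = \<kappa> \<cdot> (eb ^^ k) u"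
    and K: "fb ((eb ^^ K) u) \<in> tail u n K"
  shows "stable (tail u n K)"
proof -
  let ?S = "tail u n K"
  note sub = subspace_tail[of u n K]
  note S = subspace_add[OF sub] subspace_diff[OF sub] subspace_scale[OF sub]
  \<comment> \<open>Beyond the end of a string the vectors vanish, so membership holds for all
    \<open>j\<close>, and no bound has to be tracked when \<open>f\<close> raises
    \<open>j\<close>.\<close>
  have all: "bs u k j \<in> ?S" if "K \<le> k" for k j
  proof (cases "j \<le> n + 2 * k")
    case False
    then obtain i where "j = i + Suc (n + 2 * k)"
      using less_iff_Suc_add[of "n + 2 * k" j] by auto
    then have "bs u k j = (f ^^ i) ((f ^^ Suc (n + 2 * k)) ((eb ^^ k) u))"
      by (simp only: bs_def funpow_add o_apply)
    also have "\<dots> = (f ^^ i) 0"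
      using funpow_f_hw_zero[OF b hw_funpow_eb[OF u]] by (simp only:)
    also have "\<dots> = 0" by (induction i) (simp_all add: op_simps)
    finally show ?thesis by (simp add: subspace_0[OF sub])
  qed (use that in \<open>rule bs_in_tail\<close>)
  have into: "T x \<in> ?S" if "Vector_Spaces.linear scale scale T" "x \<in> ?S"
    "\<And>k j. K \<le> k \<Longrightarrow> T (bs u k j) \<in> ?S" for T x
  proof (rule linear_span_into[OF that(1)])
    show "x \<in> span {bs u k j | k j. K \<le> k \<and> j \<le> n + 2 * k}" using that(2) by (simp add: tail_def)
  qed (use that(3) sub in auto)
  have f: "f x \<in> ?S" if "x \<in> ?S" for x
    by (rule into[of f]) (use that in \<open>auto simp: op_linear f_bs all\<close>)
  have w: "(eb ^^ k) u \<in> ?S" if "K \<le> k" for k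
    using all[OF that, of 0] by (simp add: bs_def)
  have hbw: "hb ((eb ^^ k) u) \<in> ?S" if "K \<le> k" for k
    unfolding hb_hw[OF hw_funpow_eb[OF u] M]
    using w[of k] w[of "Suc k"] that by (intro S f) auto
  have fbw: "fb ((eb ^^ k) u) \<in> ?S" if K: "K \<le> k" for k
  proof (cases "k = K")
    case False
    then obtain l where l: "k = Suc l" "K \<le> l"
      using K by (cases k) (auto simp: le_Suc_eq)
    let ?m = "of_nat (n + 2 * l) :: complex" and ?w = "(eb ^^ l) u"
    have "?m + 3 \<noteq> 0"
      by (rule of_nat_add_numeral_nonzero)
    then have "fb (eb ?w) = (1 / (4 * (?m + 3))) \<cdot> ((4 * (?m + 3)) \<cdot> fb (eb ?w))"
      by (intro scale_divide_cancel no_zero_divisors) simp_all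
    also have "\<dots> \<in> ?S"
      unfolding fb_eb_hw[OF hw_funpow_eb[OF u] M C]
      using w[OF l(2)] hbw[OF l(2)] hbw[of "Suc l"] l(2) by (intro S f) auto
    finally show ?thesis by (simp add: l(1))
  qed (use assms(5) in simp)
  \<comment> \<open>The three claims need a joint induction: moving \<open>f\<close> past
    \<open>eb\<close> produces \<open>hb\<close>, and past \<open>hb\<close> it produces
    \<open>fb\<close>.\<close>
  have bar: "eb (bs u k j) \<in> ?S \<and> hb (bs u k j) \<in> ?S \<and> fb (bs u k j) \<in> ?S" if "K \<le> k" for k j
  proof (induction j)
    case 0
    have "eb ((eb ^^ k) u) \<in> ?S" using w[of "Suc k"] that by simp
    then show ?case using hbw[OF that] fbw[OF that] by (simp add: bs_def)
  next
    case (Suc j)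
    have "eb (bs u k (Suc j)) = f (eb (bs u k j)) + hb (bs u k j)"
      "hb (bs u k (Suc j)) = f (hb (bs u k j)) - 2 \<cdot> fb (bs u k j)"
      "fb (bs u k (Suc j)) = f (fb (bs u k j))"
      by (simp_all only: f_bs[symmetric] f_eb f_hb f_fb)
    note eqs = this
    show ?case unfolding eqs by (intro conjI S f) (use Suc in blast)+
  qed
  have "T x \<in> ?S" if T: "T \<in> {eb, hb, fb}" "x \<in> ?S" for T x
  proof (rule into[of T])
    show "T (bs u k j) \<in> ?S" if "K \<le> k" for k j
      using bar[OF that, of j] T(1) by blast
    show "Vector_Spaces.linear scale scale T"
      by (rule op_linear) (use T(1) in blast)
  qed (fact T(2))
  moreover have "h x \<in> ?S" if "x \<in> ?S" for x
  proof (rule into[of h])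
    show "h (bs u k j) \<in> ?S" if "K \<le> k" for k j
      unfolding h_bs[OF u] by (intro S all that)
  qed (use that in \<open>simp_all add: op_linear\<close>)
  moreover have "e x \<in> ?S" if "x \<in> ?S" for x
  proof (rule into[of e])
    show "e (bs u k j) \<in> ?S" if "K \<le> k" for k j
      using that by (cases j) (simp_all only: e_bs_0[OF u] e_bs_Suc[OF u] subspace_0[OF sub] S all)
  qed (use that in \<open>simp_all add: op_linear\<close>)
  ultimately show ?thesis using f sub unfolding stable_def by blast
qed

text \<open>The case left open by \<open>tail_stable\<close> is \<open>fb u\<close>. It is settled
  by \<open>lowest_fb\<close>, whose coefficient 2 n (n + 1) vanishes at n = 0, where
  \<open>lowest_zero\<close> takes over.\<close>

lemma stable_tail_0:
  assumes b: "hw_bounded n" and u: "hw (of_nat n) u"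
    and C: "\<And>k. Cas ((eb ^^ k) u) = \<zeta> \<cdot> (eb ^^ k) u" and M: "\<And>k. Mix ((eb ^^ k) u) = \<kappa> \<cdot> (eb ^^ k) u"
  shows "stable (tail u n 0)"
proof (rule tail_stable[OF assms])
  note sub = subspace_tail[of u n 0]
  note S = subspace_add[OF sub] subspace_diff[OF sub] subspace_scale[OF sub]
  have feb: "f (f (eb u)) \<in> tail u n 0"
    using bs_in_tail[of 0 1 2 n u] by (simp add: bs_def numeral_2_eq_2)
  have fu: "f u \<in> tail u n 0"
  proof (cases "n = 0")
    case True
    then show ?thesis using lowest_zero(1)[of u] b u subspace_0[OF sub] by simp
  qed (use bs_in_tail[of 0 0 1 n u] in \<open>simp add: bs_def\<close>)
  have hb: "hb u = (1 / (of_nat n + 2)) \<cdot> (\<kappa> \<cdot> u - 2 \<cdot> f (eb u))"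
    using hb_hw[OF u, of \<kappa>] M[of 0] by simp
  have fhb: "f (hb u) \<in> tail u n 0"
    unfolding hb op_simps by (intro S fu feb)
  have Mu: "Mix u = \<kappa> \<cdot> u" using M[of 0] by simp
  have "fb u \<in> tail u n 0"
  proof (cases "n = 0")
    case True
    have "fb u = (1 / 2) \<cdot> 2 \<cdot> fb u" by simp
    also have "2 \<cdot> fb u = f (hb u)" using lowest_zero(2)[of u] b u True by simp
    finally have "fb u = (1 / 2) \<cdot> f (hb u)" .
    then show ?thesis using fhb S by simp
  next
    case False
    let ?c = "2 * of_nat n * (of_nat n + 1) :: complex"
    have "of_nat n + 1 \<noteq> (0 :: complex)" using of_nat_add_numeral_nonzero[of n num.One] by simp
    then have "fb u = (1 / ?c) \<cdot> ?c \<cdot> fb u" using False by (intro scale_divide_cancel no_zero_divisors) simp_all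
    also have "\<dots> \<in> tail u n 0"
      unfolding lowest_fb[OF b u] op_simps Mu by (intro S fhb fu)
    finally show ?thesis .
  qed
  then show "fb ((eb ^^ 0) u) \<in> tail u n 0" by simp
qed

text \<open>When both scalars vanish, \<open>fb_eb_hw\<close> loses its terms in \<open>w\<close>
  and \<open>hb w\<close>. What is left of \<open>fb (eb u)\<close> is a multiple of
  \<open>f (f (eb (eb u)))\<close>, which lies above the lowest rung.\<close>

lemma stable_tail_1:
  assumes b: "hw_bounded n" and u: "hw (of_nat n) u"
    and C: "\<And>k. Cas ((eb ^^ k) u) = 0" and M: "\<And>k. Mix ((eb ^^ k) u) = 0"
  shows "stable (tail u n 1)"
proof (rule tail_stable[OF b u, of 0 0])
  have feb: "f (f (eb (eb u))) \<in> tail u n 1"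
    using bs_in_tail[of 1 2 2 n u] by (simp add: bs_def numeral_2_eq_2)
  have "fb (eb u) = (1 / (4 * (of_nat n + 3))) \<cdot> (4 * (of_nat n + 3)) \<cdot> fb (eb u)"
  proof -
    have "of_nat n + 3 \<noteq> (0 :: complex)"
      by (rule of_nat_add_numeral_nonzero)
    then show ?thesis by (intro scale_divide_cancel no_zero_divisors) simp_all
  qed
  also have "(4 * (of_nat n + 3)) \<cdot> fb (eb u) = 2 \<cdot> f (hb (eb u))"
    using fb_eb_hw[OF u, of 0 0] C[of 0] M[of 0] by simp
  also have "hb (eb u) = (1 / (of_nat (n + 2) + 2)) \<cdot> (0 \<cdot> eb u - 2 \<cdot> f (eb (eb u)))"
    using hb_hw[OF hw_funpow_eb[OF u, of 1], of 0] M[of 1] by simp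
  also have "(1 / (4 * (of_nat n + 3))) \<cdot> 2 \<cdot> f \<dots> \<in> tail u n 1"
    using feb by (simp add: op_simps subspace_scale subspace_tail subspace_neg)
  finally show "fb ((eb ^^ 1) u) \<in> tail u n 1" by simp
qed (simp_all add: C M)

text \<open>These are eigenvectors of \<open>sep\<close> with distinct eigenvalues. Selecting the
  nonzero ones by definition makes the result available before it is known which of them
  vanish.\<close>

lemma bs_independent:
  assumes u: "hw (of_nat n) u"
  defines "I \<equiv> {(k, j). bs u k j \<noteq> 0}"
  shows "inj_on (\<lambda>(k, j). bs u k j) I" "independent ((\<lambda>(k, j). bs u k j) ` I)"
proof -
  define l :: "nat \<times> nat \<Rightarrow> complex" where
    "l = (\<lambda>(k, j). of_nat (n + 2 * k) * (of_nat (n + 2 * k) + 2) + \<i> * (of_nat (n + 2 * k) - 2 * of_nat j))"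
  have ev: "sep ((\<lambda>(k, j). bs u k j) i) = l i \<cdot> (\<lambda>(k, j). bs u k j) i" for i
    using sep_funpow_f[OF hw_funpow_eb[OF u]] by (auto simp: l_def bs_def split: prod.split)
  have nz: "(\<lambda>(k, j). bs u k j) i \<noteq> 0" if "i \<in> I" for i
    using that by (auto simp: I_def)
  have inj: "inj_on l I"
  proof (rule inj_onI)
    fix x y assume "l x = l y"
    then show "x = y"
      using sep_eigenvalue_inj[of "n + 2 * fst x" "snd x" "n + 2 * fst y" "snd y"]
      by (cases x; cases y) (simp add: l_def)
  qed
  show "inj_on (\<lambda>(k, j). bs u k j) I"
    by (rule eigenvectors_inj[OF ev nz inj])
  show "independent ((\<lambda>(k, j). bs u k j) ` I)"
    by (rule eigenvectors_independent[OF sep_linear ev nz inj])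
qed

end

section \<open>Normal form of an infinite-dimensional simple module\<close>

locale takiff_basis = takiff_rep +
  fixes u :: 'a and n :: nat and \<zeta> \<kappa> :: complex
  assumes bounded: "hw_bounded n" and u: "hw (of_nat n) u" and nonzero: "(eb ^^ k) u \<noteq> 0"
    and Cas: "Cas x = \<zeta> \<cdot> x" and Mix: "Mix x = \<kappa> \<cdot> x"
    and kappa: "\<kappa> * \<kappa> = of_nat n * of_nat n * \<zeta>" and chi: "\<zeta> \<noteq> 0"
    and spanning: "tail u n 0 = UNIV"

context takiff_rep
begin

lemma simple_imp_basis:
  assumes simple: "\<And>S. stable S \<Longrightarrow> S = {0} \<or> S = UNIV"
    and C: "\<And>x. Cas x = \<zeta> \<cdot> x" and M: "\<And>x. Mix x = \<kappa> \<cdot> x"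
    and "hw m x" "x \<noteq> 0" and nat: "\<And>m x. hw m x \<Longrightarrow> x \<noteq> 0 \<Longrightarrow> m \<in> \<nat>"
    and inf: "\<And>B. finite B \<Longrightarrow> span B \<noteq> UNIV"
  shows "\<exists>u n. takiff_basis scale e f h eb fb hb u n \<zeta> \<kappa>"
proof -
  define n where "n = (LEAST n. \<exists>y. y \<noteq> 0 \<and> hw (of_nat n) y)"
  have ex: "\<exists>n::nat. \<exists>y. y \<noteq> 0 \<and> hw (of_nat n) y"
    using assms(4,5) nat[of m x] by (auto simp: Nats_def)
  then obtain u where u: "u \<noteq> 0" "hw (of_nat n) u"
    using LeastI_ex[OF ex] by (auto simp: n_def)
  have b: "hw_bounded n"
    unfolding hw_bounded_def
  proof (intro allI impI)
    fix m y assume "hw m y \<and> y \<noteq> 0"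
    with nat[of m y] obtain i where "m = of_nat i" "hw (of_nat i) y" "y \<noteq> 0" by (auto simp: Nats_def)
    then show "\<exists>i\<ge>n. m = of_nat i" unfolding n_def by (metis (mono_tags, lifting) Least_le)
  qed
  interpret Mix: Vector_Spaces.linear scale scale Mix by (fact Mix_linear)
  have "(\<kappa> * \<kappa>) \<cdot> u = (of_nat n * of_nat n * \<zeta>) \<cdot> u"
    using Mix_Mix[OF b u(2)] by (simp add: M C Mix.scale)
  then have kappa: "\<kappa> * \<kappa> = of_nat n * of_nat n * \<zeta>" using u(1) by simp
  have "u \<in> tail u n 0" using bs_in_tail[of 0 0 0 n u] by (simp add: bs_def)
  then have span0: "tail u n 0 = UNIV"
    using simple[OF stable_tail_0[OF b u(2) C M]] u(1) by auto
  \<comment> \<open>For \<zeta> = 0 also \<kappa> = 0, so \<open>tail u n 1\<close> is a submodule.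
    If it is zero, the n + 1 vectors \<open>bs u 0 j\<close> with \<open>j \<le> n\<close> span V;
    if it is everything, \<open>u\<close> depends on the other members of an independent
    family.\<close>
  have chi: "\<zeta> \<noteq> 0"
  proof
    assume "\<zeta> = 0"
    then have "stable (tail u n 1)"
      using kappa by (intro stable_tail_1[OF b u(2)]) (simp_all add: C M)
    then consider "tail u n 1 = {0}" | "tail u n 1 = UNIV" using simple by blast
    then show False
    proof cases
      case 1
      have "tail u n 0 \<subseteq> span ((\<lambda>j. bs u 0 j) ` {..n})"
        unfolding tail_def
      proof (rule span_minimal, safe)
        fix k j :: nat assume kj: "j \<le> n + 2 * k"
        show "bs u k j \<in> span ((\<lambda>j. bs u 0 j) ` {..n})"
        proof (cases k)
          case 0
          then show ?thesis using kj by (auto intro!: span_base)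
        next
          case (Suc i)
          then have "bs u k j \<in> tail u n 1" using kj by (intro bs_in_tail) auto
          then show ?thesis unfolding 1 by (auto simp: span_zero)
        qed
      qed
      then show False using inf[of "(\<lambda>j. bs u 0 j) ` {..n}"] span0 by auto
    next
      case 2
      define A where "A = (\<lambda>(k, j). bs u k j) ` {(k, j). bs u k j \<noteq> 0}"
      have uA: "u \<in> A" using u(1) by (auto simp: A_def bs_def image_iff intro!: exI[of _ 0])
      have "tail u n 1 \<subseteq> span (A - {u})"
        unfolding tail_def
      proof (rule span_minimal, safe)
        fix k j :: nat assume k: "1 \<le> k"
        show "bs u k j \<in> span (A - {u})"
        proof (cases "bs u k j = 0")
          case False
          moreover have "bs u k j \<noteq> bs u 0 0"
            using inj_onD[OF bs_independent(1)[OF u(2)], of "(k, j)" "(0, 0)"] False k u(1)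
            by (auto simp: bs_def)
          ultimately show ?thesis
            by (intro span_base) (auto simp: A_def bs_def)
        qed (simp add: span_zero)
      qed
      then have "u \<in> span (A - {u})" unfolding 2 by blast
      then show False
        using bs_independent(2)[OF u(2), folded A_def] uA unfolding dependent_def by blast
    qed
  qed
  \<comment> \<open>By \<kappa>^2 = n^2 \<zeta> and \<zeta> \<noteq> 0, the condition of
    \<open>eb_hw_nonzero\<close> at weight n + 2 k reads (n + 2 k + 2)^2 \<noteq> n^2.\<close>
  have nz: "(eb ^^ k) u \<noteq> 0" for k
  proof (induction k)
    case (Suc k)
    have "(of_nat (n + 2 * k) + 2) * (of_nat (n + 2 * k) + 2) \<noteq> (of_nat n * of_nat n :: complex)"
    proof
      assume "(of_nat (n + 2 * k) + 2) * (of_nat (n + 2 * k) + 2) = (of_nat n * of_nat n :: complex)"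
      then have "(of_nat ((n + 2 * k + 2) * (n + 2 * k + 2)) :: complex) = of_nat (n * n)"
        by (simp add: algebra_simps)
      then have "(n + 2 * k + 2) * (n + 2 * k + 2) = n * n" by (simp only: of_nat_eq_iff)
      moreover have "n * n < (n + 2 * k + 2) * (n + 2 * k + 2)"
        by (rule mult_strict_mono) auto
      ultimately show False by simp
    qed
    then have "eb ((eb ^^ k) u) \<noteq> 0"
      using chi by (intro eb_hw_nonzero[OF hw_funpow_eb[OF u(2)] M C Suc.IH]) (simp add: kappa)
    then show ?case by simp
  qed (use u(1) in simp)
  have "takiff_basis scale e f h eb fb hb u n \<zeta> \<kappa>"
    by unfold_locales (fact b u(2) nz C M kappa chi span0)+
  then show ?thesis by blast
qed

end

lemma (in vector_space) linear_eq_subspace: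
  assumes "Vector_Spaces.linear scale scale2 F" "Vector_Spaces.linear scale scale2 G"
  shows "subspace {x. F x = G x}"
proof -
  interpret F: Vector_Spaces.linear scale scale2 F by (fact assms(1))
  interpret G: Vector_Spaces.linear scale scale2 G by (fact assms(2))
  show ?thesis by (simp add: subspace_def F.zero F.add F.scale G.zero G.add G.scale)
qed

section \<open>Linear maps prescribed on the basis\<close>

context takiff_basis
begin

lemma bs_nonzero: "j \<le> n + 2 * k \<Longrightarrow> bs u k j \<noteq> 0"
  unfolding bs_def by (rule hw_funpow_f_nonzero[OF hw_funpow_eb[OF u] nonzero])

lemma basis_inj: "inj_on (\<lambda>(k, j). bs u k j) {(k, j). j \<le> n + 2 * k}"
  by (rule inj_on_subset[OF bs_independent(1)[OF u]]) (auto simp: bs_nonzero)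

lemma basis_independent: "independent ((\<lambda>(k, j). bs u k j) ` {(k, j). j \<le> n + 2 * k})"
  by (rule independent_mono[OF bs_independent(2)[OF u]]) (auto simp: bs_nonzero)

lemma basis_induct:
  assumes "subspace {x. P x}" "\<And>k j. j \<le> n + 2 * k \<Longrightarrow> P (bs u k j)"
  shows "P x"
proof -
  have "x \<in> span {bs u k j | k j. 0 \<le> k \<and> j \<le> n + 2 * k}"
    using spanning by (simp add: tail_def)
  then show ?thesis
    by (rule span_induct) (use assms in auto)
qed

lemma linear_extend:
  assumes "vector_space scale2"
  obtains F where "Vector_Spaces.linear scale scale2 F" "\<And>k j. j \<le> n + 2 * k \<Longrightarrow> F (bs u k j) = \<phi> k j"
proof -
  interpret vector_space_pair scale scale2
    using assms by (simp add: vector_space_pair_def vector_space_axioms)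
  let ?I = "{(k, j). j \<le> n + 2 * k}" and ?b = "\<lambda>(k, j). bs u k j"
  obtain F where F: "Vector_Spaces.linear scale scale2 F"
    "\<And>x. x \<in> ?b ` ?I \<Longrightarrow> F x = (case inv_into ?I ?b x of (k, j) \<Rightarrow> \<phi> k j)"
    using linear_independent_extend[OF basis_independent, of "\<lambda>x. case inv_into ?I ?b x of (k, j) \<Rightarrow> \<phi> k j"]
    by blast
  have "F (bs u k j) = \<phi> k j" if "j \<le> n + 2 * k" for k j
  proof -
    have "inv_into ?I ?b (?b (k, j)) = (k, j)"
      by (rule inv_into_f_f[OF basis_inj]) (use that in simp)
    moreover have "F (?b (k, j)) = (case inv_into ?I ?b (?b (k, j)) of (k, j) \<Rightarrow> \<phi> k j)"
      by (rule F(2)) (use that in blast)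
    ultimately show ?thesis by simp
  qed
  with F(1) show thesis using that by blast
qed

lemma weight_neq: "j = n + 2 * k \<Longrightarrow> of_nat (n + 2 * k) - 2 * of_nat j - (of_nat n + 2) \<noteq> (0 :: complex)"
proof
  assume j: "j = n + 2 * k" and "of_nat (n + 2 * k) - 2 * of_nat j - (of_nat n + 2) = (0 :: complex)"
  then have "Re (of_nat (n + 2 * k) - 2 * of_nat j - (of_nat n + 2)) = 0" by simp
  with j show False by simp
qed

text \<open>\<open>g\<close> inverts \<open>e\<close> up to \<open>low\<close>, the projection to
  the bottoms of the strings, which span a complement of the range of \<open>e\<close>. There the
  weight is -(n + 2 k), so h - (n + 2) is invertible, and \<rho> is its inverse extended by zero.
  Together they show that \<alpha> lies in the range of \<open>e\<close> as soon as (h - (n + 2))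
  \<alpha> does.\<close>

lemma obtain_inverse_e:
  obtains g low \<rho> where
    "\<And>x. e (g x) = x - low x" "\<And>x. \<rho> (h x - (of_nat n + 2) \<cdot> x) = low x"
    "\<And>x. low (e x) = 0" "\<And>x. \<rho> (e x) = 0" "low (bs u 0 n) = bs u 0 n"
    "\<And>c x. low (c \<cdot> x) = c \<cdot> low x"
proof -
  obtain g where g: "Vector_Spaces.linear scale scale g" "\<And>k j. j \<le> n + 2 * k \<Longrightarrow>
      g (bs u k j) = (if j < n + 2 * k then (1 / (of_nat (Suc j) * (of_nat (n + 2 * k) - of_nat j))) \<cdot> bs u k (Suc j) else 0)"
    by (rule linear_extend[OF vector_space_axioms, where \<phi> = "\<lambda>k j. (if j < n + 2 * k then (1 / (of_nat (Suc j) * (of_nat (n + 2 * k) - of_nat j))) \<cdot> bs u k (Suc j) else 0)"]) blast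
  obtain low where low: "Vector_Spaces.linear scale scale low" "\<And>k j. j \<le> n + 2 * k \<Longrightarrow>
      low (bs u k j) = (if j = n + 2 * k then bs u k j else 0)"
    by (rule linear_extend[OF vector_space_axioms, where \<phi> = "\<lambda>k j. (if j = n + 2 * k then bs u k j else 0)"]) blast
  obtain \<rho> where \<rho>: "Vector_Spaces.linear scale scale \<rho>" "\<And>k j. j \<le> n + 2 * k \<Longrightarrow>
      \<rho> (bs u k j) = (if j = n + 2 * k then (1 / (of_nat (n + 2 * k) - 2 * of_nat j - (of_nat n + 2))) \<cdot> bs u k j else 0)"
    by (rule linear_extend[OF vector_space_axioms, where \<phi> = "\<lambda>k j. (if j = n + 2 * k then (1 / (of_nat (n + 2 * k) - 2 * of_nat j - (of_nat n + 2))) \<cdot> bs u k j else 0)"]) blast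
  interpret g: Vector_Spaces.linear scale scale g by (fact g(1))
  interpret low: Vector_Spaces.linear scale scale low by (fact low(1))
  interpret \<rho>: Vector_Spaces.linear scale scale \<rho> by (fact \<rho>(1))
  note lin = g.zero g.add g.scale low.zero low.add low.scale \<rho>.zero \<rho>.add \<rho>.scale \<rho>.diff op_simps
  have 1: "e (g x) = x - low x" for x
  proof (rule basis_induct[of "\<lambda>x. e (g x) = x - low x"])
    fix k j assume j: "j \<le> n + 2 * k"
    show "e (g (bs u k j)) = bs u k j - low (bs u k j)"
    proof (cases "j < n + 2 * k")
      case True
      have "of_nat (n + 2 * k) - of_nat j \<noteq> (0 :: complex)"
        using True by (metis eq_iff_diff_eq_0 less_irrefl of_nat_eq_iff)
      moreover have "of_nat (Suc j) \<noteq> (0 :: complex)" by (rule of_nat_neq_0)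
      ultimately have "(1 / (of_nat (Suc j) * (of_nat (n + 2 * k) - of_nat j))) \<cdot> e (bs u k (Suc j)) = bs u k j"
        unfolding e_bs_Suc[OF u] by (simp del: of_nat_Suc of_nat_add)
      then show ?thesis using True by (simp add: g(2) low(2) op_simps del: of_nat_Suc of_nat_add)
    qed (use j in \<open>simp add: g(2) low(2) op_simps\<close>)
  qed (simp add: subspace_def lin scale_right_diff_distrib add_diff_add)
  have 2: "\<rho> (h x - (of_nat n + 2) \<cdot> x) = low x" for x
  proof (rule basis_induct[of "\<lambda>x. \<rho> (h x - (of_nat n + 2) \<cdot> x) = low x"])
    fix k j assume j: "j \<le> n + 2 * k"
    let ?c = "of_nat (n + 2 * k) - 2 * of_nat j - (of_nat n + 2) :: complex"
    have "h (bs u k j) - (of_nat n + 2) \<cdot> bs u k j = ?c \<cdot> bs u k j"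
      unfolding h_bs[OF u] by (simp only: scale_left_diff_distrib)
    then have "\<rho> (h (bs u k j) - (of_nat n + 2) \<cdot> bs u k j) = ?c \<cdot> \<rho> (bs u k j)"
      by (simp only: \<rho>.scale)
    also have "\<dots> = low (bs u k j)"
    proof (cases "j = n + 2 * k")
      case True
      have "\<rho> (bs u k j) = (1 / ?c) \<cdot> bs u k j" "low (bs u k j) = bs u k j"
        using \<rho>(2)[OF j] low(2)[OF j] unfolding if_P[OF True] by blast+
      then show ?thesis
        by (simp only: scale_scale times_divide_eq_right mult_1_right divide_self[OF weight_neq[OF True]] scale_one)
    qed (use j in \<open>simp add: \<rho>(2) low(2)\<close>)
    finally show "\<rho> (h (bs u k j) - (of_nat n + 2) \<cdot> bs u k j) = low (bs u k j)" .
  qed (simp add: subspace_def lin algebra_simps)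
  have 3: "low (e x) = 0 \<and> \<rho> (e x) = 0" for x
  proof (rule basis_induct[of "\<lambda>x. low (e x) = 0 \<and> \<rho> (e x) = 0"])
    fix k j assume j: "j \<le> n + 2 * k"
    then show "low (e (bs u k j)) = 0 \<and> \<rho> (e (bs u k j)) = 0"
    proof (cases j)
      case 0
      then show ?thesis by (simp add: e_bs_0[OF u] lin)
    next
      case (Suc i)
      with j have "low (bs u k i) = 0" "\<rho> (bs u k i) = 0" by (simp_all add: low(2) \<rho>(2))
      then show ?thesis unfolding Suc e_bs_Suc[OF u] lin by simp
    qed
  qed (auto simp: subspace_def lin)
  show thesis
    by (rule that[of g low \<rho>]) (use 1 2 3 low(2)[of n 0] in \<open>simp_all add: low.scale\<close>)
qed

text \<open>\<open>top\<close> projects to the tops \<open>(eb ^^ k) u\<close> of the strings, and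
  \<open>t\<close> reads off the coefficient of \<open>u\<close>. On the tops h - n acts by 2 k, so
  \<sigma> can invert it for k > 0; the component along \<open>u\<close> is the obstruction that
  remains.\<close>

lemma obtain_highest_projection:
  obtains top \<sigma> t where
    "\<And>x. e x = 0 \<Longrightarrow> top x = x" "\<And>x. h (\<sigma> x) - of_nat n \<cdot> \<sigma> x = top x - t x \<cdot> u"
    "\<And>x. e (\<sigma> x) = 0" "\<And>x. h (\<sigma> x) = \<sigma> (h x)" "\<And>c x. \<sigma> (c \<cdot> x) = c \<cdot> \<sigma> x"
proof -
  \<comment> \<open>At \<open>j = n + 2 * k\<close> the quotient is 1 / 0 = 0; the composite of
    \<open>g\<close> with \<open>e\<close> meets only \<open>j < n + 2 * k\<close>.\<close>
  obtain g where g: "Vector_Spaces.linear scale scale g" "\<And>k j. j \<le> n + 2 * k \<Longrightarrow>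
      g (bs u k j) = (1 / (of_nat (Suc j) * (of_nat (n + 2 * k) - of_nat j))) \<cdot> bs u k (Suc j)"
    by (rule linear_extend[OF vector_space_axioms, where \<phi> = "\<lambda>k j. (1 / (of_nat (Suc j) * (of_nat (n + 2 * k) - of_nat j))) \<cdot> bs u k (Suc j)"]) blast
  obtain top where top: "Vector_Spaces.linear scale scale top" "\<And>k j. j \<le> n + 2 * k \<Longrightarrow>
      top (bs u k j) = (if j = 0 then bs u k j else 0)"
    by (rule linear_extend[OF vector_space_axioms, where \<phi> = "\<lambda>k j. (if j = 0 then bs u k j else 0)"]) blast
  obtain \<sigma> where \<sigma>: "Vector_Spaces.linear scale scale \<sigma>" "\<And>k j. j \<le> n + 2 * k \<Longrightarrow>
      \<sigma> (bs u k j) = (if j = 0 \<and> k \<noteq> 0 then (1 / of_nat (2 * k)) \<cdot> bs u k j else 0)"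
    by (rule linear_extend[OF vector_space_axioms, where \<phi> = "\<lambda>k j. (if j = 0 \<and> k \<noteq> 0 then (1 / of_nat (2 * k)) \<cdot> bs u k j else 0)"]) blast
  have "vector_space ((*) :: complex \<Rightarrow> complex \<Rightarrow> complex)"
    by unfold_locales (simp_all add: algebra_simps)
  then obtain t where
    t: "Vector_Spaces.linear scale (*) t" "\<And>k j. j \<le> n + 2 * k \<Longrightarrow>
      t (bs u k j) = (if j = 0 \<and> k = 0 then 1 else 0)"
    by (rule linear_extend[where \<phi> = "\<lambda>k j. (if j = 0 \<and> k = 0 then 1 else 0)"]) blast
  interpret g: Vector_Spaces.linear scale scale g by (fact g(1))
  interpret top: Vector_Spaces.linear scale scale top by (fact top(1))
  interpret \<sigma>: Vector_Spaces.linear scale scale \<sigma> by (fact \<sigma>(1))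
  interpret t: Vector_Spaces.linear scale "(*)" t by (fact t(1))
  note lin = g.zero g.add g.scale top.zero top.add top.scale \<sigma>.zero \<sigma>.add \<sigma>.scale \<sigma>.diff
    t.zero t.add t.scale op_simps
  have 1: "g (e x) = x - top x" for x
  proof (rule basis_induct[of "\<lambda>x. g (e x) = x - top x"])
    fix k j assume j: "j \<le> n + 2 * k"
    show "g (e (bs u k j)) = bs u k j - top (bs u k j)"
    proof (cases j)
      case 0
      then show ?thesis by (simp add: e_bs_0[OF u] lin top(2))
    next
      case (Suc i)
      have "of_nat (n + 2 * k) - of_nat i \<noteq> (0 :: complex)"
        using Suc j by (metis Suc_n_not_le_n eq_iff_diff_eq_0 of_nat_eq_iff)
      moreover have "of_nat (Suc i) \<noteq> (0 :: complex)" by (rule of_nat_neq_0)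
      moreover have "i \<le> n + 2 * k" using Suc j by simp
      note g(2)[OF this]
      ultimately show ?thesis
        unfolding top(2)[OF j] unfolding Suc e_bs_Suc[OF u] lin by (simp del: of_nat_Suc of_nat_add)
    qed
  qed (simp add: subspace_def lin scale_right_diff_distrib add_diff_add)
  have 2: "h (\<sigma> x) - of_nat n \<cdot> \<sigma> x = top x - t x \<cdot> u" for x
  proof (rule basis_induct[of "\<lambda>x. h (\<sigma> x) - of_nat n \<cdot> \<sigma> x = top x - t x \<cdot> u"])
    fix k j assume j: "j \<le> n + 2 * k"
    have "h (bs u k 0) - of_nat n \<cdot> bs u k 0 = of_nat (2 * k) \<cdot> bs u k 0"
      unfolding h_bs[OF u] by (simp flip: scale_left_diff_distrib)
    then have "(1 / of_nat (2 * k)) \<cdot> (h (bs u k 0) - of_nat n \<cdot> bs u k 0) = bs u k 0" if "k \<noteq> 0"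
      using that by simp
    then show "h (\<sigma> (bs u k j)) - of_nat n \<cdot> \<sigma> (bs u k j) = top (bs u k j) - t (bs u k j) \<cdot> u"
      unfolding \<sigma>(2)[OF j] top(2)[OF j] t(2)[OF j]
      by (auto simp: lin bs_def scale_right_diff_distrib mult.commute)
  next
    have "Vector_Spaces.linear scale scale (\<lambda>x. h (\<sigma> x) - of_nat n \<cdot> \<sigma> x)"
      "Vector_Spaces.linear scale scale (\<lambda>x. top x - t x \<cdot> u)"
      by (unfold_locales; simp add: lin algebra_simps)+
    then show "subspace {x. h (\<sigma> x) - of_nat n \<cdot> \<sigma> x = top x - t x \<cdot> u}"
      by (rule linear_eq_subspace)
  qed
  have 3: "e (\<sigma> x) = 0 \<and> h (\<sigma> x) = \<sigma> (h x)" for x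
  proof (rule basis_induct[of "\<lambda>x. e (\<sigma> x) = 0 \<and> h (\<sigma> x) = \<sigma> (h x)"])
    fix k j assume j: "j \<le> n + 2 * k"
    have "e (\<sigma> (bs u k j)) = 0"
      unfolding \<sigma>(2)[OF j] by (simp add: lin e_bs_0[OF u])
    moreover have "h (\<sigma> (bs u k j)) = \<sigma> (h (bs u k j))"
      unfolding h_bs[OF u] \<sigma>.scale unfolding \<sigma>(2)[OF j] by (simp add: lin h_bs[OF u] mult.commute)
    ultimately show "e (\<sigma> (bs u k j)) = 0 \<and> h (\<sigma> (bs u k j)) = \<sigma> (h (bs u k j))" ..
  qed (simp add: subspace_def lin)
  have 4: "top x = x" if "e x = 0" for x
    using 1[of x] that by (simp add: lin)
  show thesis
    by (rule that[of top \<sigma> t]) (use 2 3 4 in \<open>simp_all add: \<sigma>.scale\<close>)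
qed

end

section \<open>Splitting self-extensions with constant Casimir operator\<close>

locale takiff_extension =
  V: takiff_basis scale e f h eb fb hb u n \<zeta> \<kappa> + E: takiff_rep scale' e' f' h' eb' fb' hb'
  for scale :: "complex \<Rightarrow> 'v::ab_group_add \<Rightarrow> 'v" (infixr "\<cdot>" 75) and e f h eb fb hb u n \<zeta> \<kappa>
    and scale' :: "complex \<Rightarrow> 'e::ab_group_add \<Rightarrow> 'e" (infixr "\<odot>" 75) and e' f' h' eb' fb' hb' +
  fixes i :: "'v \<Rightarrow> 'e" and p :: "'e \<Rightarrow> 'v"
  assumes i_linear: "Vector_Spaces.linear scale scale' i" and p_linear: "Vector_Spaces.linear scale' scale p"
    and i_op: "i (e x) = e' (i x)" "i (f x) = f' (i x)" "i (h x) = h' (i x)"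
      "i (eb x) = eb' (i x)" "i (fb x) = fb' (i x)" "i (hb x) = hb' (i x)"
    and p_op: "p (e' y) = e (p y)" "p (f' y) = f (p y)" "p (h' y) = h (p y)"
      "p (eb' y) = eb (p y)" "p (fb' y) = fb (p y)" "p (hb' y) = hb (p y)"
    and i_inj: "i x = 0 \<Longrightarrow> x = 0"
    and exact: "p y = 0 \<longleftrightarrow> y \<in> range i"
    and p_surj: "surj p"
begin

sublocale i: Vector_Spaces.linear scale scale' i by (fact i_linear)
sublocale p: Vector_Spaces.linear scale' scale p by (fact p_linear)

lemma p_i: "p (i x) = 0"
  by (simp add: exact)

lemma i_cancel: "i x = i y \<Longrightarrow> x = y"
  using i_inj[of "x - y"] by (simp add: i.diff)

lemma hw_p: "E.hw m y \<Longrightarrow> V.hw m (p y)"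
  by (simp add: E.hw_def V.hw_def p.zero p.scale flip: p_op)

lemma hw_i: "E.hw m (i x) \<Longrightarrow> V.hw m x"
  unfolding E.hw_def V.hw_def by (auto simp: i.scale i_inj i_cancel simp flip: i_op)

lemma E_bounded: "E.hw_bounded n"
  unfolding E.hw_bounded_def
proof (intro allI impI)
  fix m y assume y: "E.hw m y \<and> y \<noteq> 0"
  show "\<exists>i\<ge>n. m = of_nat i"
  proof (cases "p y = 0")
    case True
    then obtain x where "y = i x" by (auto simp: exact)
    then have "V.hw m x" "x \<noteq> 0" using y hw_i by (auto simp: i.zero)
    then show ?thesis using V.bounded unfolding V.hw_bounded_def by blast
  next
    case False
    then show ?thesis using y hw_p V.bounded unfolding V.hw_bounded_def by blast
  qed
qed

lemma p_funpow: "p ((f' ^^ j) y) = (f ^^ j) (p y)"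
  by (induction j) (simp_all add: p_op)

lemma i_funpow: "i ((f ^^ j) x) = (f' ^^ j) (i x)"
  by (induction j) (simp_all add: i_op)

text \<open>First correct an arbitrary lift of \<open>u\<close> to one killed by \<open>e\<close>, then to one with \<open>h v - n v\<close>
  a multiple of \<open>u\<close>; this multiple vanishes since \<open>f\<^sup>n u\<close> is not in the range of \<open>e\<close>.\<close>

lemma lift_highest: "\<exists>v. E.hw (of_nat n) v \<and> p v = u"
proof -
  let ?n = "of_nat n :: complex"
  have eu: "e u = 0" and hu: "h u = ?n \<cdot> u" using V.u by (simp_all add: V.hw_def)
  obtain g low \<rho> where g: "\<And>x. e (g x) = x - low x" "\<And>x. \<rho> (h x - (?n + 2) \<cdot> x) = low x"
    "\<And>x. low (e x) = 0" "\<And>x. \<rho> (e x) = 0" "low (V.bs u 0 n) = V.bs u 0 n" "\<And>c x. low (c \<cdot> x) = c \<cdot> low x"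
    by (rule V.obtain_inverse_e) blast
  obtain top \<sigma> t where t: "\<And>x. e x = 0 \<Longrightarrow> top x = x" "\<And>x. h (\<sigma> x) - ?n \<cdot> \<sigma> x = top x - t x \<cdot> u"
    "\<And>x. e (\<sigma> x) = 0"
    by (rule V.obtain_highest_projection) blast
  obtain v0 where v0: "p v0 = u" using p_surj by (metis surjD)
  have "p (e' v0) = 0" by (simp add: p_op v0 eu)
  then obtain \<alpha> where \<alpha>: "e' v0 = i \<alpha>" by (auto simp: exact)
  have "p (h' v0 - ?n \<odot> v0) = 0" by (simp add: p_op p.diff p.scale v0 hu)
  then obtain \<beta> where \<beta>: "h' v0 - ?n \<odot> v0 = i \<beta>" by (auto simp: exact)
  \<comment> \<open>The relation [h, e] = 2 e links the defects \<alpha> and \<beta> of the lift;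
    applying \<rho> to it gives \<open>low \<alpha> = 0\<close>, so \<alpha> is
    \<open>e (g \<alpha>)\<close> and can be subtracted away.\<close>
  have "i (e \<beta>) = e' (h' v0 - ?n \<odot> v0)" by (simp add: i_op \<beta>)
  also have "\<dots> = h' (e' v0) - (?n + 2) \<odot> e' v0"
    by (simp add: E.comm E.op_simps algebra_simps)
  also have "\<dots> = i (h \<alpha> - (?n + 2) \<cdot> \<alpha>)"
    by (simp add: \<alpha> i_op i.diff i.scale)
  finally have "e \<beta> = h \<alpha> - (?n + 2) \<cdot> \<alpha>" by (rule i_cancel)
  then have "low \<alpha> = 0" using g(2)[of \<alpha>] g(4)[of \<beta>] by simp
  then have eg: "e (g \<alpha>) = \<alpha>" using g(1)[of \<alpha>] by simp
  define v1 where "v1 = v0 - i (g \<alpha>)"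
  define \<beta>1 where "\<beta>1 = \<beta> - (h (g \<alpha>) - ?n \<cdot> g \<alpha>)"
  have ev1: "e' v1 = 0" by (simp add: v1_def E.op_simps \<alpha> eg flip: i_op)
  have hv1: "h' v1 - ?n \<odot> v1 = i \<beta>1"
  proof -
    have "h' v1 - ?n \<odot> v1 = (h' v0 - ?n \<odot> v0) - (h' (i (g \<alpha>)) - ?n \<odot> i (g \<alpha>))"
      by (simp add: v1_def E.op_simps algebra_simps)
    also have "\<dots> = i \<beta>1" by (simp only: \<beta> \<beta>1_def i.diff i.scale i_op)
    finally show ?thesis .
  qed
  have "i (e \<beta>1) = e' (h' v1 - ?n \<odot> v1)" by (simp add: i_op hv1)
  also have "\<dots> = 0" by (simp add: E.comm E.op_simps ev1)
  finally have "e \<beta>1 = 0" by (rule i_inj)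
  note top = t(1)[OF this]
  \<comment> \<open>As \<open>e \<beta>1 = 0\<close>, the new defect consists of tops of strings,
    and \<sigma> removes all of it but a multiple of \<open>u\<close>.\<close>
  define v where "v = v1 - i (\<sigma> \<beta>1)"
  define a where "a = t \<beta>1"
  have pv: "p v = u" by (simp add: v_def v1_def p.diff v0 p_i)
  have ev: "e' v = 0" by (simp add: v_def E.op_simps ev1 t(3) i.zero flip: i_op)
  have hv: "h' v - ?n \<odot> v = a \<odot> i u"
  proof -
    have "h' v - ?n \<odot> v = (h' v1 - ?n \<odot> v1) - (h' (i (\<sigma> \<beta>1)) - ?n \<odot> i (\<sigma> \<beta>1))"
      by (simp add: v_def E.op_simps algebra_simps)
    also have "\<dots> = i (\<beta>1 - (h (\<sigma> \<beta>1) - ?n \<cdot> \<sigma> \<beta>1))" by (simp only: hv1 i.diff i.scale i_op)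
    also have "\<dots> = i (a \<cdot> u)" by (simp add: t(2) top a_def)
    finally show ?thesis by (simp add: i.scale)
  qed
  \<comment> \<open>This vector lies in the image of V because \<open>(f ^^ Suc n) u = 0\<close>.
    Applying \<open>e\<close> to it gives (n + 1) a f^n u, which \<open>low\<close> fixes, whereas
    \<open>low\<close> vanishes on the range of \<open>e\<close>; hence a = 0.\<close>
  have "p ((f' ^^ Suc n) v) = 0"
    by (simp only: p_funpow pv V.funpow_f_hw_zero[OF V.bounded V.u])
  then obtain w where w: "(f' ^^ Suc n) v = i w" by (auto simp: exact)
  have z: "(f' ^^ j) 0 = 0" and s: "(f' ^^ j) (c \<odot> y) = c \<odot> (f' ^^ j) y" for j y c
    by (induction j) (simp_all add: E.op_simps)
  have "i (e w) = of_nat (Suc n) \<odot> a \<odot> i ((f ^^ n) u)"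
    by (simp only: i_op flip: w) (simp only: E.e_funpow_f ev z hv s i_funpow add_0_left)
  also have "\<dots> = i ((of_nat (Suc n) * a) \<cdot> V.bs u 0 n)"
    by (simp add: V.bs_def i.scale)
  finally have ew: "e w = (of_nat (Suc n) * a) \<cdot> V.bs u 0 n" by (rule i_cancel)
  have "(of_nat (Suc n) * a) \<cdot> V.bs u 0 n = 0"
    using g(3)[of w] by (simp only: ew g(5,6))
  then have "a = 0" using V.bs_nonzero[of n 0] by (simp del: of_nat_Suc)
  with ev hv pv show ?thesis by (auto simp: E.hw_def)
qed

text \<open>The deviation from \<kappa> is a highest weight vector of weight n in V, and among the
  tops of the strings only \<open>u\<close> has that weight; so it is a multiple of
  \<open>u\<close>. Its coefficient is removed by squaring, since \<open>Mix_Mix\<close> sees only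
  the scalar \<zeta>, or by \<open>lowest_zero\<close> when n = 0.\<close>

lemma Mix_lift:
  assumes C: "\<And>y. E.Cas y = \<zeta> \<odot> y" and v: "E.hw (of_nat n) v" and pv: "p v = u"
  shows "E.Mix v = \<kappa> \<odot> v"
proof -
  let ?n = "of_nat n :: complex"
  interpret M: Vector_Spaces.linear scale' scale' E.Mix by (fact E.Mix_linear)
  obtain top \<sigma> t where t: "\<And>x. e x = 0 \<Longrightarrow> top x = x" "\<And>x. h (\<sigma> x) - ?n \<cdot> \<sigma> x = top x - t x \<cdot> u"
    "\<And>x. h (\<sigma> x) = \<sigma> (h x)" "\<And>c x. \<sigma> (c \<cdot> x) = c \<cdot> \<sigma> x"
    by (rule V.obtain_highest_projection) blast
  have pM: "p (E.Mix y) = V.Mix (p y)" for y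
    by (simp add: E.Mix_def V.Mix_def p.add p.scale p_op)
  have iM: "E.Mix (i x) = \<kappa> \<odot> i x" for x
  proof -
    have "E.Mix (i x) = i (V.Mix x)"
      by (simp add: E.Mix_def V.Mix_def i.add i.scale i_op)
    then show ?thesis by (simp add: V.Mix i.scale)
  qed
  have "p (E.Mix v - \<kappa> \<odot> v) = 0" by (simp add: p.diff p.scale pM pv V.Mix)
  then obtain w where w: "E.Mix v - \<kappa> \<odot> v = i w" by (auto simp: exact)
  have "E.hw ?n (E.Mix v)" by (rule E.hw_Mix[OF v])
  then have "E.hw ?n (i w)"
    using v unfolding w[symmetric] by (simp add: E.hw_def E.op_simps algebra_simps)
  then have "V.hw ?n w" by (rule hw_i)
  then have "top w = w" "h w = ?n \<cdot> w" by (auto simp: V.hw_def t(1))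
  with t(2)[of w] have wu: "w = t w \<cdot> u" by (simp add: t(3,4))
  define c where "c = t w"
  have Mv: "E.Mix v = \<kappa> \<odot> v + c \<odot> i u"
    using w wu by (metis c_def add.commute diff_add_cancel i.scale)
  have "c = 0"
  proof (cases "n = 0")
    case True
    have "\<kappa> = 0" using V.kappa True by simp
    moreover have "E.Mix v = 0" using E.lowest_zero(3)[of v] E_bounded v True by simp
    ultimately have "c \<odot> i u = 0" using Mv by simp
    then show ?thesis using i_inj V.nonzero[of 0] by auto
  next
    case False
    then have \<kappa>: "\<kappa> \<noteq> 0" using V.kappa V.chi by auto
    have "E.Mix (E.Mix v) = (\<kappa> * \<kappa>) \<odot> v"
      by (simp add: E.Mix_Mix[OF E_bounded v] C V.kappa mult.assoc)
    moreover have "E.Mix (E.Mix v) = (\<kappa> * \<kappa>) \<odot> v + (2 * \<kappa> * c) \<odot> i u"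
    proof -
      have "E.Mix (E.Mix v) = \<kappa> \<odot> (\<kappa> \<odot> v + c \<odot> i u) + c \<odot> \<kappa> \<odot> i u"
        by (subst Mv) (simp only: M.add M.scale iM Mv)
      also have "\<dots> = (\<kappa> * \<kappa>) \<odot> v + (2 * \<kappa> * c) \<odot> i u"
        by (simp add: algebra_simps flip: E.scale_left_distrib)
      finally show ?thesis .
    qed
    ultimately have "(2 * \<kappa> * c) \<odot> i u = 0" by simp
    then show ?thesis using \<kappa> i_inj V.nonzero[of 0] by auto
  qed
  then show ?thesis using Mv by simp
qed

text \<open>Equivariance needs no comparison of structure constants. The range of \<open>s\<close>
  is \<open>tail v n 0\<close>, which is stable under the operators of E, and \<open>p\<close> is
  injective on it because \<open>p (s x) = x\<close>; so an operator applied to \<open>s x\<close>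
  is \<open>s\<close> of the element it projects to.\<close>

lemma split:
  assumes C: "\<And>y. E.Cas y = \<zeta> \<odot> y"
  shows "\<exists>s. Vector_Spaces.linear scale scale' s \<and> (\<forall>x. p (s x) = x) \<and>
    (\<forall>x. s (e x) = e' (s x) \<and> s (f x) = f' (s x) \<and> s (h x) = h' (s x) \<and>
      s (eb x) = eb' (s x) \<and> s (fb x) = fb' (s x) \<and> s (hb x) = hb' (s x))"
proof -
  obtain v where v: "E.hw (of_nat n) v" "p v = u" using lift_highest by blast
  have Mix: "E.Mix ((eb' ^^ k) v) = \<kappa> \<odot> (eb' ^^ k) v" for k
    by (induction k) (simp_all add: Mix_lift[OF C v] E.Mix_commute E.op_simps)
  have stable: "E.stable (E.tail v n 0)"
    by (rule E.stable_tail_0[OF E_bounded v(1) C Mix])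
  obtain s where s: "Vector_Spaces.linear scale scale' s"
    "\<And>k j. j \<le> n + 2 * k \<Longrightarrow> s (V.bs u k j) = E.bs v k j"
    by (rule V.linear_extend[OF E.vector_space_axioms, of "E.bs v"]) blast
  interpret s: Vector_Spaces.linear scale scale' s by (fact s(1))
  have pe: "p ((eb' ^^ k) v) = (eb ^^ k) u" for k
    by (induction k) (simp_all add: p_op v(2))
  then have pbs: "p (E.bs v k j) = V.bs u k j" for k j
    by (simp add: E.bs_def V.bs_def p_funpow)
  have ps: "p (s x) = x" for x
    by (rule V.basis_induct[of "\<lambda>x. p (s x) = x"])
      (simp_all add: V.subspace_def s.zero s.add s.scale p.zero p.add p.scale s(2) pbs)
  have s_tail: "s x \<in> E.tail v n 0" for x
  proof (rule V.basis_induct[of "\<lambda>x. s x \<in> E.tail v n 0"])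
    show "V.subspace {x. s x \<in> E.tail v n 0}"
      using E.subspace_tail[of v n 0]
      by (simp add: E.subspace_def V.subspace_def s.zero s.add s.scale)
  qed (simp add: s(2) E.bs_in_tail)
  have tail_s: "E.tail v n 0 \<subseteq> range s"
    unfolding E.tail_def
  proof (rule E.span_minimal)
    show "{E.bs v k j |k j. 0 \<le> k \<and> j \<le> n + 2 * k} \<subseteq> range s"
    proof safe
      fix k j assume "j \<le> n + 2 * k"
      then show "E.bs v k j \<in> range s" using s(2)[of j k] by (metis rangeI)
    qed
    show "E.subspace (range s)" by (rule s.subspace_image) simp
  qed
  have comm: "s (T x) = T' (s x)" if "T' \<in> {e', f', h', eb', fb', hb'}" "\<And>y. p (T' y) = T (p y)" for T T' x
  proof -
    have "T' (s x) \<in> range s"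
      using stable s_tail[of x] tail_s that(1) unfolding E.stable_def by blast
    then obtain y where y: "T' (s x) = s y" by blast
    then have "y = T x" using that(2)[of "s x"] by (simp add: ps)
    then show ?thesis using y by simp
  qed
  show ?thesis
    using s(1) ps comm[of e' e] comm[of f' f] comm[of h' h] comm[of eb' eb] comm[of fb' fb] comm[of hb' hb]
    by (intro exI[of _ s]) (simp add: p_op)
qed

end

section \<open>The standard basis of the Takiff algebra\<close>

definition mat_e :: "complex^2^2" where "mat_e = vector [vector [0, 1], vector [0, 0]]"
definition mat_f :: "complex^2^2" where "mat_f = vector [vector [0, 0], vector [1, 0]]"
definition mat_h :: "complex^2^2" where "mat_h = vector [vector [1, 0], vector [0, - 1]]"

lemmas mat_defs = mat_e_def mat_f_def mat_h_def

lemma mat_in_sl2 [simp]: "mat_e \<in> sl2" "mat_f \<in> sl2" "mat_h \<in> sl2" "0 \<in> sl2"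
  by (simp_all add: mat_defs sl2_def trace_def sum_2)

lemma tensor_in_takiff: "A \<in> sl2 \<Longrightarrow> (A, 0) \<in> takiff" "A \<in> sl2 \<Longrightarrow> (0, A) \<in> takiff"
  by (simp_all add: takiff_def)

lemma tensor_in_takiff_g: "A \<in> sl2 \<Longrightarrow> (A, 0) \<in> takiff_g"
  by (auto simp: takiff_g_def takiff_tensor_def)

lemma takiff_g_subset: "takiff_g \<subseteq> takiff"
  by (auto simp: takiff_g_def takiff_tensor_def tensor_in_takiff)

lemma mat_brackets:
  "mat_bracket mat_e mat_f = mat_h" "mat_bracket mat_e mat_h = mat_smult (- 2) mat_e"
  "mat_bracket mat_h mat_e = mat_smult 2 mat_e" "mat_bracket mat_h mat_f = mat_smult (- 2) mat_f"
  "mat_bracket mat_f mat_e = mat_smult (- 1) mat_h" "mat_bracket mat_f mat_h = mat_smult 2 mat_f"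
  "mat_bracket A A = 0" "mat_smult c 0 = 0"
  by (simp_all add: mat_defs mat_bracket_def mat_smult_def matrix_matrix_mult_def vec_eq_iff forall_2 sum_2)

lemma sl2_decompose:
  assumes "A \<in> sl2"
  shows "A = mat_smult (A $ 1 $ 2) mat_e + mat_smult (A $ 2 $ 1) mat_f + mat_smult (A $ 1 $ 1) mat_h"
  using assms
  by (simp add: sl2_def trace_def mat_defs mat_smult_def vec_eq_iff forall_2 sum_2 add_eq_0_iff)

lemma module_rep:
  assumes M: "takiff_module M"
  shows "takiff_rep (scal M) (act M (mat_e, 0)) (act M (mat_f, 0)) (act M (mat_h, 0))
    (act M (0, mat_e)) (act M (0, mat_f)) (act M (0, mat_h))"
proof -
  interpret vector_space "scal M" using M by (simp add: takiff_module_def)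
  note mem = tensor_in_takiff mat_in_sl2
  have br: "act M X (act M Y v) = act M Y (act M X v) + act M (takiff_bracket X Y) v"
    if "X \<in> takiff" "Y \<in> takiff" for X Y v
    using M that by (simp add: takiff_module_def)
  have sm: "act M (takiff_smult c X) v = scal M c (act M X v)" if "X \<in> takiff" for c X v
    using M that by (simp add: takiff_module_def)
  have smp: "act M (mat_smult c A, 0) v = scal M c (act M (A, 0) v)"
    "act M (0, mat_smult c A) v = scal M c (act M (0, A) v)" if "A \<in> sl2" for c A v
    using sm[of "(A, 0)" c v] sm[of "(0, A)" c v] that by (simp_all add: mem takiff_smult_def mat_brackets)
  have z: "act M (0, 0) v = 0" for v
    using sm[of "(0, 0)" 0 v] by (simp add: mem takiff_smult_def mat_brackets)
  show ?thesis
  proof (intro takiff_rep.intro takiff_rep_axioms.intro vector_space_axioms)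
    fix T assume "T \<in> {act M (mat_e, 0), act M (mat_f, 0), act M (mat_h, 0),
      act M (0, mat_e), act M (0, mat_f), act M (0, mat_h)}"
    then show "Vector_Spaces.linear (scal M) (scal M) T"
      using M mem unfolding takiff_module_def by blast
  qed (subst br; simp add: mem takiff_bracket_def mat_brackets smp z)+
qed

lemma act_decompose:
  assumes M: "takiff_module M" and A: "A \<in> sl2" and B: "B \<in> sl2"
  shows "act M (A, B) v =
    (scal M (A $ 1 $ 2) (act M (mat_e, 0) v) + scal M (A $ 2 $ 1) (act M (mat_f, 0) v) + scal M (A $ 1 $ 1) (act M (mat_h, 0) v))
  + (scal M (B $ 1 $ 2) (act M (0, mat_e) v) + scal M (B $ 2 $ 1) (act M (0, mat_f) v) + scal M (B $ 1 $ 1) (act M (0, mat_h) v))"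
proof -
  note mem = tensor_in_takiff mat_in_sl2
  have ad: "act M (X + Y) v = act M X v + act M Y v" if "X \<in> takiff" "Y \<in> takiff" for X Y
    using M that by (simp add: takiff_module_def)
  have sm: "act M (takiff_smult c X) v = scal M c (act M X v)" if "X \<in> takiff" for c X
    using M that by (simp add: takiff_module_def)
  have cl: "takiff_smult c X \<in> takiff" if "X \<in> takiff" for c X
    using takiff_closed(2)[OF that that] .
  have "(A, B) = (takiff_smult (A $ 1 $ 2) (mat_e, 0) + takiff_smult (A $ 2 $ 1) (mat_f, 0) + takiff_smult (A $ 1 $ 1) (mat_h, 0))
    + (takiff_smult (B $ 1 $ 2) (0, mat_e) + takiff_smult (B $ 2 $ 1) (0, mat_f) + takiff_smult (B $ 1 $ 1) (0, mat_h))"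
    using sl2_decompose[OF A] sl2_decompose[OF B] by (simp add: takiff_smult_def mat_brackets)
  then show ?thesis
    by (simp only: ad sm cl mem takiff_closed(1))
qed

lemma takiff_induct:
  assumes M: "takiff_module M" and X: "X \<in> takiff"
    and basis: "\<And>A. A \<in> {mat_e, mat_f, mat_h} \<Longrightarrow> act M (A, 0) v \<in> S \<and> act M (0, A) v \<in> S"
    and S: "module.subspace (scal M) S"
  shows "act M X v \<in> S"
proof -
  interpret vector_space "scal M" using M by (simp add: takiff_module_def)
  obtain A B where X: "X = (A, B)" "A \<in> sl2" "B \<in> sl2" using X by (auto simp: takiff_def)
  show ?thesis
    unfolding X(1) act_decompose[OF M X(2,3)]
    using basis by (intro subspace_add[OF S] subspace_scale[OF S]) blast+
qed

lemma submodI: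
  assumes M: "takiff_module M" and S: "module.subspace (scal M) S"
    and basis: "\<And>A x. A \<in> {mat_e, mat_f, mat_h} \<Longrightarrow> x \<in> S \<Longrightarrow> act M (A, 0) x \<in> S \<and> act M (0, A) x \<in> S"
  shows "submod takiff M S"
  using assms unfolding submod_def by (auto intro: takiff_induct)

lemma homI:
  assumes M: "takiff_module M" and N: "takiff_module N"
    and lin: "Vector_Spaces.linear (scal M) (scal N) F"
    and basis: "\<And>A x. A \<in> {mat_e, mat_f, mat_h} \<Longrightarrow>
      F (act M (A, 0) x) = act N (A, 0) (F x) \<and> F (act M (0, A) x) = act N (0, A) (F x)"
  shows "hom_on takiff UNIV M N F"
proof -
  interpret F: Vector_Spaces.linear "scal M" "scal N" F by (fact lin)
  have "F (act M X x) = act N X (F x)" if "X \<in> takiff" for X x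
  proof -
    obtain A B where X: "X = (A, B)" "A \<in> sl2" "B \<in> sl2" using \<open>X \<in> takiff\<close> by (auto simp: takiff_def)
    show ?thesis
      using basis by (simp add: X(1) act_decompose[OF M X(2,3)] act_decompose[OF N X(2,3)] F.add F.scale)
  qed
  then show ?thesis by (simp add: hom_on_def F.add F.scale)
qed

section \<open>Schur's lemma for Harish-Chandra modules\<close>

text \<open>The clause about additive maps \<open>A\<close> reflects the uniqueness of the
  decomposition. Taking scalar multiplication or the action of an element of sl2 for
  \<open>A\<close> shows each projection to be linear and equivariant.\<close>

definition projections :: "'a::ab_group_add set set \<Rightarrow> ('a set \<Rightarrow> 'a \<Rightarrow> 'a) \<Rightarrow> bool" where
  "projections \<S> \<pi> \<longleftrightarrow>
    (\<forall>v. finite {S \<in> \<S>. \<pi> S v \<noteq> 0} \<and> v = (\<Sum>S\<in>{S \<in> \<S>. \<pi> S v \<noteq> 0}. \<pi> S v)) \<and>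
    (\<forall>S\<in>\<S>. (\<forall>v. \<pi> S v \<in> S) \<and> (\<forall>v w. \<pi> S (v + w) = \<pi> S v + \<pi> S w) \<and>
      (\<forall>A. (\<forall>x y. A (x + y) = A x + A y) \<and> (\<forall>S\<in>\<S>. A ` S \<subseteq> S) \<longrightarrow> (\<forall>v. \<pi> S (A v) = A (\<pi> S v))))"

lemma projectionsD:
  assumes "projections \<S> \<pi>"
  shows "finite {S \<in> \<S>. \<pi> S v \<noteq> 0}" "(\<Sum>S\<in>{S \<in> \<S>. \<pi> S v \<noteq> 0}. \<pi> S v) = v"
    "S \<in> \<S> \<Longrightarrow> \<pi> S v \<in> S" "S \<in> \<S> \<Longrightarrow> \<pi> S (v + w) = \<pi> S v + \<pi> S w"
    "S \<in> \<S> \<Longrightarrow> (\<And>x y. A (x + y) = A x + A y) \<Longrightarrow> (\<And>S x. S \<in> \<S> \<Longrightarrow> x \<in> S \<Longrightarrow> A x \<in> S) \<Longrightarrow>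
      \<pi> S (A v) = A (\<pi> S v)"
  using assms unfolding projections_def by (auto simp: image_subset_iff)

text \<open>Applying \<open>A\<close> termwise to the decomposition of \<open>v\<close> gives a
  decomposition of \<open>A v\<close>, so by uniqueness taking components commutes with
  \<open>A\<close>.\<close>

lemma direct_sum_projections:
  fixes \<S> :: "'a::ab_group_add set set"
  assumes ds: "is_direct_sum \<S>"
    and add: "\<And>S x y. S \<in> \<S> \<Longrightarrow> x \<in> S \<Longrightarrow> y \<in> S \<Longrightarrow> x + y \<in> S"
  shows "\<exists>\<pi>. projections \<S> \<pi>"
proof -
  define D where "D v f \<longleftrightarrow> (\<forall>S\<in>\<S>. f S \<in> S) \<and> (\<forall>S. S \<notin> \<S> \<longrightarrow> f S = 0) \<and>
    finite {S. f S \<noteq> 0} \<and> v = (\<Sum>S | f S \<noteq> 0. f S)" for v f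
  have ex1: "\<exists>!f. D v f" for v using ds by (simp add: is_direct_sum_def D_def)
  define dec where "dec v = (THE f. D v f)" for v
  have dec: "D v (dec v)" for v unfolding dec_def by (rule theI'[OF ex1])
  have uniq: "dec v = f" if "D v f" for v f using ex1 dec that by blast
  have DI: "D v f" if "\<And>S. S \<in> \<S> \<Longrightarrow> f S \<in> S" "\<And>S. S \<notin> \<S> \<Longrightarrow> f S = 0" "finite F" "\<And>S. S \<notin> F \<Longrightarrow> f S = 0"
    "v = sum f F" for v f F
  proof -
    have sub: "{S. f S \<noteq> 0} \<subseteq> F" using that(4) by blast
    have "sum f F = (\<Sum>S | f S \<noteq> 0. f S)"
      using sub \<open>finite F\<close> by (intro sum.mono_neutral_right) auto
    then show ?thesis using that sub unfolding D_def by (auto intro: finite_subset)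
  qed
  have supp: "{S \<in> \<S>. dec v S \<noteq> 0} = {S. dec v S \<noteq> 0}" for v
    using dec[of v] unfolding D_def by blast
  have sum_dec: "sum (dec v) F = v" if "finite F" "{S. dec v S \<noteq> 0} \<subseteq> F" for v F
  proof -
    have "sum (dec v) F = (\<Sum>S | dec v S \<noteq> 0. dec v S)"
      using that by (intro sum.mono_neutral_right) auto
    then show ?thesis using dec[of v] by (simp add: D_def)
  qed
  have fin: "finite {S. dec v S \<noteq> 0}" for v using dec[of v] by (simp add: D_def)
  have dec_add: "dec (v + w) = (\<lambda>S. dec v S + dec w S)" for v w
  proof (rule uniq, rule DI[where F = "{S. dec v S \<noteq> 0} \<union> {S. dec w S \<noteq> 0}"])
    show "v + w = (\<Sum>S\<in>{S. dec v S \<noteq> 0} \<union> {S. dec w S \<noteq> 0}. dec v S + dec w S)"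
      by (simp add: sum.distrib sum_dec fin)
  qed (use dec[of v] dec[of w] add in \<open>auto simp: D_def\<close>)
  have dec_op: "dec (A v) = (\<lambda>S. A (dec v S))"
    if A: "\<And>x y. A (x + y) = A x + A y" "\<And>S x. S \<in> \<S> \<Longrightarrow> x \<in> S \<Longrightarrow> A x \<in> S" for A v
  proof (rule uniq, rule DI[where F = "{S. dec v S \<noteq> 0}"])
    interpret additive A by unfold_locales (fact A(1))
    show "A v = (\<Sum>S | dec v S \<noteq> 0. A (dec v S))"
      by (simp add: sum_dec[OF fin order_refl] flip: sum)
    show "A (dec v S) = 0" if "S \<notin> \<S>" for S using dec[of v] that by (simp add: D_def zero)
    show "A (dec v S) = 0" if "S \<notin> {S. dec v S \<noteq> 0}" for S using that by (simp add: zero)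
    show "A (dec v S) \<in> S" if "S \<in> \<S>" for S using dec[of v] that A(2) by (simp add: D_def)
  qed (fact fin)
  have "projections \<S> (\<lambda>S v. dec v S)"
    unfolding projections_def
  proof (intro conjI allI ballI impI)
    show "finite {S \<in> \<S>. dec v S \<noteq> 0}" for v using fin by (simp add: supp)
    show "v = (\<Sum>S\<in>{S \<in> \<S>. dec v S \<noteq> 0}. dec v S)" for v
      by (simp add: supp sum_dec[OF fin order_refl])
    fix S assume "S \<in> \<S>"
    then show "dec v S \<in> S" for v using dec[of v] by (simp add: D_def)
    show "dec (v + w) S = dec v S + dec w S" for v w by (simp add: dec_add)
    show "dec (A v) S = A (dec v S)" if "(\<forall>x y. A (x + y) = A x + A y) \<and> (\<forall>S\<in>\<S>. A ` S \<subseteq> S)" for A v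
    proof -
      have "dec (A v) = (\<lambda>S. A (dec v S))"
        by (rule dec_op[of A]) (use that in \<open>simp_all add: image_subset_iff\<close>)
      then show ?thesis by simp
    qed
  qed
  then show ?thesis by blast
qed

lemma complex_poly_root: "degree (p :: complex poly) > 0 \<Longrightarrow> \<exists>z. poly p z = 0"
  using fundamental_theorem_of_algebra[of p] by (simp add: constant_degree)

lemma (in vector_space) eigenvectors_vanish:
  fixes x :: "nat \<Rightarrow> 'b"
  assumes T: "Vector_Spaces.linear scale scale T"
    and ev: "\<And>i. T (x i) = scale (l i) (x i)" and l: "inj l" and B: "finite B" "\<And>i. x i \<in> span B"
  shows "\<exists>i. x i = 0"
proof (rule ccontr)
  assume nz: "\<nexists>i. x i = 0"
  have "independent (range x)" "inj x"
    using eigenvectors_independent[OF T ev _ l] eigenvectors_inj[of UNIV T x l] ev l nz by auto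
  moreover have "finite (range x)"
    using independent_span_bound[OF B(1), of "range x"] \<open>independent (range x)\<close> B(2) by auto
  ultimately show False by (simp add: finite_image_iff)
qed

section \<open>Simple Harish-Chandra modules: endomorphisms and highest weights\<close>

locale hc_module =
  fixes V :: "'v::ab_group_add takiff_struct"
  assumes simple: "simple_takiff_module V" and hc: "harish_chandra V"
begin

lemma module: "takiff_module V"
  using simple by (simp add: simple_takiff_module_def)

sublocale takiff_rep "scal V" "act V (mat_e, 0)" "act V (mat_f, 0)" "act V (mat_h, 0)"
    "act V (0, mat_e)" "act V (0, mat_f)" "act V (0, mat_h)"
  by (rule module_rep[OF module])

lemma act_linear: "X \<in> takiff \<Longrightarrow> Vector_Spaces.linear (scal V) (scal V) (act V X)"
  using module by (simp add: takiff_module_def)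

lemma act_zero:
  assumes "X \<in> takiff"
  shows "act V X 0 = 0"
proof -
  interpret Vector_Spaces.linear "scal V" "scal V" "act V X" by (rule act_linear[OF assms])
  show ?thesis by (rule zero)
qed

lemma submod_trivial: "submod takiff V S \<Longrightarrow> S = {0} \<or> S = UNIV"
  using simple unfolding simple_takiff_module_def simple_submod_def by blast

text \<open>V may have infinite dimension, so an eigenvector of \<open>T\<close> is sought in the
  isotypic component of a simple sl2-summand \<open>S0\<close>: this is finite-dimensional because
  multiplicities are finite, and endomorphisms send \<open>x0\<close> into it. The eigenspace of
  \<open>T\<close> is then a nonzero submodule.\<close>

lemma schur:
  assumes T: "hom_on takiff UNIV V V T"
  shows "\<exists>c. \<forall>x. T x = scal V c x"
proof -
  obtain \<S> where \<S>: "is_direct_sum \<S>" "\<And>S. S \<in> \<S> \<Longrightarrow> simple_submod takiff_g V S"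
    "\<And>S. S \<in> \<S> \<Longrightarrow> finite_dim V S" "\<And>S. S \<in> \<S> \<Longrightarrow> finite {S' \<in> \<S>. submod_iso takiff_g V S S'}"
    using hc unfolding harish_chandra_def by blast
  have sub: "subspace S" if "S \<in> \<S>" for S
    using \<S>(2)[OF that] by (simp add: simple_submod_def submod_def)
  have stab: "act V X x \<in> S" if "S \<in> \<S>" "X \<in> takiff_g" "x \<in> S" for S X x
    using \<S>(2)[OF that(1)] that by (simp add: simple_submod_def submod_def)
  obtain \<pi> where proj: "projections \<S> \<pi>"
    using direct_sum_projections[OF \<S>(1)] sub subspace_add by blast
  note \<pi> = projectionsD(3,1,2,4)[OF proj] and \<pi>_op = projectionsD(5)[OF proj]
  have \<pi>_scale: "\<pi> S (scal V c v) = scal V c (\<pi> S v)" if "S \<in> \<S>" for S c v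
    by (rule \<pi>_op[OF that, of "scal V c"]) (auto simp: scale_right_distrib subspace_scale sub)
  have \<pi>_act: "\<pi> S (act V X v) = act V X (\<pi> S v)" if "S \<in> \<S>" "X \<in> takiff_g" for S X v
  proof (rule \<pi>_op[OF that(1), of "act V X"])
    show "act V X (x + y) = act V X x + act V X y" for x y
      using act_linear[of X] that(2) takiff_g_subset by (auto simp: Vector_Spaces.linear_iff)
  qed (use stab that in auto)
  obtain v0 :: 'v where v0: "v0 \<noteq> 0"
    using simple unfolding simple_takiff_module_def simple_submod_def by auto
  obtain S0 where S0: "S0 \<in> \<S>" "\<pi> S0 v0 \<noteq> 0"
  proof -
    have "{S \<in> \<S>. \<pi> S v0 \<noteq> 0} \<noteq> {}"
      using \<pi>(3)[of v0] v0 by (metis sum.empty)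
    then show thesis using that by blast
  qed
  define x0 where "x0 = \<pi> S0 v0"
  have x0: "x0 \<in> S0" "x0 \<noteq> 0" using S0 \<pi>(1) by (auto simp: x0_def)
  have "\<forall>S\<in>\<S>. \<exists>B. finite B \<and> span B = S"
    using \<S>(3) unfolding finite_dim_def by blast
  then obtain B where B: "\<And>S. S \<in> \<S> \<Longrightarrow> finite (B S) \<and> span (B S) = S" by metis
  define P where "P = (\<Union>S\<in>{S \<in> \<S>. submod_iso takiff_g V S0 S}. B S)"
  have finP: "finite P" using \<S>(4)[OF S0(1)] B by (auto simp: P_def)
  have U: "U x0 \<in> span P" if U: "hom_on takiff UNIV V V U" for U
  proof -
    \<comment> \<open>A nonzero component of \<open>U\<close> in \<open>S\<close> restricts to a
      homomorphism between the simple modules \<open>S0\<close> and \<open>S\<close>, hence to an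
      isomorphism; so \<open>S\<close> is one of the summands collected in \<open>P\<close>.\<close>
    have "\<pi> S (U x0) \<in> span P" if S: "S \<in> \<S>" "\<pi> S (U x0) \<noteq> 0" for S
    proof -
      let ?\<phi> = "\<lambda>x. \<pi> S (U x)"
      have add: "?\<phi> (v + w) = ?\<phi> v + ?\<phi> w" for v w
        using hom_onD(1)[OF U] by (simp add: \<pi>(4)[OF S(1)])
      have sc: "?\<phi> (scal V c v) = scal V c (?\<phi> v)" for c v
        using hom_onD(2)[OF U] by (simp add: \<pi>_scale[OF S(1)])
      have ac: "?\<phi> (act V X v) = act V X (?\<phi> v)" if "X \<in> takiff_g" for X v
        using hom_onD(3)[OF U UNIV_I subsetD[OF takiff_g_subset that], of v] that by (simp add: \<pi>_act[OF S(1)])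
      interpret \<phi>: Vector_Spaces.linear "scal V" "scal V" ?\<phi>
        by unfold_locales (fact add sc)+
      have "submod takiff_g V {x \<in> S0. ?\<phi> x = 0}"
        unfolding submod_def
      proof (intro conjI ballI)
        show "subspace {x \<in> S0. ?\<phi> x = 0}"
          using sub[OF S0(1)] by (simp add: subspace_def \<phi>.zero \<phi>.add \<phi>.scale)
        fix X x assume "X \<in> takiff_g" "x \<in> {x \<in> S0. ?\<phi> x = 0}"
        then show "act V X x \<in> {x \<in> S0. ?\<phi> x = 0}"
          using stab[OF S0(1)] act_zero[of X] takiff_g_subset by (auto simp: ac)
      qed
      moreover have "simple_submod takiff_g V S0" by (rule \<S>(2)[OF S0(1)])
      ultimately have "{x \<in> S0. ?\<phi> x = 0} = {0} \<or> {x \<in> S0. ?\<phi> x = 0} = S0"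
        unfolding simple_submod_def by blast
      then have ker: "{x \<in> S0. ?\<phi> x = 0} = {0}" using x0 S(2) by blast
      have inj: "inj_on ?\<phi> S0"
      proof (rule inj_onI)
        fix x y assume xy: "x \<in> S0" "y \<in> S0" "?\<phi> x = ?\<phi> y"
        then have "x - y \<in> {x \<in> S0. ?\<phi> x = 0}"
          using \<phi>.diff subspace_diff[OF sub[OF S0(1)]] by simp
        then show "x = y" unfolding ker by simp
      qed
      have "submod takiff_g V (?\<phi> ` S0)"
        unfolding submod_def
      proof (intro conjI ballI)
        show "subspace (?\<phi> ` S0)" by (rule \<phi>.subspace_image[OF sub[OF S0(1)]])
        fix X y assume X: "X \<in> takiff_g" and "y \<in> ?\<phi> ` S0"
        then obtain x where x: "x \<in> S0" "y = ?\<phi> x" by blast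
        then have "act V X y = ?\<phi> (act V X x)" using ac[OF X] by simp
        then show "act V X y \<in> ?\<phi> ` S0" using stab[OF S0(1) X x(1)] by blast
      qed
      moreover have "?\<phi> ` S0 \<subseteq> S" using \<pi>(1)[OF S(1)] by blast
      moreover have "?\<phi> ` S0 \<noteq> {0}" using x0(1) S(2) by blast
      ultimately have "?\<phi> ` S0 = S" using \<S>(2)[OF S(1)] unfolding simple_submod_def by blast
      then have "submod_iso takiff_g V S0 S"
        unfolding submod_iso_def using inj add sc ac
        by (intro exI[of _ ?\<phi>]) (simp add: hom_on_def bij_betw_def)
      then have "span (B S) \<subseteq> span P" using S(1) by (intro span_mono) (auto simp: P_def)
      then show ?thesis using B[OF S(1)] \<pi>(1)[OF S(1)] by blast
    qed
    then show ?thesis by (subst \<pi>(3)[symmetric]) (auto intro!: span_sum)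
  qed
  have "hom_on takiff UNIV V V (T ^^ i)" for i
    by (induction i) (use T in \<open>simp_all add: hom_on_def\<close>)
  note TP = U[OF this]
  have lin: "Vector_Spaces.linear (scal V) (scal V) T"
    using T by (simp add: hom_on_def Vector_Spaces.linear_iff vector_space_axioms)
  interpret T: Vector_Spaces.linear "scal V" "scal V" T by (fact lin)
  obtain y l where y: "y \<noteq> 0" "T y = scal V l y"
    using eigenvector_exists[OF complex_poly_root lin x0(2) finP TP subspace_UNIV] by auto
  have "submod takiff V {z. T z = scal V l z}"
    unfolding submod_def
  proof (intro conjI ballI)
    show "subspace {z. T z = scal V l z}"
      by (auto simp: subspace_def T.zero T.add T.scale scale_right_distrib mult.commute)
    fix X z assume X: "X \<in> takiff" and z: "z \<in> {z. T z = scal V l z}"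
    show "act V X z \<in> {z. T z = scal V l z}"
      using hom_onD(3)[OF T UNIV_I X, of z] act_linear[OF X] z by (simp add: Vector_Spaces.linear_iff)
  qed
  then have "{z. T z = scal V l z} = UNIV" using submod_trivial y by blast
  then show ?thesis by blast
qed

text \<open>This moves questions about strings into a finite-dimensional summand. The component
  \<open>x\<close> of \<open>v\<close> inherits the highest weight property because projections
  commute with \<open>e\<close> and \<open>h\<close>.\<close>

lemma g_summand:
  assumes "v \<noteq> 0"
  obtains S x where "x \<in> S" "x \<noteq> 0" "subspace S" "\<And>X y. X \<in> takiff_g \<Longrightarrow> y \<in> S \<Longrightarrow> act V X y \<in> S"
    "finite_dim V S" "hw m v \<Longrightarrow> hw m x"
proof -
  obtain \<S> where \<S>: "is_direct_sum \<S>" "\<And>S. S \<in> \<S> \<Longrightarrow> simple_submod takiff_g V S"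
    "\<And>S. S \<in> \<S> \<Longrightarrow> finite_dim V S"
    using hc unfolding harish_chandra_def by blast
  have sub: "subspace S" if "S \<in> \<S>" for S
    using \<S>(2)[OF that] by (simp add: simple_submod_def submod_def)
  have stab: "act V X x \<in> S" if "S \<in> \<S>" "X \<in> takiff_g" "x \<in> S" for S X x
    using \<S>(2)[OF that(1)] that by (simp add: simple_submod_def submod_def)
  obtain \<pi> where proj: "projections \<S> \<pi>"
    using direct_sum_projections[OF \<S>(1)] sub subspace_add by blast
  note \<pi>_op = projectionsD(5)[OF proj]
  have \<pi>_scale: "\<pi> S (scal V c v) = scal V c (\<pi> S v)" if "S \<in> \<S>" for S c v
    by (rule \<pi>_op[OF that, of "scal V c"]) (auto simp: scale_right_distrib subspace_scale sub)
  have \<pi>_act: "\<pi> S (act V X v) = act V X (\<pi> S v)" if "S \<in> \<S>" "X \<in> takiff_g" for S X v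
  proof (rule \<pi>_op[OF that(1), of "act V X"])
    show "act V X (x + y) = act V X x + act V X y" for x y
      using act_linear[of X] that(2) takiff_g_subset by (auto simp: Vector_Spaces.linear_iff)
  qed (use stab that in auto)
  have "{S \<in> \<S>. \<pi> S v \<noteq> 0} \<noteq> {}"
    using projectionsD(2)[OF proj, of v] \<open>v \<noteq> 0\<close> by (metis sum.empty)
  then obtain S where S: "S \<in> \<S>" "\<pi> S v \<noteq> 0" by blast
  have "\<pi> S 0 = 0" using \<pi>_scale[OF S(1), of 0 0] by simp
  moreover note \<pi>_act[OF S(1) tensor_in_takiff_g[OF mat_in_sl2(1)], of v]
    \<pi>_act[OF S(1) tensor_in_takiff_g[OF mat_in_sl2(3)], of v]
  ultimately have "hw m (\<pi> S v)" if "hw m v"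
    using that by (simp add: hw_def \<pi>_scale[OF S(1)])
  then show thesis
    using that[of "\<pi> S v" S] projectionsD(3)[OF proj S(1)] S(2) sub[OF S(1)] stab[OF S(1)] \<S>(3)[OF S(1)]
    by blast
qed

text \<open>Inside a finite-dimensional summand the string of \<open>f\<close> ends, since its
  weights are distinct. At its last nonzero vector \<open>e_funpow_f_hw\<close> gives (j + 1) (m -
  j) = 0.\<close>

lemma hw_weight_nat:
  assumes "hw m v" "v \<noteq> 0"
  shows "m \<in> \<nat>"
proof -
  obtain S x where x: "x \<in> S" "x \<noteq> 0" "subspace S" "\<And>X y. X \<in> takiff_g \<Longrightarrow> y \<in> S \<Longrightarrow> act V X y \<in> S"
    "finite_dim V S" "hw m v \<Longrightarrow> hw m x"
    by (rule g_summand[OF assms(2), where m = m]) blast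
  obtain B where B: "finite B" "span B = S" using x(5) by (auto simp: finite_dim_def)
  let ?f = "act V (mat_f, 0)"
  have hx: "hw m x" using assms(1) x(6) by simp
  have "(?f ^^ i) x \<in> span B" for i
    unfolding B(2) by (induction i) (simp_all add: x(1,4) tensor_in_takiff_g)
  moreover have "inj (\<lambda>i. m - 2 * of_nat i)" by (rule injI) simp
  moreover have "act V (mat_h, 0) ((?f ^^ i) x) = scal V (m - 2 * of_nat i) ((?f ^^ i) x)" for i
    using hx by (intro h_funpow_f) (simp add: hw_def)
  ultimately have "\<exists>i. (?f ^^ i) x = 0"
    using eigenvectors_vanish[OF h.linear_axioms, of "\<lambda>i. (?f ^^ i) x" "\<lambda>i. m - 2 * of_nat i" B] B(1) by blast
  then obtain j where j: "(?f ^^ Suc j) x = 0" "(?f ^^ j) x \<noteq> 0"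
    using x(2) ex_least_nat_less[of "\<lambda>i. (?f ^^ i) x = 0"] by auto
  have "scal V (of_nat (Suc j) * (m - of_nat j)) ((?f ^^ j) x) = 0"
    using e_funpow_f_hw[OF hx, of j] by (simp only: j(1) e.zero)
  then have "m = of_nat j" using j(2) by (simp del: of_nat_Suc)
  then show ?thesis by simp
qed

text \<open>\<open>h\<close> has an eigenvector in a finite-dimensional summand; powers of
  \<open>e\<close> raise its weight and must end at a highest weight vector.\<close>

lemma hw_exists: "\<exists>m x. hw m x \<and> x \<noteq> 0"
proof -
  obtain v :: 'v where "v \<noteq> 0"
    using simple unfolding simple_takiff_module_def simple_submod_def by auto
  then obtain S x where x: "x \<in> S" "x \<noteq> 0" "subspace S" "\<And>X y. X \<in> takiff_g \<Longrightarrow> y \<in> S \<Longrightarrow> act V X y \<in> S"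
    "finite_dim V S"
    by (rule g_summand) blast
  obtain B where B: "finite B" "span B = S" using x(5) by (auto simp: finite_dim_def)
  let ?e = "act V (mat_e, 0)" and ?h = "act V (mat_h, 0)"
  have hS: "(?h ^^ i) x \<in> S" for i
    by (induction i) (simp_all add: x(1,4) tensor_in_takiff_g)
  obtain y l where y: "y \<in> S" "y \<noteq> 0" "?h y = scal V l y"
    using eigenvector_exists[OF complex_poly_root h.linear_axioms x(2) B(1) _ x(3) hS] hS B(2) by blast
  have "(?e ^^ i) y \<in> span B" for i
    unfolding B(2) by (induction i) (simp_all add: y(1) x(4) tensor_in_takiff_g)
  moreover have "inj (\<lambda>i. l + 2 * of_nat i)" by (rule injI) simp
  moreover have he: "?h ((?e ^^ i) y) = scal V (l + 2 * of_nat i) ((?e ^^ i) y)" for i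
  proof (induction i)
    case (Suc i)
    have "?h (?e z) = ?e (?h z) + scal V 2 (?e z)" for z by (simp add: he)
    then show ?case using Suc by (simp add: e.scale e.add algebra_simps)
  qed (simp add: y(3))
  ultimately have "\<exists>i. (?e ^^ i) y = 0"
    using eigenvectors_vanish[OF h.linear_axioms, of "\<lambda>i. (?e ^^ i) y" "\<lambda>i. l + 2 * of_nat i" B] B(1) by blast
  then obtain j where j: "(?e ^^ Suc j) y = 0" "(?e ^^ j) y \<noteq> 0"
    using y(2) ex_least_nat_less[of "\<lambda>i. (?e ^^ i) y = 0"] by auto
  then have "hw (l + 2 * of_nat j) ((?e ^^ j) y)" using he[of j] by (simp add: hw_def)
  then show ?thesis using j(2) by blast
qed

lemma basis_exists:
  assumes "\<not> finite_dim V UNIV"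
  obtains u n \<zeta> \<kappa> where "takiff_basis (scal V) (act V (mat_e, 0)) (act V (mat_f, 0)) (act V (mat_h, 0))
    (act V (0, mat_e)) (act V (0, mat_f)) (act V (0, mat_h)) u n \<zeta> \<kappa>"
proof -
  have "\<exists>c. \<forall>x. Cas x = scal V c x"
    by (rule schur[OF homI[OF module module Cas_linear]]) (auto simp: Cas_commute)
  then obtain \<zeta> where C: "\<And>x. Cas x = scal V \<zeta> x" by blast
  have "\<exists>c. \<forall>x. Mix x = scal V c x"
    by (rule schur[OF homI[OF module module Mix_linear]]) (auto simp: Mix_commute)
  then obtain \<kappa> where M: "\<And>x. Mix x = scal V \<kappa> x" by blast
  obtain m x where x: "hw m x" "x \<noteq> 0" using hw_exists by blast
  have simple: "S = {0} \<or> S = UNIV" if "stable S" for S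
  proof (rule submod_trivial, rule submodI[OF module])
    show "subspace S" using that by (simp add: stable_def)
    show "A \<in> {mat_e, mat_f, mat_h} \<Longrightarrow> y \<in> S \<Longrightarrow> act V (A, 0) y \<in> S \<and> act V (0, A) y \<in> S" for A y
      using that unfolding stable_def by blast
  qed
  have "span B \<noteq> UNIV" if "finite B" for B
    using assms that by (auto simp: finite_dim_def)
  with simple hw_weight_nat have "\<exists>u n. takiff_basis (scal V) (act V (mat_e, 0)) (act V (mat_f, 0)) (act V (mat_h, 0))
    (act V (0, mat_e)) (act V (0, mat_f)) (act V (0, mat_h)) u n \<zeta> \<kappa>"
    by (intro simple_imp_basis[OF _ C M x])
  then show thesis using that by blast
qed

end

section \<open>The Casimir operator on extensions\<close>

text \<open>The operator \<open>Cas\<close> for an arbitrary structure, so that it can be evaluated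
  on \<open>prod_struct\<close>, where Baer sums and multiples are formed, without first
  establishing module axioms there.\<close>

definition casimir :: "'a::ab_group_add takiff_struct \<Rightarrow> 'a \<Rightarrow> 'a" where
  "casimir M x = act M (0, mat_h) (act M (0, mat_h) x)
    + scal M 4 (act M (0, mat_e) (act M (0, mat_f) x))"

lemma casimir_Cas:
  "takiff_module M \<Longrightarrow> takiff_rep.Cas (scal M) (act M (0, mat_e)) (act M (0, mat_f)) (act M (0, mat_h)) = casimir M"
  by (rule ext) (simp add: takiff_rep.Cas_def[OF module_rep] casimir_def)

lemma casimir_hom:
  assumes M: "takiff_module M"
  shows "hom_on takiff UNIV M M (casimir M)"
proof -
  interpret takiff_rep "scal M" "act M (mat_e, 0)" "act M (mat_f, 0)" "act M (mat_h, 0)"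
    "act M (0, mat_e)" "act M (0, mat_f)" "act M (0, mat_h)"
    by (rule module_rep[OF M])
  have "hom_on takiff UNIV M M Cas"
    by (rule homI[OF M M Cas_linear]) (auto simp: Cas_commute)
  then show ?thesis by (simp add: casimir_Cas[OF M])
qed

text \<open>The subset \<open>P\<close> accommodates Baer sums, whose quotient map is a homomorphism
  on the pullback only.\<close>

lemma casimir_natural:
  assumes q: "hom_on takiff P M N q" and x: "x \<in> P"
    and P: "\<And>X y. X \<in> takiff \<Longrightarrow> y \<in> P \<Longrightarrow> act M X y \<in> P" "\<And>c y. y \<in> P \<Longrightarrow> scal M c y \<in> P"
  shows "q (casimir M x) = casimir N (q x)"
proof -
  note mem = tensor_in_takiff(2)[OF mat_in_sl2(1)] tensor_in_takiff(2)[OF mat_in_sl2(2)]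
    tensor_in_takiff(2)[OF mat_in_sl2(3)]
  show ?thesis
    by (simp add: casimir_def hom_onD[OF q] P mem x)
qed

definition cas_shift ::
  "'v::ab_group_add takiff_struct \<Rightarrow> complex \<Rightarrow> ('v, 'e::ab_group_add, 'v) extension \<Rightarrow> complex \<Rightarrow> bool" where
  "cas_shift V \<zeta> E c \<longleftrightarrow>
    (\<forall>y. casimir (mid E) y = scal (mid E) \<zeta> y + incl E (scal V c (proj E y)))"

lemma extensionD:
  assumes "is_extension W V E"
  shows "takiff_module (mid E)" "hom_on takiff UNIV W (mid E) (incl E)" "hom_on takiff UNIV (mid E) V (proj E)"
    "inj (incl E)" "surj (proj E)" "proj E y = 0 \<longleftrightarrow> y \<in> range (incl E)" "proj E (incl E w) = 0"
  using assms unfolding is_extension_def by auto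

lemma hom_linear:
  assumes "takiff_module M" "takiff_module N" "hom_on takiff UNIV M N q"
  shows "Vector_Spaces.linear (scal M) (scal N) q"
  using assms by (simp add: takiff_module_def Vector_Spaces.linear_iff hom_on_def)

lemma cas_shift_unique:
  fixes V :: "'v::ab_group_add takiff_struct" and E :: "('v, 'e::ab_group_add, 'v) extension"
  assumes V: "takiff_module V" and E: "is_extension V V E" and v: "v \<noteq> (0::'v::ab_group_add)"
    and c: "cas_shift V \<zeta> E c" "cas_shift V \<zeta> E c'"
  shows "c = c'"
proof -
  interpret V: vector_space "scal V" using V by (simp add: takiff_module_def)
  obtain y where y: "proj E y = v" using extensionD(5)[OF E] by (metis surjD)
  have "incl E (scal V c (proj E y)) = incl E (scal V c' (proj E y))"
    using c unfolding cas_shift_def by (metis add_left_cancel)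
  then show ?thesis using extensionD(4)[OF E] v by (simp add: inj_eq y)
qed

lemma cas_shift_equivalent:
  assumes V: "takiff_module V" and E: "is_extension V V E"
    and eq: "ext_equivalent E E'" and c: "cas_shift V \<zeta> E c"
  shows "cas_shift V \<zeta> E' c"
proof -
  obtain f where f: "hom_on takiff UNIV (mid E) (mid E') f" "bij f" "f \<circ> incl E = incl E'" "proj E' \<circ> f = proj E"
    using eq by (auto simp: ext_equivalent_def)
  have "casimir (mid E') y = scal (mid E') \<zeta> y + incl E' (scal V c (proj E' y))" for y
  proof -
    obtain x where x: "y = f x" using \<open>bij f\<close> by (metis bij_pointE)
    have "casimir (mid E') y = f (casimir (mid E) x)"
      by (simp only: x casimir_natural[OF f(1) UNIV_I UNIV_I UNIV_I])
    also have "\<dots> = scal (mid E') \<zeta> (f x) + f (incl E (scal V c (proj E x)))"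
      using c by (simp only: cas_shift_def hom_onD[OF f(1) UNIV_I] UNIV_I)
    also have "\<dots> = scal (mid E') \<zeta> y + incl E' (scal V c (proj E' y))"
      by (simp only: x o_apply flip: f(3,4))
    finally show ?thesis .
  qed
  then show ?thesis unfolding cas_shift_def by blast
qed

text \<open>The difference of the Casimir operator and \<zeta> maps E into the image of V and kills
  that image, so it induces an endomorphism of V, which is a scalar by \<open>schur\<close>.\<close>

lemma cas_shift_exists:
  assumes V: "hc_module V" and E: "is_extension V V E" and z: "\<And>v. casimir V v = scal V \<zeta> v"
  shows "\<exists>c. cas_shift V \<zeta> E c"
proof -
  interpret hc_module V by (fact V)
  interpret M: vector_space "scal (mid E)"
    using extensionD(1)[OF E] by (simp add: takiff_module_def)
  note i = hom_onD[OF extensionD(2)[OF E] UNIV_I] and p = hom_onD[OF extensionD(3)[OF E] UNIV_I]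
  note i0 = hom_on_cancel[OF extensionD(2)[OF E]] and p0 = hom_on_cancel[OF extensionD(3)[OF E]]
  note cas = hom_onD[OF casimir_hom[OF extensionD(1)[OF E]] UNIV_I]
    and cas0 = hom_on_cancel[OF casimir_hom[OF extensionD(1)[OF E]]]
  have inj: "incl E x = incl E y \<longleftrightarrow> x = y" for x y
    using extensionD(4)[OF E] by (simp add: inj_eq)
  have act_lin: "act (mid E) X (a - b) = act (mid E) X a - act (mid E) X b"
    "act (mid E) X (scal (mid E) c a) = scal (mid E) c (act (mid E) X a)" if "X \<in> takiff" for X a b c
  proof -
    interpret L: Vector_Spaces.linear "scal (mid E)" "scal (mid E)" "act (mid E) X"
      using extensionD(1)[OF E] that by (simp add: takiff_module_def)
    show "act (mid E) X (a - b) = act (mid E) X a - act (mid E) X b"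
      "act (mid E) X (scal (mid E) c a) = scal (mid E) c (act (mid E) X a)" by (rule L.diff L.scale)+
  qed
  have "proj E (casimir (mid E) y - scal (mid E) \<zeta> y) = 0" for y
    by (simp only: p0 casimir_natural[OF extensionD(3)[OF E] UNIV_I UNIV_I UNIV_I] z p) simp
  then have "\<forall>y. \<exists>x. incl E x = casimir (mid E) y - scal (mid E) \<zeta> y"
    using extensionD(6)[OF E] by (metis imageE)
  then obtain N where N: "\<And>y. incl E (N y) = casimir (mid E) y - scal (mid E) \<zeta> y" by metis
  have N_add: "N (a + b) = N a + N b" for a b
    by (subst inj[symmetric]) (simp add: N i cas M.scale_right_distrib)
  have N_scale: "N (scal (mid E) c a) = scal V c (N a)" for c a
    by (subst inj[symmetric]) (simp add: N i cas M.scale_right_diff_distrib mult.commute)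
  have N_act: "N (act (mid E) X a) = act V X (N a)" if "X \<in> takiff" for X a
    by (subst inj[symmetric]) (simp add: N i(3)[OF that] cas(3)[OF that] act_lin[OF that])
  have N_i: "N (incl E x) = 0" for x
    by (subst inj[symmetric])
      (simp add: N i0 z i flip: casimir_natural[OF extensionD(2)[OF E] UNIV_I UNIV_I UNIV_I])
  have N_p: "N a = N b" if "proj E a = proj E b" for a b
  proof -
    have "proj E (a - b) = 0" using that by (simp add: p0)
    then obtain x where "a - b = incl E x" using extensionD(6)[OF E] by blast
    then have "a = b + incl E x" by (simp add: algebra_simps)
    then show ?thesis by (simp add: N_add N_i)
  qed
  define T where "T v = N (inv (proj E) v)" for v
  have pinv: "proj E (inv (proj E) v) = v" for v
    using extensionD(5)[OF E] by (simp add: surj_f_inv_f)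
  have T: "N y = T (proj E y)" for y
    unfolding T_def by (rule N_p) (simp add: pinv)
  have "hom_on takiff UNIV V V T"
    unfolding hom_on_def
  proof (intro conjI ballI allI)
    fix v w
    have "N (inv (proj E) v + inv (proj E) w) = T (v + w)" by (simp add: T p pinv)
    then show "T (v + w) = T v + T w"
      by (simp only: N_add T_def[of v, symmetric] T_def[of w, symmetric])
  next
    fix c v
    have "N (scal (mid E) c (inv (proj E) v)) = T (scal V c v)" by (simp add: T p pinv)
    then show "T (scal V c v) = scal V c (T v)"
      by (simp only: N_scale T_def[of v, symmetric])
  next
    fix X v assume X: "X \<in> takiff"
    have "N (act (mid E) X (inv (proj E) v)) = T (act V X v)" by (simp add: T p(3)[OF X] pinv)
    then show "T (act V X v) = act V X (T v)"
      by (simp only: N_act[OF X] T_def[of v, symmetric])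
  qed
  then obtain c where c: "\<And>v. T v = scal V c v" using schur by blast
  have "casimir (mid E) y = scal (mid E) \<zeta> y + incl E (scal V c (proj E y))" for y
    using N[of y] by (simp add: T c)
  then show ?thesis by (auto simp: cas_shift_def)
qed

lemma prod_struct_sel [simp]:
  "scal (prod_struct M N) c z = (scal M c (fst z), scal N c (snd z))"
  "act (prod_struct M N) X z = (act M X (fst z), act N X (snd z))"
  by (simp_all add: prod_struct_def)

lemma casimir_prod: "casimir (prod_struct M N) z = (casimir M (fst z), casimir N (snd z))"
  by (simp add: casimir_def)

text \<open>The operator acts componentwise on the pullback, and the quotient identifies
  \<open>(0, incl E2 x)\<close> with \<open>(incl E1 x, 0)\<close>; therefore the two deviations add
  up in the image of \<open>incl E3\<close>.\<close>

lemma cas_shift_baer: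
  fixes E1 :: "('v::ab_group_add, 'e::ab_group_add, 'v) extension"
    and E2 :: "('v, 'f::ab_group_add, 'v) extension" and E3 :: "('v, 'g::ab_group_add, 'v) extension"
  assumes V: "takiff_module V" and E: "is_extension V V E1" "is_extension V V E2"
    and c: "cas_shift V \<zeta> E1 c1" "cas_shift V \<zeta> E2 c2" and b: "is_baer_sum E1 E2 E3"
  shows "cas_shift V \<zeta> E3 (c1 + c2)"
proof -
  interpret V: vector_space "scal V" using V by (simp add: takiff_module_def)
  let ?P = "{(a, b). proj E1 a = proj E2 b}"
  let ?M = "prod_struct (mid E1) (mid E2)"
  obtain q where q: "hom_on takiff ?P ?M (mid E3) q" "q ` ?P = UNIV"
    "{z \<in> ?P. q z = 0} = range (\<lambda>w. (incl E1 w, - incl E2 w))"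
    "\<And>w. incl E3 w = q (incl E1 w, 0)" "\<forall>(a, b)\<in>?P. proj E3 (q (a, b)) = proj E1 a"
    using b unfolding is_baer_sum_def Let_def by blast
  note i1 = hom_onD[OF extensionD(2)[OF E(1)] UNIV_I] and i2 = hom_onD[OF extensionD(2)[OF E(2)] UNIV_I]
    and p1 = hom_onD[OF extensionD(3)[OF E(1)] UNIV_I] and p2 = hom_onD[OF extensionD(3)[OF E(2)] UNIV_I]
  note p10 = hom_on_cancel[OF extensionD(3)[OF E(1)]] and p20 = hom_on_cancel[OF extensionD(3)[OF E(2)]]
  have mem: "(incl E1 x, 0) \<in> ?P" "(0, incl E2 x) \<in> ?P" "(incl E1 x, - incl E2 x) \<in> ?P" for x
    by (simp_all add: extensionD(7)[OF E(1)] extensionD(7)[OF E(2)] p10 p20)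
  have q_add: "q (x + y) = q x + q y" if "x \<in> ?P" "y \<in> ?P" for x y
    using hom_onD(1)[OF q(1) that] .
  have P_add: "x + y \<in> ?P" if "x \<in> ?P" "y \<in> ?P" for x y
    using that by (auto simp: p1 p2)
  have q2: "q (0, incl E2 x) = incl E3 x" for x
  proof -
    have "(incl E1 x, - incl E2 x) \<in> {z \<in> ?P. q z = 0}" unfolding q(3) by blast
    then have "q (incl E1 x, - incl E2 x) = 0" by blast
    moreover have "(incl E1 x, 0) = (incl E1 x, - incl E2 x) + (0, incl E2 x)" by simp
    then have "q (incl E1 x, 0) = q (incl E1 x, - incl E2 x) + q (0, incl E2 x)"
      using q_add[OF mem(3,2)] by metis
    ultimately show ?thesis by (simp add: q(4))
  qed
  have "casimir (mid E3) y = scal (mid E3) \<zeta> y + incl E3 (scal V (c1 + c2) (proj E3 y))" for y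
  proof -
    obtain a b where ab: "(a, b) \<in> ?P" "y = q (a, b)" using q(2) by (metis (no_types, lifting) UNIV_I imageE mem_Collect_eq case_prodE)
    define v where "v = proj E1 a"
    have v: "proj E1 a = v" "proj E2 b = v" "proj E3 y = v"
      using ab q(5) by (auto simp: v_def)
    have zab: "(scal (mid E1) \<zeta> a, scal (mid E2) \<zeta> b) \<in> ?P" using v by (simp add: p1 p2)
    have "casimir (mid E3) y = q (casimir ?M (a, b))"
      unfolding ab(2)
      by (rule casimir_natural[OF q(1) ab(1), symmetric]) (auto simp: p1 p2)
    also have "casimir ?M (a, b) = (scal (mid E1) \<zeta> a, scal (mid E2) \<zeta> b)
        + ((incl E1 (scal V c1 v), 0) + (0, incl E2 (scal V c2 v)))"
      using c by (simp add: casimir_prod cas_shift_def v)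
    also have "q \<dots> = q (scal (mid E1) \<zeta> a, scal (mid E2) \<zeta> b) + (q (incl E1 (scal V c1 v), 0) + q (0, incl E2 (scal V c2 v)))"
      by (simp only: q_add[OF zab P_add[OF mem(1,2)]] q_add[OF mem(1,2)])
    also have "q (scal (mid E1) \<zeta> a, scal (mid E2) \<zeta> b) = scal (mid E3) \<zeta> y"
      using hom_onD(2)[OF q(1) ab(1), of \<zeta>] by (simp add: ab(2))
    also have "q (incl E1 (scal V c1 v), 0) + q (0, incl E2 (scal V c2 v)) = incl E3 (scal V (c1 + c2) v)"
    proof -
      have "incl E3 (x + x') = incl E3 x + incl E3 x'" for x x'
      proof -
        have "(incl E1 (x + x'), 0 :: 'f) = (incl E1 x, 0) + (incl E1 x', 0)" by (simp add: i1)
        then show ?thesis unfolding q(4) using q_add[OF mem(1) mem(1)] by metis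
      qed
      then show ?thesis by (simp add: q2 V.scale_left_distrib flip: q(4))
    qed
    finally show ?thesis by (simp only: v)
  qed
  then show ?thesis unfolding cas_shift_def by blast
qed

text \<open>In the pushout \<open>(0, incl E x)\<close> becomes \<open>(scal V a x, 0)\<close>,
  which multiplies the deviation by \<open>a\<close>.\<close>

lemma cas_shift_multiple:
  assumes V: "takiff_module V" and E: "is_extension V V E" and c: "cas_shift V \<zeta> E c"
    and z: "\<And>v. casimir V v = scal V \<zeta> v" and b: "is_ext_multiple V a E E'"
  shows "cas_shift V \<zeta> E' (a * c)"
proof -
  interpret V: vector_space "scal V" using V by (simp add: takiff_module_def)
  let ?M = "prod_struct V (mid E)"
  obtain q where q: "hom_on takiff UNIV ?M (mid E') q" "surj q"
    "{z. q z = 0} = range (\<lambda>w. (scal V a w, - incl E w))"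
    "\<And>w. incl E' w = q (w, 0)" "\<And>w e. proj E' (q (w, e)) = proj E e"
    using b unfolding is_ext_multiple_def by blast
  note q0 = hom_onD[OF q(1) UNIV_I]
  have q2: "q (0, incl E x) = incl E' (scal V a x)" for x
  proof -
    have "(scal V a x, - incl E x) \<in> {z. q z = 0}" unfolding q(3) by blast
    moreover have "q (scal V a x, 0) = q (scal V a x, - incl E x) + q (0, incl E x)"
      using q0(1)[of "(0, incl E x)" "(scal V a x, - incl E x)"] by simp
    ultimately show ?thesis by (simp add: q(4))
  qed
  have "casimir (mid E') y = scal (mid E') \<zeta> y + incl E' (scal V (a * c) (proj E' y))" for y
  proof -
    obtain w e where we: "y = q (w, e)" using q(2) by (metis surjD surj_pair)
    have "casimir (mid E') y = q (casimir ?M (w, e))"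
      unfolding we by (rule casimir_natural[OF q(1) UNIV_I UNIV_I UNIV_I, symmetric])
    also have "casimir ?M (w, e) = scal ?M \<zeta> (w, e) + (0, incl E (scal V c (proj E e)))"
      using c by (simp add: casimir_prod cas_shift_def z)
    also have "q \<dots> = scal (mid E') \<zeta> y + incl E' (scal V (a * c) (proj E' y))"
      by (simp only: q0 UNIV_I we q2 q(5) V.scale_scale)
    finally show ?thesis .
  qed
  then show ?thesis unfolding cas_shift_def by blast
qed

section \<open>Extensions as cocycles\<close>

text \<open>Off-diagonal blocks of an action on V \<oplus> V. The last clause is the 1-cocycle
  condition for values in the linear endomorphisms of V.\<close>

definition cocycle :: "'v::ab_group_add takiff_struct \<Rightarrow> (takiff_elt \<Rightarrow> 'v \<Rightarrow> 'v) \<Rightarrow> bool" where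
  "cocycle V D \<longleftrightarrow>
     (\<forall>X\<in>takiff. \<forall>v w. D X (v + w) = D X v + D X w) \<and>
     (\<forall>X\<in>takiff. \<forall>c v. D X (scal V c v) = scal V c (D X v)) \<and>
     (\<forall>X\<in>takiff. \<forall>Y\<in>takiff. \<forall>v. D (X + Y) v = D X v + D Y v) \<and>
     (\<forall>X\<in>takiff. \<forall>c v. D (takiff_smult c X) v = scal V c (D X v)) \<and>
     (\<forall>X\<in>takiff. \<forall>Y\<in>takiff. \<forall>v.
        D (takiff_bracket X Y) v = act V X (D Y v) + D X (act V Y v) - (act V Y (D X v) + D Y (act V X v)))"

definition cext :: "'v::ab_group_add takiff_struct \<Rightarrow> (takiff_elt \<Rightarrow> 'v \<Rightarrow> 'v) \<Rightarrow> ('v, 'v \<times> 'v, 'v) extension" where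
  "cext V D =
    \<lparr>mid = \<lparr>scal = \<lambda>c z. (scal V c (fst z), scal V c (snd z)),
            act = \<lambda>X z. (act V X (fst z) + D X (snd z), act V X (snd z))\<rparr>,
     incl = \<lambda>w. (w, 0), proj = snd\<rparr>"

lemma cext_sel [simp]:
  "scal (mid (cext V D)) c z = (scal V c (fst z), scal V c (snd z))"
  "act (mid (cext V D)) X z = (act V X (fst z) + D X (snd z), act V X (snd z))"
  "incl (cext V D) w = (w, 0)" "proj (cext V D) z = snd z"
  by (simp_all add: cext_def)

lemma module_simps:
  assumes "takiff_module V"
  shows "X \<in> takiff \<Longrightarrow> act V X (v + w) = act V X v + act V X w"
    "X \<in> takiff \<Longrightarrow> act V X (v - w) = act V X v - act V X w"
    "X \<in> takiff \<Longrightarrow> act V X 0 = 0"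
    "X \<in> takiff \<Longrightarrow> act V X (scal V c v) = scal V c (act V X v)"
    "X \<in> takiff \<Longrightarrow> Y \<in> takiff \<Longrightarrow> act V (X + Y) v = act V X v + act V Y v"
    "X \<in> takiff \<Longrightarrow> act V (takiff_smult c X) v = scal V c (act V X v)"
    "X \<in> takiff \<Longrightarrow> Y \<in> takiff \<Longrightarrow> act V (takiff_bracket X Y) v = act V X (act V Y v) - act V Y (act V X v)"
proof -
  have lin: "Vector_Spaces.linear (scal V) (scal V) (act V X)" if "X \<in> takiff" for X
    using assms that by (simp add: takiff_module_def)
  show "act V X (v + w) = act V X v + act V X w" "act V X (v - w) = act V X v - act V X w"
    "act V X 0 = 0" "act V X (scal V c v) = scal V c (act V X v)" if "X \<in> takiff"
  proof -
    interpret L: Vector_Spaces.linear "scal V" "scal V" "act V X" by (rule lin[OF that])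
    show "act V X (v + w) = act V X v + act V X w" "act V X (v - w) = act V X v - act V X w"
      "act V X 0 = 0" "act V X (scal V c v) = scal V c (act V X v)"
      by (rule L.add L.diff L.zero L.scale)+
  qed
qed (use assms in \<open>simp_all add: takiff_module_def\<close>)

lemma cocycle_simps:
  assumes "cocycle V D"
  shows "X \<in> takiff \<Longrightarrow> D X (v + w) = D X v + D X w"
    "X \<in> takiff \<Longrightarrow> D X (scal V c v) = scal V c (D X v)"
    "X \<in> takiff \<Longrightarrow> Y \<in> takiff \<Longrightarrow> D (X + Y) v = D X v + D Y v"
    "X \<in> takiff \<Longrightarrow> D (takiff_smult c X) v = scal V c (D X v)"
    "X \<in> takiff \<Longrightarrow> Y \<in> takiff \<Longrightarrow> D (takiff_bracket X Y) v =
       act V X (D Y v) + D X (act V Y v) - (act V Y (D X v) + D Y (act V X v))"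
    "X \<in> takiff \<Longrightarrow> D X 0 = 0"
proof -
  show "D X 0 = 0" if "X \<in> takiff"
    using assms that unfolding cocycle_def by (metis add_cancel_right_right)
qed (use assms in \<open>simp_all add: cocycle_def\<close>)

lemma cext_extension:
  assumes V: "takiff_module V" and D: "cocycle V D"
  shows "is_extension V V (cext V D)"
proof -
  interpret V: vector_space "scal V" using V by (simp add: takiff_module_def)
  note vs = module_simps[OF V] cocycle_simps[OF D]
  have vsM: "vector_space (scal (mid (cext V D)))"
    by unfold_locales (simp_all add: V.scale_right_distrib V.scale_left_distrib plus_prod_def)
  have "takiff_module (mid (cext V D))"
    unfolding takiff_module_def Vector_Spaces.linear_iff
    using vsM
    by (auto simp: vs V.scale_right_distrib takiff_closed algebra_simps)
  then show ?thesis
    unfolding is_extension_def using V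
    by (auto simp: hom_on_def vs inj_on_def image_iff)
qed

text \<open>Choose a linear section \<open>s\<close> of the projection; \<open>D\<close> measures
  how far it is from commuting with the action.\<close>

lemma extension_cocycle:
  assumes V: "takiff_module V" and E: "is_extension V V E"
  shows "\<exists>D. cocycle V D \<and> ext_equivalent (cext V D) E"
proof -
  let ?M = "mid E" and ?i = "incl E" and ?p = "proj E"
  have M: "takiff_module ?M" by (rule extensionD(1)[OF E])
  interpret vector_space_pair "scal ?M" "scal V"
    using M V by (simp add: vector_space_pair_def takiff_module_def)
  note i = hom_onD[OF extensionD(2)[OF E] UNIV_I] and p = hom_onD[OF extensionD(3)[OF E] UNIV_I]
  note i0 = hom_on_cancel[OF extensionD(2)[OF E]] and p0 = hom_on_cancel[OF extensionD(3)[OF E]]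
  have inj: "?i x = ?i y \<longleftrightarrow> x = y" for x y
    using extensionD(4)[OF E] by (simp add: inj_eq)
  obtain s where s: "Vector_Spaces.linear (scal V) (scal ?M) s" and ps: "\<And>v. ?p (s v) = v"
    using linear_surjective_right_inverse[OF hom_linear[OF M V extensionD(3)[OF E]] extensionD(5)[OF E]]
    by (auto simp: fun_eq_iff)
  have s_add: "s (a + b) = s a + s b" and s_scale: "s (scal V c a) = scal ?M c (s a)" for a b c
    using s by (simp_all add: Vector_Spaces.linear_iff)
  have s_diff: "s (a - b) = s a - s b" for a b
    using s_add[of "a - b" b] by (simp add: algebra_simps)
  note mM = module_simps[OF M] and mV = module_simps[OF V]
  have "\<exists>x. ?i x = act ?M X (s v) - s (act V X v)" if "X \<in> takiff" for X v
  proof -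
    have "?p (act ?M X (s v) - s (act V X v)) = 0" by (simp add: p0 p(3)[OF that] ps)
    then show ?thesis using extensionD(6)[OF E] by (metis imageE)
  qed
  then obtain D where D: "\<And>X v. X \<in> takiff \<Longrightarrow> ?i (D X v) = act ?M X (s v) - s (act V X v)" by metis
  have "cocycle V D"
    unfolding cocycle_def
  proof (intro conjI ballI allI; subst inj[symmetric])
    fix X assume X: "X \<in> takiff"
    show "?i (D X (v + w)) = ?i (D X v + D X w)" for v w
      by (simp add: D[OF X] i(1) mM(1)[OF X] mV(1)[OF X] s_add)
    show "?i (D X (scal V c v)) = ?i (scal V c (D X v))" for c v
      by (simp add: D[OF X] i(2) mM(4)[OF X] mV(4)[OF X] s_scale vs1.scale_right_diff_distrib)
    show "?i (D (takiff_smult c X) v) = ?i (scal V c (D X v))" for c v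
      by (simp add: D[OF X] D[OF takiff_closed(2)[OF X X]] i(2) mM(6)[OF X] mV(6)[OF X] s_scale vs1.scale_right_diff_distrib)
    fix Y assume Y: "Y \<in> takiff"
    show "?i (D (X + Y) v) = ?i (D X v + D Y v)" for v
      by (simp add: D[OF X] D[OF Y] D[OF takiff_closed(1)[OF X Y]] i(1) mM(5)[OF X Y] mV(5)[OF X Y] s_add)
    show "?i (D (takiff_bracket X Y) v) =
      ?i (act V X (D Y v) + D X (act V Y v) - (act V Y (D X v) + D Y (act V X v)))" for v
      by (simp add: D[OF X] D[OF Y] D[OF takiff_closed(3)[OF X Y]] i(1) i(3)[OF X] i(3)[OF Y] i0
          mM(7)[OF X Y] mV(7)[OF X Y] mM(2)[OF X] mM(2)[OF Y] s_diff)
  qed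
  moreover have "ext_equivalent (cext V D) E"
    unfolding ext_equivalent_def
  proof (intro exI[of _ "\<lambda>z. ?i (fst z) + s (snd z)"] conjI)
    let ?g = "\<lambda>z. ?i (fst z) + s (snd z)"
    show "hom_on takiff UNIV (mid (cext V D)) ?M ?g"
      unfolding hom_on_def
      by (intro conjI ballI allI)
        (simp_all add: i s_add s_scale vs1.scale_right_distrib D mM)
    show "bij ?g"
    proof (rule bijI)
      show "inj ?g"
      proof (rule injI)
        fix y z assume yz: "?g y = ?g z"
        then have "?p (?g y) = ?p (?g z)" by simp
        then have "snd y = snd z" by (simp add: p ps extensionD(7)[OF E])
        then show "y = z" using yz by (simp add: prod_eq_iff inj)
      qed
      show "surj ?g"
      proof (unfold surj_def, intro allI)
        fix e
        have "?p (e - s (?p e)) = 0" by (simp add: p0 ps)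
        then obtain x where "e - s (?p e) = ?i x" using extensionD(6)[OF E] by blast
        then have "?g (x, ?p e) = e" by (simp add: algebra_simps)
        then show "\<exists>z. e = ?g z" by metis
      qed
    qed
    have "s 0 = 0" using s_add[of 0 0] by simp
    then show "?g \<circ> incl (cext V D) = ?i" by (simp add: fun_eq_iff)
    show "?p \<circ> ?g = proj (cext V D)" by (simp add: fun_eq_iff p ps extensionD(7)[OF E])
  qed
  ultimately show ?thesis by blast
qed

section \<open>Sums and multiples of extensions in terms of cocycles\<close>

lemma cocycle_add:
  assumes V: "takiff_module V" and D: "cocycle V D" "cocycle V D'"
  shows "cocycle V (\<lambda>X v. D X v + D' X v)"
proof -
  interpret V: vector_space "scal V" using V by (simp add: takiff_module_def)
  show ?thesis
    unfolding cocycle_def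
    by (simp add: cocycle_simps[OF D(1)] cocycle_simps[OF D(2)] module_simps[OF V] V.scale_right_distrib algebra_simps)
qed

lemma cocycle_scale:
  assumes V: "takiff_module V" and D: "cocycle V D"
  shows "cocycle V (\<lambda>X v. scal V a (D X v))"
proof -
  interpret V: vector_space "scal V" using V by (simp add: takiff_module_def)
  show ?thesis
    unfolding cocycle_def
    by (simp add: cocycle_simps[OF D] module_simps[OF V] V.scale_right_distrib V.scale_right_diff_distrib mult.commute)
qed

text \<open>In the pullback the second coordinates agree, and dividing by the antidiagonal copy of V
  amounts to adding the first ones.\<close>

lemma cext_baer:
  fixes V :: "'v::ab_group_add takiff_struct"
  assumes V: "takiff_module V"
  shows "is_baer_sum (cext V D) (cext V D') (cext V (\<lambda>X v. D X v + D' X v))"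
proof -
  interpret V: vector_space "scal V" using V by (simp add: takiff_module_def)
  let ?q = "\<lambda>z :: ('v \<times> 'v) \<times> ('v \<times> 'v). (fst (fst z) + fst (snd z), snd (fst z))"
  let ?P = "{(a, b). proj (cext V D) a = proj (cext V D') b}"
  show ?thesis
    unfolding is_baer_sum_def Let_def
  proof (intro exI[of _ ?q] conjI)
    show "hom_on takiff ?P (prod_struct (mid (cext V D)) (mid (cext V D'))) (mid (cext V (\<lambda>X v. D X v + D' X v))) ?q"
      unfolding hom_on_def
      by (auto simp: V.scale_right_distrib module_simps[OF V])
    show "?q ` ?P = UNIV"
    proof -
      have "z \<in> ?q ` ?P" for z
        by (rule image_eqI[of _ _ "(z, (0, snd z))"]) simp_all
      then show ?thesis by blast
    qed
    show "{z \<in> ?P. ?q z = 0} = range (\<lambda>w. (incl (cext V D) w, - incl (cext V D') w))"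
      by (auto simp: image_iff zero_prod_def eq_neg_iff_add_eq_0 add.commute)
  qed auto
qed

lemma cext_multiple:
  fixes V :: "'v::ab_group_add takiff_struct"
  assumes V: "takiff_module V"
  shows "is_ext_multiple V a (cext V D) (cext V (\<lambda>X v. scal V a (D X v)))"
proof -
  interpret V: vector_space "scal V" using V by (simp add: takiff_module_def)
  let ?q = "\<lambda>z :: 'v \<times> ('v \<times> 'v). (fst z + scal V a (fst (snd z)), snd (snd z))"
  show ?thesis
    unfolding is_ext_multiple_def
  proof (intro exI[of _ ?q] conjI)
    show "hom_on takiff UNIV (prod_struct V (mid (cext V D))) (mid (cext V (\<lambda>X v. scal V a (D X v)))) ?q"
      unfolding hom_on_def
      by (simp add: V.scale_right_distrib module_simps[OF V] mult.commute add_ac)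
    show "surj ?q"
    proof -
      have "z \<in> range ?q" for z
        by (rule image_eqI[of _ _ "(fst z, (0, snd z))"]) simp_all
      then show ?thesis by blast
    qed
    show "{z. ?q z = 0} = range (\<lambda>w. (scal V a w, - incl (cext V D) w))"
    proof (intro set_eqI iffI)
      fix z assume "z \<in> {z. ?q z = 0}"
      then have "z = (scal V a (- fst (snd z)), - incl (cext V D) (- fst (snd z)))"
        by (simp add: prod_eq_iff eq_neg_iff_add_eq_0)
      then show "z \<in> range (\<lambda>w. (scal V a w, - incl (cext V D) w))" by blast
    qed (auto simp: zero_prod_def)
  qed auto
qed

text \<open>\<open>Ext1_add\<close> collects all Baer sums of representatives; for it to contain a
  whole class, being a sum must be invariant under equivalence. \<open>multiple_transport\<close>
  does the same for \<open>Ext1_scale\<close>.\<close>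

lemma baer_transport:
  assumes b: "is_baer_sum E1 E2 E" and eq: "ext_equivalent E E'"
  shows "is_baer_sum E1 E2 E'"
proof -
  let ?P = "{(a, b). proj E1 a = proj E2 b}"
  obtain f where f: "hom_on takiff UNIV (mid E) (mid E') f" "bij f" "f \<circ> incl E = incl E'" "proj E' \<circ> f = proj E"
    using eq by (auto simp: ext_equivalent_def)
  have f0: "f x = 0 \<longleftrightarrow> x = 0" for x
    using hom_on_cancel(1)[OF f(1)] bij_is_inj[OF f(2)] by (metis injD)
  have f3: "f (incl E w) = incl E' w" and f4: "proj E' (f x) = proj E x" for w x
    using f(3,4) by (simp_all add: fun_eq_iff del: split_paired_All)
  obtain q where q: "hom_on takiff ?P (prod_struct (mid E1) (mid E2)) (mid E) q" "q ` ?P = UNIV"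
    "{z \<in> ?P. q z = 0} = range (\<lambda>w. (incl E1 w, - incl E2 w))"
    "\<forall>w. incl E w = q (incl E1 w, 0)" "\<forall>(a, b)\<in>?P. proj E (q (a, b)) = proj E1 a"
    using b unfolding is_baer_sum_def Let_def by blast
  show ?thesis
    unfolding is_baer_sum_def Let_def
  proof (intro exI[of _ "f \<circ> q"] conjI)
    show "hom_on takiff ?P (prod_struct (mid E1) (mid E2)) (mid E') (f \<circ> q)"
      using q(1) f(1) unfolding hom_on_def by (simp del: split_paired_All split_paired_Ball_Sigma)
    show "(f \<circ> q) ` ?P = UNIV"
      using q(2) f(2) by (metis bij_is_surj image_comp)
    show "{z \<in> ?P. (f \<circ> q) z = 0} = range (\<lambda>w. (incl E1 w, - incl E2 w))"
      unfolding q(3)[symmetric] by (simp add: f0)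
    show "\<forall>w. incl E' w = (f \<circ> q) (incl E1 w, 0)"
      using q(4) f3 by (metis comp_apply)
    show "\<forall>(a, b)\<in>?P. proj E' ((f \<circ> q) (a, b)) = proj E1 a"
      using q(5) by (simp add: f4 case_prod_beta)
  qed
qed

lemma multiple_transport:
  assumes b: "is_ext_multiple W a E1 E" and eq: "ext_equivalent E E'"
  shows "is_ext_multiple W a E1 E'"
proof -
  obtain f where f: "hom_on takiff UNIV (mid E) (mid E') f" "bij f" "f \<circ> incl E = incl E'" "proj E' \<circ> f = proj E"
    using eq by (auto simp: ext_equivalent_def)
  have f0: "f x = 0 \<longleftrightarrow> x = 0" for x
    using hom_on_cancel(1)[OF f(1)] bij_is_inj[OF f(2)] by (metis injD)
  have f3: "f (incl E w) = incl E' w" and f4: "proj E' (f x) = proj E x" for w x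
    using f(3,4) by (simp_all add: fun_eq_iff del: split_paired_All)
  obtain q where q: "hom_on takiff UNIV (prod_struct W (mid E1)) (mid E) q" "surj q"
    "{z. q z = 0} = range (\<lambda>w. (scal W a w, - incl E1 w))"
    "\<forall>w. incl E w = q (w, 0)" "\<forall>w e. proj E (q (w, e)) = proj E1 e"
    using b unfolding is_ext_multiple_def by blast
  show ?thesis
    unfolding is_ext_multiple_def
  proof (intro exI[of _ "f \<circ> q"] conjI)
    show "hom_on takiff UNIV (prod_struct W (mid E1)) (mid E') (f \<circ> q)"
      using q(1) f(1) unfolding hom_on_def by (simp del: split_paired_All)
    show "surj (f \<circ> q)"
      using q(2) f(2) by (metis bij_is_surj image_comp)
    show "{z. (f \<circ> q) z = 0} = range (\<lambda>w. (scal W a w, - incl E1 w))"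
      unfolding q(3)[symmetric] by (simp add: f0)
    show "\<forall>w. incl E' w = (f \<circ> q) (w, 0)"
      using q(4) f3 by (metis comp_apply)
    show "\<forall>w e. proj E' ((f \<circ> q) (w, e)) = proj E1 e"
      using q(5) by (simp add: f4)
  qed
qed

section \<open>The classification of self-extensions\<close>

locale infinite_hc_module = hc_module V +
  takiff_basis "scal V" "act V (mat_e, 0)" "act V (mat_f, 0)" "act V (mat_h, 0)"
    "act V (0, mat_e)" "act V (0, mat_f)" "act V (0, mat_h)" u n \<zeta> \<kappa>
  for V :: "'v::ab_group_add takiff_struct" and u n \<zeta> \<kappa>
begin

lemma casimir_scalar: "casimir V v = scal V \<zeta> v"
  using Cas[of v] by (simp add: casimir_Cas[OF module])

lemma u_nonzero: "u \<noteq> 0"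
  using nonzero[of 0] by simp

text \<open>A splitting of \<open>cext V D\<close> sends v to (\<sigma> v, v), and its equivariance
  is the equation for \<open>D\<close>.\<close>

lemma coboundary:
  assumes D: "cocycle V D" and shift: "cas_shift V \<zeta> (cext V D) 0"
  shows "\<exists>\<sigma>. (\<forall>v w. \<sigma> (v + w) = \<sigma> v + \<sigma> w) \<and> (\<forall>c v. \<sigma> (scal V c v) = scal V c (\<sigma> v)) \<and>
    (\<forall>X\<in>takiff. \<forall>v. D X v = \<sigma> (act V X v) - act V X (\<sigma> v))"
proof -
  let ?E = "cext V D" and ?M = "mid (cext V D)"
  have E: "is_extension V V ?E" by (rule cext_extension[OF module D])
  have M: "takiff_module ?M" by (rule extensionD(1)[OF E])
  note mem = tensor_in_takiff[OF mat_in_sl2(1)] tensor_in_takiff[OF mat_in_sl2(2)] tensor_in_takiff[OF mat_in_sl2(3)]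
  note i = hom_onD(3)[OF extensionD(2)[OF E] UNIV_I] and p = hom_onD(3)[OF extensionD(3)[OF E] UNIV_I]
  interpret E: takiff_rep "scal ?M" "act ?M (mat_e, 0)" "act ?M (mat_f, 0)" "act ?M (mat_h, 0)"
    "act ?M (0, mat_e)" "act ?M (0, mat_f)" "act ?M (0, mat_h)"
    by (rule module_rep[OF M])
  interpret X: takiff_extension "scal V" "act V (mat_e, 0)" "act V (mat_f, 0)" "act V (mat_h, 0)"
    "act V (0, mat_e)" "act V (0, mat_f)" "act V (0, mat_h)" u n \<zeta> \<kappa>
    "scal ?M" "act ?M (mat_e, 0)" "act ?M (mat_f, 0)" "act ?M (mat_h, 0)"
    "act ?M (0, mat_e)" "act ?M (0, mat_f)" "act ?M (0, mat_h)" "incl ?E" "proj ?E"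
  proof (intro takiff_extension.intro takiff_extension_axioms.intro)
    show "Vector_Spaces.linear (scal V) (scal ?M) (incl ?E)"
      by (rule hom_linear[OF module M extensionD(2)[OF E]])
    show "Vector_Spaces.linear (scal ?M) (scal V) (proj ?E)"
      by (rule hom_linear[OF M module extensionD(3)[OF E]])
    show "surj (proj ?E)" by (rule extensionD(5)[OF E])
    show "proj ?E y = 0 \<longleftrightarrow> y \<in> range (incl ?E)" for y by (rule extensionD(6)[OF E])
    show "x = 0" if "incl ?E x = 0" for x using that by (simp add: zero_prod_def)
  qed (rule takiff_basis_axioms E.takiff_rep_axioms i p mem)+
  have "E.Cas y = scal ?M \<zeta> y" for y
    using shift[unfolded cas_shift_def, rule_format, of y]
    by (simp add: casimir_Cas[OF M] del: cext_sel(1,2) flip: zero_prod_def)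
  from X.split[OF this] obtain s where s: "Vector_Spaces.linear (scal V) (scal ?M) s" "\<And>x. proj ?E (s x) = x"
    "\<And>A x. A \<in> {mat_e, mat_f, mat_h} \<Longrightarrow>
      s (act V (A, 0) x) = act ?M (A, 0) (s x) \<and> s (act V (0, A) x) = act ?M (0, A) (s x)"
    by (metis (no_types, lifting) insert_iff singletonD)
  have "hom_on takiff UNIV V ?M s"
    by (rule homI[OF module M s(1)]) (rule s(3))
  note h = hom_onD[OF this UNIV_I]
  have snd: "snd (s x) = x" for x using s(2)[of x] by simp
  have "D X v = fst (s (act V X v)) - act V X (fst (s v))" if "X \<in> takiff" for X v
    using h(3)[OF that, of v] by (simp add: snd)
  moreover have "fst (s (v + w)) = fst (s v) + fst (s w)" "fst (s (scal V c v)) = scal V c (fst (s v))" for v w c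
    by (simp_all add: h(1,2))
  ultimately show ?thesis by (intro exI[of _ "\<lambda>v. fst (s v)"]) simp
qed

text \<open>Additivity of the shift reduces equal shifts to shift zero: the difference of the
  cocycles is then the coboundary of some \<sigma>, and the shear by -\<sigma> is the
  equivalence.\<close>

lemma cext_equivalent:
  assumes D: "cocycle V D" "cocycle V D'"
    and c: "cas_shift V \<zeta> (cext V D) c" "cas_shift V \<zeta> (cext V D') c"
  shows "ext_equivalent (cext V D) (cext V D')"
proof -
  let ?N = "\<lambda>X v. scal V (- 1) (D' X v)"
  let ?B = "\<lambda>X v. D X v + ?N X v"
  have N: "cocycle V ?N" by (rule cocycle_scale[OF module D(2)])
  have B: "cocycle V ?B" by (rule cocycle_add[OF module D(1) N])
  have "cas_shift V \<zeta> (cext V ?N) (- 1 * c)"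
    by (rule cas_shift_multiple[OF module cext_extension[OF module D(2)] c(2) casimir_scalar cext_multiple[OF module]])
  then have "cas_shift V \<zeta> (cext V ?B) (c + - 1 * c)"
    by (intro cas_shift_baer[OF module cext_extension[OF module D(1)] cext_extension[OF module N] c(1) _ cext_baer[OF module]])
  then have "cas_shift V \<zeta> (cext V ?B) 0" by simp
  from coboundary[OF B this] obtain \<sigma> where \<sigma>: "\<And>v w. \<sigma> (v + w) = \<sigma> v + \<sigma> w"
    "\<And>c v. \<sigma> (scal V c v) = scal V c (\<sigma> v)"
    "\<forall>X\<in>takiff. \<forall>v. ?B X v = \<sigma> (act V X v) - act V X (\<sigma> v)"
    by blast
  have D_eq: "D X v = D' X v + \<sigma> (act V X v) - act V X (\<sigma> v)" if "X \<in> takiff" for X v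
    using bspec[OF \<sigma>(3) that, THEN spec, of v] by (simp add: algebra_simps)
  have \<sigma>0: "\<sigma> 0 = 0" using \<sigma>(1)[of 0 0] by simp
  let ?f = "\<lambda>z. (fst z - \<sigma> (snd z), snd z)"
  show ?thesis
    unfolding ext_equivalent_def
  proof (intro exI[of _ ?f] conjI)
    show "hom_on takiff UNIV (mid (cext V D)) (mid (cext V D')) ?f"
      unfolding hom_on_def
      by (simp add: \<sigma>(1,2) scale_right_diff_distrib module_simps[OF module] D_eq)
    show "bij ?f"
      by (rule bij_betw_byWitness[where f' = "\<lambda>z. (fst z + \<sigma> (snd z), snd z)"]) auto
  qed (simp_all add: fun_eq_iff \<sigma>0)
qed

lemma ext_equivalent_sym:
  assumes "E \<in> extensions W V" "E' \<in> extensions W V" "ext_equivalent E E'"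
  shows "ext_equivalent E' E"
  using equiv_ext_rel[of W V] assms unfolding equiv_def sym_def ext_rel_def by blast

lemma ext_equivalent_trans:
  assumes "E \<in> extensions W V" "E' \<in> extensions W V" "E'' \<in> extensions W V"
    "ext_equivalent E E'" "ext_equivalent E' E''"
  shows "ext_equivalent E E''"
  using equiv_ext_rel[of W V] assms unfolding equiv_def trans_def ext_rel_def by blast

text \<open>The converse passes to cocycle models, where \<open>cext_equivalent\<close> applies; the
  shift carries over to them since it is invariant under equivalence.\<close>

lemma ext_equivalent_iff:
  assumes E: "E \<in> extensions V V" "E' \<in> extensions V V" and c: "cas_shift V \<zeta> E c"
  shows "ext_equivalent E E' \<longleftrightarrow> cas_shift V \<zeta> E' c"
proof
  assume "ext_equivalent E E'"
  then show "cas_shift V \<zeta> E' c"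
    using cas_shift_equivalent[OF module _ _ c] E by (simp add: extensions_def)
next
  assume c': "cas_shift V \<zeta> E' c"
  have ext: "cext V D \<in> extensions V V" if "cocycle V D" for D
    using cext_extension[OF module that] by (simp add: extensions_def)
  have cext: "\<exists>D. cocycle V D \<and> ext_equivalent (cext V D) E \<and> cas_shift V \<zeta> (cext V D) c"
    if E: "E \<in> extensions V V" "cas_shift V \<zeta> E c" for E :: "('v, 'v \<times> 'v, 'v) extension"
  proof -
    obtain D where D: "cocycle V D" "ext_equivalent (cext V D) E"
      using extension_cocycle[OF module, of E] E(1) by (auto simp: extensions_def)
    have "cas_shift V \<zeta> (cext V D) c"
      using cas_shift_equivalent[OF module _ ext_equivalent_sym[OF ext[OF D(1)] E(1) D(2)] E(2)] E(1)
      by (simp add: extensions_def)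
    then show ?thesis using D by blast
  qed
  obtain D D' where D: "cocycle V D" "ext_equivalent (cext V D) E" "cas_shift V \<zeta> (cext V D) c"
    "cocycle V D'" "ext_equivalent (cext V D') E'" "cas_shift V \<zeta> (cext V D') c"
    using cext[OF E(1) c] cext[OF E(2) c'] by blast
  show "ext_equivalent E E'"
    by (meson D E ext cext_equivalent ext_equivalent_sym ext_equivalent_trans)
qed

text \<open>The grading derivation \<open>A \<otimes> 1 + B \<otimes> x \<mapsto> B \<otimes> x\<close> yields the non-split extensions.\<close>

lemma cas_shift_surjective: "\<exists>D. cocycle V D \<and> cas_shift V \<zeta> (cext V D) c"
proof -
  \<comment> \<open>Solves 2 b \<zeta> = c; the factor 2 arises because the Casimir operator is
    quadratic in the action of sl2 \<otimes> x.\<close>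
  define b where "b = c / (2 * \<zeta>)"
  define D where "D X v = scal V b (act V (0, snd X) v)" for X :: takiff_elt and v
  note vs = module_simps[OF module]
  have mem: "(0, snd X) \<in> takiff" if "X \<in> takiff" for X
    using that by (auto simp: takiff_def)
  \<comment> \<open>The third identity says that taking X to (0, snd X) is a derivation of the
    Takiff algebra; under the action it becomes the cocycle condition.\<close>
  have add: "(0 :: complex^2^2, snd (X + Y)) = (0, snd X) + (0, snd Y)"
    and sm: "(0 :: complex^2^2, snd (takiff_smult a X)) = takiff_smult a (0, snd X)"
    and br: "(0 :: complex^2^2, snd (takiff_bracket X Y)) = takiff_bracket X (0, snd Y) + takiff_bracket (0, snd X) Y"
    for X Y :: takiff_elt and a
    by (simp_all add: takiff_smult_def takiff_bracket_def mat_brackets)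
  have act_add: "act V (0, snd X + snd Y) v = act V (0, snd X) v + act V (0, snd Y) v"
    if "X \<in> takiff" "Y \<in> takiff" for X Y v
    using vs(5)[OF mem mem, OF that] by simp
  have D: "cocycle V D"
    unfolding cocycle_def D_def add sm br
    by (simp add: act_add vs mem takiff_closed scale_right_distrib scale_right_diff_distrib mult.commute algebra_simps
        del: split_paired_Ball_Sigma)
  note memb = tensor_in_takiff[OF mat_in_sl2(1)] tensor_in_takiff[OF mat_in_sl2(2)] tensor_in_takiff[OF mat_in_sl2(3)]
  have "casimir (mid (cext V D)) y = scal (mid (cext V D)) \<zeta> y + incl (cext V D) (scal V c (proj (cext V D) y))" for y
  proof -
    have "casimir (mid (cext V D)) y = (casimir V (fst y) + scal V (2 * b) (casimir V (snd y)), casimir V (snd y))"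
    proof -
      \<comment> \<open>The coefficients 1 and 4 of the Casimir operator lead to 2 b and 8 b, with
        one contribution from each of the two factors.\<close>
      have "scal V (b * 2) x = scal V b x + scal V b x" "scal V (b * 8) x = scal V (b * 4) x + scal V (b * 4) x" for x
        by (simp_all flip: scale_left_distrib)
      then show ?thesis
        by (simp add: casimir_def D_def vs memb scale_right_distrib algebra_simps)
    qed
    also have "\<dots> = (scal V \<zeta> (fst y) + scal V c (snd y), scal V \<zeta> (snd y))"
      using chi by (simp add: casimir_scalar b_def)
    finally show ?thesis by simp
  qed
  then have "cas_shift V \<zeta> (cext V D) c" unfolding cas_shift_def by blast
  with D show ?thesis by blast
qed

section \<open>The classes of Ext1 as fibres of the shift\<close>

definition shift_class :: "complex \<Rightarrow> ('v, 'v \<times> 'v, 'v) extension set" where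
  "shift_class c = {E \<in> extensions V V. cas_shift V \<zeta> E c}"

lemma shift_class_witness:
  obtains D where "cocycle V D" "cext V D \<in> shift_class c"
  using cas_shift_surjective[of c] cext_extension[OF module] by (auto simp: shift_class_def extensions_def)

lemma shift_class_inj: "shift_class c = shift_class c' \<Longrightarrow> c = c'"
  using shift_class_witness[of c] cas_shift_unique[OF module _ u_nonzero]
  by (metis (no_types, lifting) extensions_def mem_Collect_eq shift_class_def)

text \<open>Every self-extension has a shift, and by \<open>ext_equivalent_iff\<close> the
  equivalence classes are the fibres of the shift; \<open>shift_class_witness\<close> shows that no
  fibre is empty.\<close>

lemma Ext1_eq: "Ext1 V V = range shift_class"
proof -
  have cl: "ext_rel V V `` {E} = shift_class c" if "E \<in> extensions V V" "cas_shift V \<zeta> E c" for E c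
    using ext_equivalent_iff[OF that(1) _ that(2)] that(1) by (auto simp: ext_rel_def shift_class_def)
  show ?thesis
  proof (intro set_eqI iffI)
    fix \<alpha> assume "\<alpha> \<in> Ext1 V V"
    then obtain E where E: "E \<in> extensions V V" "\<alpha> = ext_rel V V `` {E}"
      by (auto simp: Ext1_def elim: quotientE)
    obtain c where "cas_shift V \<zeta> E c"
      using cas_shift_exists[OF hc_module_axioms _ casimir_scalar] E(1) by (auto simp: extensions_def)
    then show "\<alpha> \<in> range shift_class" using cl E by blast
  next
    fix \<alpha> assume "\<alpha> \<in> range shift_class"
    then obtain c where c: "\<alpha> = shift_class c" by blast
    obtain D where "cext V D \<in> shift_class c" by (rule shift_class_witness)
    then have D: "cext V D \<in> extensions V V" "cas_shift V \<zeta> (cext V D) c"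
      by (simp_all add: shift_class_def)
    show "\<alpha> \<in> Ext1 V V"
      unfolding c cl[OF D, symmetric] Ext1_def by (rule quotientI[OF D(1)])
  qed
qed

text \<open>One inclusion is the additivity of the shift. For the other, a given \<open>E\<close> is
  equivalent to the sum of two cocycle extensions with shifts \<open>a\<close> and \<open>b\<close>,
  and is therefore itself a Baer sum of them.\<close>

lemma Ext1_add_shift: "Ext1_add V V (shift_class a) (shift_class b) = shift_class (a + b)"
proof (intro set_eqI iffI)
  fix E assume "E \<in> Ext1_add V V (shift_class a) (shift_class b)"
  then show "E \<in> shift_class (a + b)"
    using cas_shift_baer[OF module] by (auto simp: Ext1_add_def shift_class_def extensions_def)
next
  fix E assume E: "E \<in> shift_class (a + b)"
  obtain D D' where D: "cocycle V D" "cext V D \<in> shift_class a" "cocycle V D'" "cext V D' \<in> shift_class b"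
    using shift_class_witness by metis
  let ?S = "cext V (\<lambda>X v. D X v + D' X v)"
  have S: "?S \<in> extensions V V"
    using cext_extension[OF module cocycle_add[OF module D(1,3)]] by (simp add: extensions_def)
  have "cas_shift V \<zeta> ?S (a + b)"
    using D(2,4) by (intro cas_shift_baer[OF module _ _ _ _ cext_baer[OF module]])
      (auto simp: shift_class_def extensions_def)
  then have "ext_equivalent ?S E"
    using E S by (subst ext_equivalent_iff) (auto simp: shift_class_def)
  then have "is_baer_sum (cext V D) (cext V D') E"
    by (rule baer_transport[OF cext_baer[OF module]])
  then show "E \<in> Ext1_add V V (shift_class a) (shift_class b)"
    using D E by (auto simp: Ext1_add_def shift_class_def)
qed

lemma Ext1_scale_shift: "Ext1_scale V V a (shift_class b) = shift_class (a * b)"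
proof (intro set_eqI iffI)
  fix E assume "E \<in> Ext1_scale V V a (shift_class b)"
  then show "E \<in> shift_class (a * b)"
    using cas_shift_multiple[OF module _ _ casimir_scalar] by (auto simp: Ext1_scale_def shift_class_def extensions_def)
next
  fix E assume E: "E \<in> shift_class (a * b)"
  obtain D where D: "cocycle V D" "cext V D \<in> shift_class b"
    by (rule shift_class_witness)
  let ?S = "cext V (\<lambda>X v. scal V a (D X v))"
  have S: "?S \<in> extensions V V"
    using cext_extension[OF module cocycle_scale[OF module D(1)]] by (simp add: extensions_def)
  have "cas_shift V \<zeta> ?S (a * b)"
    using D(2) by (intro cas_shift_multiple[OF module _ _ casimir_scalar cext_multiple[OF module]])
      (auto simp: shift_class_def extensions_def)
  then have "ext_equivalent ?S E"
    using E S by (subst ext_equivalent_iff) (auto simp: shift_class_def)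
  then have "is_ext_multiple V a (cext V D) E"
    by (rule multiple_transport[OF cext_multiple[OF module]])
  then show "E \<in> Ext1_scale V V a (shift_class b)"
    using D E by (auto simp: Ext1_scale_def shift_class_def)
qed

lemma Ext1_line: "iso_complex_line (Ext1 V V) (Ext1_add V V) (Ext1_scale V V)"
proof -
  have inj: "inj shift_class" by (rule injI) (rule shift_class_inj)
  then have "bij_betw (inv shift_class) (range shift_class) UNIV"
    using bij_betw_inv_into[of shift_class UNIV "range shift_class"] by (simp add: bij_betw_def)
  then show ?thesis
    unfolding iso_complex_line_def Ext1_eq
    by (auto simp: Ext1_add_shift Ext1_scale_shift inv_f_f[OF inj] intro!: exI[of _ "inv shift_class"])
qed

end

theorem theorem31:
  fixes V :: "'v::ab_group_add takiff_struct"
  assumes "simple_takiff_module V"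
    and "harish_chandra V"
    and "\<not> finite_dim V UNIV"
  shows "iso_complex_line (Ext1 V V) (Ext1_add V V) (Ext1_scale V V)"
proof -
  interpret hc_module V by (rule hc_module.intro[OF assms(1,2)])
  obtain u n \<zeta> \<kappa> where "takiff_basis (scal V) (act V (mat_e, 0)) (act V (mat_f, 0)) (act V (mat_h, 0))
    (act V (0, mat_e)) (act V (0, mat_f)) (act V (0, mat_h)) u n \<zeta> \<kappa>"
    by (rule basis_exists[OF assms(3)])
  then interpret infinite_hc_module V u n \<zeta> \<kappa>
    by (intro infinite_hc_module.intro hc_module_axioms)
  show ?thesis by (rule Ext1_line)
qed

end
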